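(* Let $F$ be a bipartite graph and let $r,\Delta\ge 2$ be integers such that $F$ has a bipartition $S\cup T$ and a vertex $v^*\in T$ such that every vertex in $T\setminus\{v^*\}$ has degree at most $r$ in $F$ and every $u\in S$ satisfies $|N_F(u)\cup\{v^*\}|\le \Delta$. Then there exists a constant $C$ such that for every $p=p(n)\in[0,1]$ with $p\ge n^{-\frac{r-1}{r\Delta-1}}(\log n)^C$ we have a.a.s. \[\mathrm{ex}(G_{n,p},F)=O\left(p^{1-1/r}n^{2-1/r}\right).\] If moreover $F$ contains a subgraph isomorphic to a complete bipartite graph $K_{r,t}$ (for some $t$) satisfying $\mathrm{ex}(n,K_{r,t})=\Theta(n^{2-1/r})$, then for every $p=p(n)\in[0,1]$ with $p\ge n^{-\frac{r-1}{r\Delta-1}}(\log n)^C$ we have a.a.s. \[\mathrm{ex}(G_{n,p},F)=\Theta\left(p^{1-1/r}n^{2-1/r}\right).\]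
   Context: All graphs are finite and simple. $N_F(u)$ is the set of neighbours of $u$ in $F$. $\mathrm{ex}(n,F)$ is the maximum number of edges in an $n$-vertex $F$-free graph. $G_{n,p}$ is the random graph on $n$ vertices in which each possible edge is included independently with probability $p$, and $\mathrm{ex}(G_{n,p},F)$ is the maximum number of edges in an $F$-free subgraph of $G_{n,p}$ (here "$F$-free" means containing no, not necessarily induced, subgraph isomorphic to $F$). A sequence of events $A_n$ holds asymptotically almost surely (a.a.s.) if $\Pr[A_n]\to1$ as $n\to\infty$. For a random variable $X_n$, "a.a.s. $X_n=O(g(n))$" means that there is a constant $K>0$ depending only on the fixed data ($F$, $r$, $\Delta$, the bipartition) such that a.a.s. $X_n\le Kg(n)$; "a.a.s. $X_n=\Theta(g(n))$" means there is such a $K$ with a.a.s. $K^{-1}g(n)\le X_n\le Kg(n)$. *)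

theory Defs
  imports
    "HOL-Probability.Probability"
    "HOL-Probability.Product_PMF"
    "HOL-Library.Landau_Symbols"
begin

type_synonym 'a graph = "'a set \<times> 'a set set"

abbreviation verts :: "'a graph \<Rightarrow> 'a set" where
  "verts \<equiv> fst"

abbreviation edges :: "'a graph \<Rightarrow> 'a set set" where
  "edges \<equiv> snd"

definition simple_graph :: "'a graph \<Rightarrow> bool" where
  "simple_graph G \<longleftrightarrow> finite (verts G) \<and> (\<forall>e\<in>edges G. e \<subseteq> verts G \<and> card e = 2)"

definition neighbours :: "'a graph \<Rightarrow> 'a \<Rightarrow> 'a set" where
  "neighbours G u = {w. {u, w} \<in> edges G}"

definition vertex_degree :: "'a graph \<Rightarrow> 'a \<Rightarrow> nat" where
  "vertex_degree G u = card (neighbours G u)"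

definition bipartition :: "'a graph \<Rightarrow> 'a set \<Rightarrow> 'a set \<Rightarrow> bool" where
  "bipartition G S T \<longleftrightarrow>
     S \<union> T = verts G \<and> S \<inter> T = {} \<and> (\<forall>e\<in>edges G. \<exists>s\<in>S. \<exists>t\<in>T. e = {s, t})"

definition subgraph :: "'a graph \<Rightarrow> 'a graph \<Rightarrow> bool" where
  "subgraph H G \<longleftrightarrow> simple_graph H \<and> verts H \<subseteq> verts G \<and> edges H \<subseteq> edges G"

definition isomorphic :: "'a graph \<Rightarrow> 'b graph \<Rightarrow> bool" where
  "isomorphic G H \<longleftrightarrow>
     (\<exists>f. bij_betw f (verts G) (verts H) \<and> edges H = (\<lambda>e. f ` e) ` edges G)"

definition contains_copy :: "'a graph \<Rightarrow> 'b graph \<Rightarrow> bool" where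
  "contains_copy G F \<longleftrightarrow> (\<exists>H. subgraph H G \<and> isomorphic H F)"

abbreviation free_of :: "'b graph \<Rightarrow> 'a graph \<Rightarrow> bool" where
  "free_of F G \<equiv> \<not> contains_copy G F"

definition complete_bipartite :: "nat \<Rightarrow> nat \<Rightarrow> (nat + nat) graph" where
  "complete_bipartite r t =
     (Inl ` {..<r} \<union> Inr ` {..<t}, {{Inl i, Inr j} | i j. i < r \<and> j < t})"

text \<open>The edge numbers below are bounded (in \<open>ex_in\<close>, for finite \<open>G\<close>), so \<^const>\<open>Sup\<close> is their maximum. If there is
  no \<open>F\<close>-free graph to choose from (possible only if \<open>F\<close> has no edges, or no vertices), the value
  is \<open>Sup {} = 0\<close>.\<close>

definition ex_number :: "nat \<Rightarrow> 'b graph \<Rightarrow> nat" where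
  "ex_number n F = Sup {card (edges H) | H :: nat graph.
                   simple_graph H \<and> card (verts H) = n \<and> free_of F H}"

definition ex_in :: "'a graph \<Rightarrow> 'b graph \<Rightarrow> nat" where
  "ex_in G F = Sup {card (edges H) | H. subgraph H G \<and> free_of F H}"

definition all_edges :: "nat \<Rightarrow> nat set set" where
  "all_edges n = {e. e \<subseteq> {..<n} \<and> card e = 2}"

definition random_graph :: "nat \<Rightarrow> real \<Rightarrow> nat graph pmf" where
  "random_graph n p =
     map_pmf (\<lambda>\<omega>. ({..<n}, {e \<in> all_edges n. \<omega> e}))
       (Pi_pmf (all_edges n) False (\<lambda>_. bernoulli_pmf p))"

definition aas :: "(nat \<Rightarrow> 'a pmf) \<Rightarrow> (nat \<Rightarrow> 'a \<Rightarrow> bool) \<Rightarrow> bool" where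
  "aas M A \<longleftrightarrow> (\<lambda>n. measure_pmf.prob (M n) {x. A n x}) \<longlonglongrightarrow> 1"

text \<open>The lower bound on \<open>p\<close> is required for all sufficiently large \<open>n\<close> only: for large \<open>C\<close> the
  threshold exceeds 1 for some small \<open>n\<close>, so that no \<open>p\<close> with values in \<open>[0,1]\<close> could satisfy it
  for every \<open>n\<close>.\<close>

definition admissible_prob :: "nat \<Rightarrow> nat \<Rightarrow> real \<Rightarrow> (nat \<Rightarrow> real) \<Rightarrow> bool" where
  "admissible_prob r \<Delta> C p \<longleftrightarrow>
     (\<forall>n. 0 \<le> p n \<and> p n \<le> 1) \<and>
     (\<forall>\<^sub>F n in sequentially.
        p n \<ge> real n powr (- ((real r - 1) / (real r * real \<Delta> - 1))) * ln (real n) powr C)"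

end

theory Submission
  imports Defs "HOL-Probability.Hoeffding"
begin

text \<open>
Both bounds have order \<open>m\<^sub>0 = p^(1-1/r) n^(2-1/r)\<close>, which is \<open>p\<close> times \<open>M\<^sub>0 = p^(-1/r) n^(2-1/r)\<close>.
The upper bound is a first-moment argument over containers, the lower bound thins a blow-up of an
extremal graph.

\<^bold>\<open>Upper bound.\<close> An edge set \<open>I\<close> lies in the random graph with probability \<open>p^|I|\<close>.  Hence some
\<open>F\<close>-free edge set with at least \<open>x\<close> edges lies in it with probability at most \<open>exp (-x) * Z\<close>, where
\<open>Z\<close> is the sum of \<open>(e p)^|I|\<close> over all \<open>F\<close>-free \<open>I\<close>: the hard-core partition function of the
hypergraph of copies of \<open>F\<close> (\<open>prob_large_member\<close>).  It therefore suffices that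
\<open>Z \<le> exp (O(m\<^sub>0))\<close>, which is \<open>hard_core_bound\<close>.

To bound the partition function of an edge set \<open>E\<close> of size \<open>N = z M\<^sub>0\<close> with \<open>z\<close> above a constant, every
\<open>F\<close>-free \<open>I \<subseteq> E\<close> is enclosed in a container of size at most \<open>(1 - \<delta>) N\<close> that is determined by a
fingerprint of \<open>O(\<tau> N)\<close> elements of \<open>I\<close>; this costs a factor \<open>exp (O(\<tau> N (1 + log z)))\<close> and the
argument is repeated inside the container.  Two terms enter \<open>\<tau>\<close>.  One is \<open>k^(-r)\<close> with
\<open>N = k n^(2-1/r)\<close>; its costs form a geometric series dominated by the last step, of total order
\<open>m\<^sub>0\<close>.  The other contributes at most \<open>m\<^sub>0 / log n\<close> in each of \<open>O(log n)\<close> steps, and this is what the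
lower bound on \<open>p\<close> is for.  Below \<open>O(M\<^sub>0)\<close> edges the trivial bound \<open>exp (e p N)\<close> suffices.

Containers exist (\<open>containers\<close>) for every hypergraph with a weight on its edges such that the
total weight of the edges through \<open>j\<close> given vertices is at most \<open>K \<tau>^(j-1)\<close> times the total weight
divided by the number of vertices.  A fingerprint is a set \<open>G \<subseteq> I\<close> maximising the weight of a well-spread hypergraph that can be
formed from the links of its elements, minus a cost for each element; maximality makes the set of
elements that would not increase this weight by much a container.

A graph with \<open>k n^(2-1/r)\<close> edges carries such a weight on copies of \<open>F\<close> (\<open>spread_weight\<close>).  After
adding edges and vertices one may assume that \<open>v\<close> is adjacent to all of \<open>S\<close> and that all other
vertices of \<open>T\<close> have degree exactly \<open>r\<close>.  A copy is chosen at random: first the image \<open>x\<close> of \<open>v\<close>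
with probability proportional to its degree, then the images of \<open>S\<close> independently among the
neighbours of \<open>x\<close>, then the other vertices of \<open>T\<close> among the common neighbours of their \<open>r\<close>
neighbours, with weight \<open>deg^(1-r)\<close>.  By double counting most \<open>r\<close>-tuples met in this way have
many common neighbours.  The weight \<open>deg^(1-r)\<close> makes the image of \<open>v\<close> and of any other vertex of \<open>T\<close>
exchangeable given their common neighbours, so that prescribing \<open>s'\<close> vertices of \<open>S\<close> and \<open>t'\<close>
vertices of \<open>T\<close> costs \<open>h^(1-s') \<eta>^(t'-1)\<close> whether or not \<open>v\<close> is among them; here \<open>h = |E|/n\<close> and
\<open>\<eta> = O(k^(-r))\<close>.  The degree conditions bound \<open>j\<close> edges on these vertices by
\<open>j \<le> (s'-1) \<Delta> + t'\<close> and \<open>j \<le> s' + r (t'-1)\<close>, which is exactly what the exponent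
\<open>(r-1)/(r \<Delta>-1)\<close> requires (\<open>exponent_tradeoff\<close>).

\<^bold>\<open>Lower bound.\<close> An extremal \<open>K\<^bsub>r,t\<^esub>\<close>-free graph on about \<open>n p\<close> vertices is blown up by a factor
\<open>b\<close> of order \<open>1/p\<close>.  Between two blobs that correspond to an edge, the random graph has about \<open>b\<close>
edges, a constant proportion of which meet no other such edge.  The graph of these isolated edges
projects injectively onto the extremal graph on every copy of \<open>K\<^bsub>r,t\<^esub>\<close>, so it is \<open>K\<^bsub>r,t\<^esub>\<close>-free
(\<open>thinned_free\<close>); distinct pairs of blobs are independent, and Hoeffding's inequality shows that it
has \<open>\<Omega>((n p)^(2-1/r) / p) = \<Omega>(m\<^sub>0)\<close> edges (\<open>thinned_concentration\<close>).
\<close>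

section \<open>Weighted hypergraph containers\<close>

text \<open>Hypergraphs are given by a weight function on the finite sets of vertices, so that edges of a
hypergraph may be counted with real multiplicities.  The value at the empty set is the total weight.\<close>

definition codegree :: "'e set \<Rightarrow> ('e set \<Rightarrow> real) \<Rightarrow> 'e set \<Rightarrow> real" where
  "codegree V w \<sigma> = (\<Sum>e | e \<subseteq> V \<and> \<sigma> \<subseteq> e. w e)"

text \<open>The hypothesis of the container theorem: the weight is no more concentrated, up to the factor \<open>K\<close>,
than that of a hypergraph in which fixing one further vertex of an edge costs a factor \<open>\<tau>\<close>.\<close>

definition spread :: "'e set \<Rightarrow> nat \<Rightarrow> ('e set \<Rightarrow> real) \<Rightarrow> real \<Rightarrow> real \<Rightarrow> bool" where
  "spread V l w K \<tau> \<longleftrightarrow> finite V \<and> (\<forall>e. 0 \<le> w e) \<and> (\<forall>e. 0 < w e \<longrightarrow> e \<subseteq> V \<and> card e = l) \<and>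
     0 < codegree V w {} \<and>
     (\<forall>\<sigma>. \<sigma> \<subseteq> V \<longrightarrow> \<sigma> \<noteq> {} \<longrightarrow>
        codegree V w \<sigma> \<le> K * \<tau> ^ (card \<sigma> - 1) * codegree V w {} / card V)"

lemma codegree_add: "codegree V (\<lambda>e. f e + g e) \<sigma> = codegree V f \<sigma> + codegree V g \<sigma>"
  by (simp add: codegree_def sum.distrib)

lemma codegree_nonneg: "(\<And>e. 0 \<le> w e) \<Longrightarrow> 0 \<le> codegree V w \<sigma>"
  by (simp add: codegree_def sum_nonneg)

lemma codegree_mono:
  "finite V \<Longrightarrow> (\<And>e. e \<subseteq> V \<Longrightarrow> \<sigma> \<subseteq> e \<Longrightarrow> f e \<le> g e) \<Longrightarrow> codegree V f \<sigma> \<le> codegree V g \<sigma>"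
  unfolding codegree_def by (rule sum_mono) auto

lemma sum_codegree:
  fixes w :: "'e set \<Rightarrow> real"
  assumes "finite V" "P \<subseteq> Pow V"
  shows "(\<Sum>\<sigma>\<in>P. codegree V w \<sigma>) = (\<Sum>e\<in>Pow V. card {\<sigma>\<in>P. \<sigma> \<subseteq> e} * w e)"
proof -
  have fP: "finite P" using assms finite_subset by blast
  have "(\<Sum>\<sigma>\<in>P. codegree V w \<sigma>) = (\<Sum>\<sigma>\<in>P. \<Sum>e\<in>Pow V. if \<sigma> \<subseteq> e then w e else 0)"
  proof (rule sum.cong[OF refl])
    fix \<sigma>
    have "{e. e \<subseteq> V \<and> \<sigma> \<subseteq> e} = {e \<in> Pow V. \<sigma> \<subseteq> e}" by auto
    thus "codegree V w \<sigma> = (\<Sum>e\<in>Pow V. if \<sigma> \<subseteq> e then w e else 0)"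
      using sum.inter_filter[of "Pow V" w] assms(1) by (simp only: codegree_def finite_Pow_iff)
  qed
  also have "\<dots> = (\<Sum>e\<in>Pow V. \<Sum>\<sigma>\<in>P. if \<sigma> \<subseteq> e then w e else 0)"
    by (rule sum.swap)
  also have "\<dots> = (\<Sum>e\<in>Pow V. card {\<sigma>\<in>P. \<sigma> \<subseteq> e} * w e)"
    using fP by (intro sum.cong refl) (simp add: sum.inter_filter [symmetric])
  finally show ?thesis .
qed

lemma sum_codegree_singletons:
  fixes w :: "'e set \<Rightarrow> real"
  assumes "finite V" "\<And>e. 0 < w e \<Longrightarrow> card e = l" "\<And>e. 0 \<le> w e"
  shows "(\<Sum>x\<in>V. codegree V w {x}) = l * codegree V w {}"
proof -
  have "(\<Sum>x\<in>V. codegree V w {x}) = (\<Sum>\<sigma>\<in>(\<lambda>x. {x}) ` V. codegree V w \<sigma>)"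
    by (simp add: sum.reindex)
  also have "\<dots> = (\<Sum>e\<in>Pow V. card {\<sigma>\<in>(\<lambda>x. {x}) ` V. \<sigma> \<subseteq> e} * w e)"
    using assms by (intro sum_codegree) auto
  also have "\<dots> = (\<Sum>e\<in>Pow V. l * w e)"
  proof (rule sum.cong[OF refl])
    fix e assume e: "e \<in> Pow V"
    have "{\<sigma>\<in>(\<lambda>x. {x}) ` V. \<sigma> \<subseteq> e} = (\<lambda>x. {x}) ` e" using e by blast
    hence "card {\<sigma>\<in>(\<lambda>x. {x}) ` V. \<sigma> \<subseteq> e} = card e" by (simp add: card_image)
    thus "card {\<sigma>\<in>(\<lambda>x. {x}) ` V. \<sigma> \<subseteq> e} * w e = l * w e"
      using assms(2)[of e] assms(3)[of e] by (cases "w e = 0") (auto simp: less_le)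
  qed
  also have "\<dots> = l * codegree V w {}"
    by (simp add: codegree_def sum_distrib_left Pow_def)
  finally show ?thesis .
qed

definition link :: "'e set \<Rightarrow> ('e set \<Rightarrow> real) \<Rightarrow> 'e \<Rightarrow> 'e set \<Rightarrow> real" where
  "link V w x e = (if x \<in> V \<and> x \<notin> e \<and> e \<subseteq> V then w (insert x e) else 0)"

text \<open>An edge of weight \<open>w e\<close> containing \<open>\<sigma>\<close> is counted once for each of its vertices outside \<open>\<sigma>\<close>.\<close>

lemma sum_codegree_link:
  fixes w :: "'e set \<Rightarrow> real"
  assumes "finite V" "\<And>e. 0 < w e \<Longrightarrow> card e = l" "\<And>e. 0 \<le> w e"
  shows "(\<Sum>x\<in>V. codegree V (link V w x) \<sigma>) \<le> l * codegree V w \<sigma>"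
proof -
  have "(\<Sum>x\<in>V. codegree V (link V w x) \<sigma>)
      = (\<Sum>(x,e)\<in>(SIGMA x:V. {e. e \<subseteq> V \<and> \<sigma> \<subseteq> e}). link V w x e)"
    unfolding codegree_def using assms by (subst sum.Sigma) auto
  also have "\<dots> = (\<Sum>(x,e)\<in>(SIGMA x:V. {e. e \<subseteq> V \<and> \<sigma> \<subseteq> e \<and> x \<notin> e}). w (insert x e))"
    using assms(1) by (intro sum.mono_neutral_cong_right) (auto simp: link_def)
  also have "\<dots> \<le> (\<Sum>(e,x)\<in>(SIGMA e:{e. e \<subseteq> V \<and> \<sigma> \<subseteq> e}. e). w e)"
  proof (rule sum_le_included[where i = "\<lambda>(e,x). (x, e - {x})"])
    show "finite (SIGMA x:V. {e. e \<subseteq> V \<and> \<sigma> \<subseteq> e \<and> x \<notin> e})"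
      using assms(1) by (intro finite_SigmaI) auto
    show "finite (SIGMA e:{e. e \<subseteq> V \<and> \<sigma> \<subseteq> e}. e)"
      using assms(1) by (intro finite_SigmaI) (simp, blast intro: finite_subset)
    show "\<forall>y\<in>SIGMA e:{e. e \<subseteq> V \<and> \<sigma> \<subseteq> e}. e. 0 \<le> (case y of (e, x) \<Rightarrow> w e)"
      using assms(3) by (simp split: prod.split)
    show "\<forall>s\<in>SIGMA x:V. {e. e \<subseteq> V \<and> \<sigma> \<subseteq> e \<and> x \<notin> e}.
       \<exists>t\<in>SIGMA e:{e. e \<subseteq> V \<and> \<sigma> \<subseteq> e}. e.
          (case t of (e, x) \<Rightarrow> (x, e - {x})) = s \<and>
          (case s of (x, e) \<Rightarrow> w (insert x e)) \<le> (case t of (e, x) \<Rightarrow> w e)"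
    proof
      fix s assume "s \<in> (SIGMA x:V. {e. e \<subseteq> V \<and> \<sigma> \<subseteq> e \<and> x \<notin> e})"
      then obtain x e where s: "s = (x,e)" "x \<in> V" "e \<subseteq> V" "\<sigma> \<subseteq> e" "x \<notin> e" by auto
      show "\<exists>t\<in>SIGMA e:{e. e \<subseteq> V \<and> \<sigma> \<subseteq> e}. e.
          (case t of (e, x) \<Rightarrow> (x, e - {x})) = s \<and>
          (case s of (x, e) \<Rightarrow> w (insert x e)) \<le> (case t of (e, x) \<Rightarrow> w e)"
        by (rule bexI[of _ "(insert x e, x)"]) (use s in auto)
    qed
  qed
  also have "\<dots> = (\<Sum>e | e \<subseteq> V \<and> \<sigma> \<subseteq> e. \<Sum>x\<in>e. w e)"
    using assms(1) by (subst sum.Sigma) (simp, blast intro: finite_subset, simp)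
  also have "\<dots> = (\<Sum>e | e \<subseteq> V \<and> \<sigma> \<subseteq> e. l * w e)"
  proof (rule sum.cong[OF refl])
    fix e show "(\<Sum>x\<in>e. w e) = l * w e"
      using assms(2)[of e] assms(3)[of e] by (cases "w e = 0") (auto simp: less_le)
  qed
  also have "\<dots> = l * codegree V w \<sigma>" by (simp add: codegree_def sum_distrib_left)
  finally show ?thesis .
qed

lemma codegree_link_le:
  fixes w :: "'e set \<Rightarrow> real"
  assumes "finite V" "\<And>e. 0 \<le> w e"
  shows "codegree V (link V w x) \<sigma> \<le> codegree V w (insert x \<sigma>)"
proof (cases "x \<in> V \<and> x \<notin> \<sigma>")
  case True
  have "codegree V (link V w x) \<sigma> = (\<Sum>e | e \<subseteq> V \<and> \<sigma> \<subseteq> e \<and> x \<notin> e. w (insert x e))"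
    unfolding codegree_def using assms True
    by (intro sum.mono_neutral_cong_right) (auto simp: link_def)
  also have "\<dots> = (\<Sum>e\<in>insert x ` {e. e \<subseteq> V \<and> \<sigma> \<subseteq> e \<and> x \<notin> e}. w e)"
    by (subst sum.reindex) (auto simp: inj_on_def)
  also have "\<dots> \<le> codegree V w (insert x \<sigma>)"
    unfolding codegree_def using assms True by (intro sum_mono2) auto
  finally show ?thesis .
next
  case False
  hence "codegree V (link V w x) \<sigma> = 0" unfolding codegree_def
    by (intro sum.neutral) (auto simp: link_def)
  thus ?thesis using codegree_nonneg[of w] assms by simp
qed

lemma codegree_singleton_eq_link:
  fixes w :: "'e set \<Rightarrow> real"
  assumes "finite V" "x \<in> V"
  shows "codegree V w {x} = codegree V (link V w x) {}"
proof -
  have "codegree V (link V w x) {} = (\<Sum>e | e \<subseteq> V \<and> x \<notin> e. w (insert x e))"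
    unfolding codegree_def using assms
    by (intro sum.mono_neutral_cong_right) (auto simp: link_def)
  also have "\<dots> = (\<Sum>e\<in>insert x ` {e. e \<subseteq> V \<and> x \<notin> e}. w e)"
    by (subst sum.reindex) (auto simp: inj_on_def)
  also have "insert x ` {e. e \<subseteq> V \<and> x \<notin> e} = {e. e \<subseteq> V \<and> {x} \<subseteq> e}"
  proof (rule Set.set_eqI)
    fix e
    show "e \<in> insert x ` {e. e \<subseteq> V \<and> x \<notin> e} \<longleftrightarrow> e \<in> {e. e \<subseteq> V \<and> {x} \<subseteq> e}"
      using assms(2) by (auto intro!: image_eqI[of _ _ "e - {x}"])
  qed
  finally show ?thesis by (simp add: codegree_def)
qed

text \<open>The \<open>l\<close>-uniform hypergraphs that can be formed from the links of the elements of \<open>F\<close> without exceeding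
prescribed codegrees.  Only the support is tied to the links, not the weights: this suffices for a set
that contains \<open>F\<close> and no edge of \<open>w\<close> to contain no edge of \<open>w'\<close>.  The bound for the empty set caps
the total weight.\<close>

definition feasible ::
  "'e set \<Rightarrow> nat \<Rightarrow> ('e set \<Rightarrow> real) \<Rightarrow> (nat \<Rightarrow> real) \<Rightarrow> 'e set \<Rightarrow> ('e set \<Rightarrow> real) \<Rightarrow> bool" where
  "feasible V l w b F w' \<longleftrightarrow> (\<forall>e. 0 \<le> w' e) \<and>
     (\<forall>e. 0 < w' e \<longrightarrow> e \<subseteq> V \<and> card e = l \<and> (\<exists>x\<in>F. 0 < w (insert x e))) \<and>
     (\<forall>\<sigma>\<subseteq>V. codegree V w' \<sigma> \<le> b (card \<sigma>))"

text \<open>The largest total weight that can be formed from the links of \<open>F\<close>, or rather the supremum, which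
near-optimal hypergraphs approach as closely as required.\<close>

definition capacity ::
  "'e set \<Rightarrow> nat \<Rightarrow> ('e set \<Rightarrow> real) \<Rightarrow> (nat \<Rightarrow> real) \<Rightarrow> 'e set \<Rightarrow> real" where
  "capacity V l w b F = Sup ((\<lambda>w'. codegree V w' {}) ` Collect (feasible V l w b F))"

lemma feasible_total_le: "feasible V l w b F w' \<Longrightarrow> codegree V w' {} \<le> b 0"
  unfolding feasible_def by (metis card.empty empty_subsetI)

lemma capacity_upper:
  fixes b :: "nat \<Rightarrow> real"
  assumes "feasible V l w b F w'"
  shows "codegree V w' {} \<le> capacity V l w b F"
  unfolding capacity_def
proof (rule cSup_upper)
  show "bdd_above ((\<lambda>w'. codegree V w' {}) ` Collect (feasible V l w b F))"
    using feasible_total_le[of V l w b F] by (intro bdd_aboveI[of _ "b 0"]) blast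
qed (use assms in blast)

lemma feasible_zero: "(\<And>j. 0 \<le> b j) \<Longrightarrow> feasible V l w b F (\<lambda>_. 0)"
  by (simp add: feasible_def codegree_def)

lemma near_optimal:
  fixes b :: "nat \<Rightarrow> real"
  assumes "\<And>j. 0 \<le> b j" "0 < c"
  obtains w' where "feasible V l w b F w'" "capacity V l w b F \<le> codegree V w' {} + c"
proof -
  let ?S = "(\<lambda>w'. codegree V w' {}) ` Collect (feasible V l w b F)"
  have ne: "?S \<noteq> {}"
    using feasible_zero[of b, OF assms(1)] by blast
  have "\<exists>y\<in>?S. capacity V l w b F - c < y"
    using less_cSupD[OF ne, of "capacity V l w b F - c"] assms(2) unfolding capacity_def by simp
  then obtain w' where "feasible V l w b F w'" "capacity V l w b F - c < codegree V w' {}"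
    by blast
  thus ?thesis using that[of w'] by linarith
qed

lemma capacity_le:
  fixes b :: "nat \<Rightarrow> real"
  assumes "\<And>j. 0 \<le> b j"
  shows "capacity V l w b F \<le> b 0"
  unfolding capacity_def 
proof (rule cSup_least)
  show "(\<lambda>w'. codegree V w' {}) ` Collect (feasible V l w b F) \<noteq> {}"
    using feasible_zero[of b, OF assms(1)] by blast
qed (use feasible_total_le[of V l w b F] in blast)

lemma capacity_nonneg:
  fixes b :: "nat \<Rightarrow> real"
  assumes "\<And>j. 0 \<le> b j"
  shows "0 \<le> capacity V l w b F"
  using capacity_upper[OF feasible_zero[of b V l w F, OF assms(1)]] by (simp add: codegree_def)

text \<open>The elements that can increase the capacity of \<open>F\<close> by at most \<open>c\<close>.  This set depends on \<open>F\<close> only, and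
it will be the container belonging to the fingerprint \<open>F\<close>.\<close>

definition candidates :: "'e set \<Rightarrow> nat \<Rightarrow> ('e set \<Rightarrow> real) \<Rightarrow> (nat \<Rightarrow> real) \<Rightarrow> real \<Rightarrow> 'e set \<Rightarrow> 'e set" where
  "candidates V l w b c F = {x\<in>V. capacity V l w b (insert x F) \<le> capacity V l w b F + c}"

text \<open>A subset \<open>F\<close> of \<open>I\<close> maximising the capacity minus \<open>c |F|\<close> has the desired properties: enlarging it
by an element of \<open>I\<close> gains at most \<open>c\<close>, and its value is at least that of the empty set.\<close>

lemma fingerprint_exists:
  fixes w :: "'e set \<Rightarrow> real" and b :: "nat \<Rightarrow> real" and c :: real
  assumes "finite I" "I \<subseteq> V" "\<And>j. 0 \<le> b j" "0 < c"
  obtains F where "F \<subseteq> I" "c * card F \<le> b 0" "I \<subseteq> candidates V l w b c F"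
proof -
  let ?f = "\<lambda>F. capacity V l w b F - c * card F"
  have fin: "finite (?f ` Pow I)" and ne: "?f ` Pow I \<noteq> {}" using assms(1) by auto
  obtain F where F0: "F \<in> Pow I" "?f F = Max (?f ` Pow I)" using obtains_MAX[of "Pow I" ?f] assms(1) by (metis Pow_not_empty finite_Pow_iff)
  have F: "F \<in> Pow I" "\<And>G. G \<in> Pow I \<Longrightarrow> ?f G \<le> ?f F"
    using F0 Max_ge[OF fin] by auto
  have fF: "finite F" using F(1) assms(1) by (auto intro: finite_subset)
  have "0 \<le> ?f F" using F(2)[of "{}"] capacity_nonneg[of b V l w "{}", OF assms(3)] by simp
  hence "c * card F \<le> b 0" using capacity_le[of b V l w F, OF assms(3)] by simp
  moreover have "I \<subseteq> candidates V l w b c F"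
  proof
    fix x assume x: "x \<in> I"
    have "?f (insert x F) \<le> ?f F" using F x by auto
    moreover have "c * real (card (insert x F)) \<le> c * card F + c"
      using fF assms(4) by (cases "x \<in> F") (auto simp: insert_absorb algebra_simps)
    ultimately show "x \<in> candidates V l w b c F"
      using x assms(2) by (auto simp: candidates_def)
  qed
  ultimately show ?thesis using that F(1) by blast
qed

lemma spreadD:
  assumes "spread V l w K \<tau>"
  shows "finite V" "\<And>e. 0 \<le> w e" "\<And>e. 0 < w e \<Longrightarrow> e \<subseteq> V" "\<And>e. 0 < w e \<Longrightarrow> card e = l"
    "0 < codegree V w {}"
    "\<And>\<sigma>. \<sigma> \<subseteq> V \<Longrightarrow> \<sigma> \<noteq> {} \<Longrightarrow>
        codegree V w \<sigma> \<le> K * \<tau> ^ (card \<sigma> - 1) * codegree V w {} / card V"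
  using assms unfolding spread_def by blast+

text \<open>If the near-optimal hypergraph \<open>w'\<close> does not fill its total capacity, then the links of the candidates
have hardly any weight outside the saturated sets, those whose codegree in \<open>w'\<close> exceeds half of the
bound: such weight could be added to \<open>w'\<close>.  The saturated sets in turn carry little weight of \<open>w\<close>,
because each uses up a proportional part of \<open>w'\<close>.  Hence the candidates have small total degree, and
as no degree is much above the average, many vertices are not candidates.\<close>

lemma candidates_small:
  fixes V :: "'e set" and w w' :: "'e set \<Rightarrow> real" and K \<tau> W0 :: real and l :: nat
  defines "A \<equiv> real (l + 1) * 2 ^ (l + 3)"
  defines "b \<equiv> \<lambda>j. if j = 0 then W0 else A * K * \<tau> ^ (j - 1) * W0 / card V"
  assumes sp: "spread V (Suc l) w K \<tau>" and K: "1 \<le> K" and t: "0 < \<tau>" "1 \<le> \<tau> * card V"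
  assumes W0: "W0 = 2 * K * \<tau> * codegree V w {}"
  assumes c: "c = codegree V w {} / (8 * card V)"
  assumes w': "feasible V l w b F w'" "capacity V l w b F \<le> codegree V w' {} + c"
  assumes unsat: "codegree V w' {} \<le> W0 / 2"
  shows "card (candidates V l w b c F) \<le> (1 - 1 / (2 * K)) * card V"
proof -
  note S = spreadD[OF sp]
  define N where "N = real (card V)"
  define W where "W = codegree V w {}"
  define B where "B = b"
  define C where "C = candidates V l w B c F"
  have W: "0 < W" using S(5) by (simp add: W_def)
  have N: "0 < N" using t unfolding N_def by (cases "card V = 0") auto
  have A1: "1 \<le> A" 
  proof -
    have "1 * 1 \<le> real (l + 1) * 2 ^ (l + 3)" by (intro mult_mono) auto
    thus ?thesis by (simp add: A_def)
  qed
  have A: "0 < A" using A1 by simp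
  have W0p: "0 < W0" using W0 W K t by (simp add: W_def)
  have c0: "0 < c" using W N by (simp add: c W_def N_def)
  have CV: "C \<subseteq> V" by (auto simp: C_def candidates_def)
  have fC: "finite C" using CV S(1) finite_subset by blast
  have bpos: "0 < B j" for j using W0p K t A N by (auto simp: B_def b_def N_def)
  have w'0: "0 \<le> w' e" for e using w'(1) by (simp add: feasible_def)
  \<comment> \<open>A single link takes up at most half of every bound; this is how the total \<open>W0\<close> is chosen.\<close>
  have half: "codegree V w (insert x \<sigma>) \<le> B (card \<sigma>) / 2" if "x \<in> V" "\<sigma> \<subseteq> V" "x \<notin> \<sigma>" for x \<sigma>
  proof -
    have fs: "finite \<sigma>" using that S(1) finite_subset by blast
    have "codegree V w (insert x \<sigma>) \<le> K * \<tau> ^ card \<sigma> * W / N"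
      using S(6)[of "insert x \<sigma>"] that fs by (simp add: W_def N_def)
    also have "\<dots> \<le> B (card \<sigma>) / 2"
    proof (cases "card \<sigma> = 0")
      case True
      have "K * W \<le> K * \<tau> * W * N" using t K W by (simp add: N_def mult.commute[of _ \<tau>] mult.left_commute[of _ \<tau>])
      hence "K * W / N \<le> K * \<tau> * W" using N by (simp add: field_simps)
      thus ?thesis using True by (simp add: B_def b_def N_def W0 W_def)
    next
      case False
      then obtain i where i: "card \<sigma> = Suc i" by (cases "card \<sigma>") auto
      have "K * \<tau> ^ Suc i * W / N = 1 * (K * \<tau> ^ Suc i * W / N)" by simp
      also have "\<dots> \<le> (A * K) * (K * \<tau> ^ Suc i * W / N)"
        using A1 K W N t by (intro mult_right_mono) (auto intro: order.trans[OF _ mult_mono[of 1 _ 1]])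
      also have "\<dots> = B (card \<sigma>) / 2" by (simp add: B_def b_def N_def i W0 W_def)
      finally show ?thesis by (simp add: i)
    qed
    finally show ?thesis .
  qed
  define sat where "sat = {\<sigma>. \<sigma> \<subseteq> V \<and> B (card \<sigma>) / 2 < codegree V w' \<sigma>}"
  have fsat: "finite sat" using S(1) by (simp add: sat_def)
  have empty_unsat: "{} \<notin> sat" using unsat by (simp add: sat_def B_def b_def N_def)
  \<comment> \<open>The part of the link of \<open>x\<close> that can be added to \<open>w'\<close> without violating any bound.\<close>
  define T where "T = (\<lambda>x e. if \<exists>\<sigma>\<in>sat. \<sigma> \<subseteq> e then 0 else link V w x e)"
  have l0: "0 \<le> link V w x e" for x e using S(2) by (simp add: link_def)
  have T0: "0 \<le> T x e" for x e using l0 by (simp add: T_def)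
  have Tle: "T x e \<le> link V w x e" for x e using l0 by (simp add: T_def)
  have T_total: "codegree V (T x) {} \<le> 2 * c" if x: "x \<in> C" for x
  proof -
    have xV: "x \<in> V" using x CV by auto
    have "feasible V l w B (insert x F) (\<lambda>e. w' e + T x e)"
      unfolding feasible_def
    proof (intro conjI allI impI)
      fix e show "0 \<le> w' e + T x e" using w'0 T0 by (simp add: add_nonneg_nonneg)
    next
      fix e assume pos: "0 < w' e + T x e"
      show "e \<subseteq> V" "card e = l" "\<exists>y\<in>insert x F. 0 < w (insert y e)"
      proof (atomize(full), cases "0 < w' e")
        case True
        thus "e \<subseteq> V \<and> card e = l \<and> (\<exists>y\<in>insert x F. 0 < w (insert y e))"
          using w'(1) by (auto simp: feasible_def)
      next
        case False
        hence "0 < T x e" using w'0[of e] pos by simp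
        hence "0 < link V w x e" using Tle by (rule less_le_trans)
        hence e: "x \<notin> e" "e \<subseteq> V" "0 < w (insert x e)" by (auto simp: link_def split: if_splits)
        have "finite e" using e(2) S(1) finite_subset by blast
        hence "card e = l" using S(4)[OF e(3)] e(1) by simp
        thus "e \<subseteq> V \<and> card e = l \<and> (\<exists>y\<in>insert x F. 0 < w (insert y e))" using e by auto
      qed
    next
      fix \<sigma> assume sV: "\<sigma> \<subseteq> V"
      show "codegree V (\<lambda>e. w' e + T x e) \<sigma> \<le> B (card \<sigma>)"
      proof (cases "\<sigma> \<in> sat")
        case True
        have "codegree V (T x) \<sigma> = 0" unfolding codegree_def
          using True by (intro sum.neutral) (auto simp: T_def)
        thus ?thesis using w'(1) sV by (simp add: codegree_add feasible_def B_def N_def)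
      next
        case False
        have "codegree V (T x) \<sigma> \<le> B (card \<sigma>) / 2"
        proof (cases "x \<in> \<sigma>")
          case True
          have "codegree V (T x) \<sigma> \<le> codegree V (link V w x) \<sigma>"
            using S(1) Tle by (intro codegree_mono) auto
          also have "\<dots> = 0" unfolding codegree_def
            using True by (intro sum.neutral) (auto simp: link_def)
          finally show ?thesis using bpos[of "card \<sigma>"] by simp
        next
          case x\<sigma>: False
          have "codegree V (T x) \<sigma> \<le> codegree V (link V w x) \<sigma>"
            using S(1) Tle by (intro codegree_mono) auto
          also have "\<dots> \<le> codegree V w (insert x \<sigma>)" using S by (intro codegree_link_le) auto
          also have "\<dots> \<le> B (card \<sigma>) / 2" using half[OF xV sV x\<sigma>] .
          finally show ?thesis .
        qed
        moreover have "codegree V w' \<sigma> \<le> B (card \<sigma>) / 2" using False sV by (simp add: sat_def)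
        ultimately show ?thesis by (simp add: codegree_add)
      qed
    qed
    from capacity_upper[OF this]
    have "codegree V w' {} + codegree V (T x) {} \<le> capacity V l w B (insert x F)"
      by (simp add: codegree_add)
    also have "\<dots> \<le> capacity V l w B F + c" using x by (simp add: C_def candidates_def)
    also have "\<dots> \<le> codegree V w' {} + 2 * c" using w'(2) by (simp add: B_def N_def)
    finally show ?thesis by simp
  qed
  have link_le: "codegree V w {x} \<le> 2 * c + (\<Sum>\<sigma>\<in>sat. codegree V (link V w x) \<sigma>)" if x: "x \<in> C" for x
  proof -
    have xV: "x \<in> V" using x CV by auto
    have "codegree V w {x} = (\<Sum>e\<in>Pow V. link V w x e)"
      using codegree_singleton_eq_link[OF S(1) xV] by (simp add: codegree_def Pow_def)
    also have "\<dots> \<le> (\<Sum>e\<in>Pow V. T x e + card {\<sigma>\<in>sat. \<sigma> \<subseteq> e} * link V w x e)"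
    proof (rule sum_mono)
      fix e
      show "link V w x e \<le> T x e + card {\<sigma>\<in>sat. \<sigma> \<subseteq> e} * link V w x e"
      proof (cases "\<exists>\<sigma>\<in>sat. \<sigma> \<subseteq> e")
        case True
        hence "{\<sigma>\<in>sat. \<sigma> \<subseteq> e} \<noteq> {}" by blast
        hence "1 \<le> card {\<sigma>\<in>sat. \<sigma> \<subseteq> e}" using fsat by (simp add: Suc_le_eq card_gt_0_iff)
        hence "1 * link V w x e \<le> card {\<sigma>\<in>sat. \<sigma> \<subseteq> e} * link V w x e"
          using l0 by (intro mult_right_mono) auto
        thus ?thesis using T0[of x e] by simp
      next
        case False
        thus ?thesis using l0 by (auto simp: T_def)
      qed
    qed
    also have "\<dots> = codegree V (T x) {} + (\<Sum>\<sigma>\<in>sat. codegree V (link V w x) \<sigma>)"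
      using S(1) by (subst sum_codegree) (auto simp: sum.distrib codegree_def Pow_def sat_def)
    also have "\<dots> \<le> 2 * c + (\<Sum>\<sigma>\<in>sat. codegree V (link V w x) \<sigma>)" using T_total[OF x] by simp
    finally show ?thesis .
  qed
  \<comment> \<open>Each saturated set uses a fixed proportion of \<open>w'\<close>, and an edge of \<open>w'\<close> contains at most \<open>2^l\<close> sets;
    the factor \<open>A\<close> in the bounds is there to make up for this.\<close>
  have sat_sum: "(\<Sum>\<sigma>\<in>sat. real (Suc l) * codegree V w \<sigma>) \<le> W / 4"
  proof -
    have "(\<Sum>\<sigma>\<in>sat. codegree V w \<sigma>) \<le> (\<Sum>\<sigma>\<in>sat. 2 * W / (A * W0) * codegree V w' \<sigma>)"
    proof (rule sum_mono)
      fix \<sigma> assume s: "\<sigma> \<in> sat"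
      have ne: "\<sigma> \<noteq> {}" using s empty_unsat by blast
      have sV: "\<sigma> \<subseteq> V" using s by (simp add: sat_def)
      have "card \<sigma> \<noteq> 0" using ne sV S(1) finite_subset by fastforce
      hence "K * \<tau> ^ (card \<sigma> - 1) * W / N = W / (A * W0) * B (card \<sigma>)"
        using A W0p by (simp add: B_def b_def N_def)
      hence "codegree V w \<sigma> \<le> W / (A * W0) * B (card \<sigma>)"
        using S(6)[OF sV ne] by (simp add: W_def N_def)
      also have "\<dots> \<le> W / (A * W0) * (2 * codegree V w' \<sigma>)"
        using s W A W0p by (intro mult_left_mono) (auto simp: sat_def)
      finally show "codegree V w \<sigma> \<le> 2 * W / (A * W0) * codegree V w' \<sigma>" by (simp add: mult_ac)
    qed
    also have "\<dots> = 2 * W / (A * W0) * (\<Sum>e\<in>Pow V. card {\<sigma>\<in>sat. \<sigma> \<subseteq> e} * w' e)"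
      using S(1) by (subst sum_codegree[symmetric]) (auto simp: sat_def sum_distrib_left)
    also have "\<dots> \<le> 2 * W / (A * W0) * (\<Sum>e\<in>Pow V. 2 ^ l * w' e)"
    proof (intro mult_left_mono sum_mono)
      fix e assume e: "e \<in> Pow V"
      show "card {\<sigma>\<in>sat. \<sigma> \<subseteq> e} * w' e \<le> 2 ^ l * w' e"
      proof (cases "0 < w' e")
        case True
        hence ce: "card e = l" using w'(1) by (auto simp: feasible_def)
        have fe: "finite e" using e S(1) finite_subset by auto
        have "card {\<sigma>\<in>sat. \<sigma> \<subseteq> e} \<le> card (Pow e)" using fe by (intro card_mono) auto
        hence "real (card {\<sigma>\<in>sat. \<sigma> \<subseteq> e}) \<le> 2 ^ l"
          using fe ce by (metis card_Pow of_nat_le_iff of_nat_numeral of_nat_power)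
        thus ?thesis using True by (intro mult_right_mono) auto
      next
        case False
        thus ?thesis using w'0[of e] by simp
      qed
    qed (use W A W0p in auto)
    also have "\<dots> = 2 * W / (A * W0) * (2 ^ l * codegree V w' {})"
      by (simp add: codegree_def Pow_def sum_distrib_left)
    also have "\<dots> \<le> 2 * W / (A * W0) * (2 ^ l * W0)"
      using unsat W0p W A by (intro mult_left_mono) auto
    also have "\<dots> = 2 ^ (l + 1) * W / A" using W0p by simp
    finally have "(\<Sum>\<sigma>\<in>sat. codegree V w \<sigma>) \<le> 2 ^ (l + 1) * W / A" .
    hence "real (Suc l) * (\<Sum>\<sigma>\<in>sat. codegree V w \<sigma>) \<le> real (Suc l) * (2 ^ (l + 1) * W / A)"
      by (intro mult_left_mono) auto
    also have "A = real (Suc l) * (4 * 2 ^ (l + 1))" by (simp add: A_def power_add)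
    also have "real (Suc l) * (2 ^ (l + 1) * W / \<dots>) = W / 4" by (simp del: of_nat_Suc)
    finally show ?thesis by (simp add: sum_distrib_left)
  qed
  have "(\<Sum>x\<in>C. codegree V w {x}) \<le> (\<Sum>x\<in>C. 2 * c + (\<Sum>\<sigma>\<in>sat. codegree V (link V w x) \<sigma>))"
    using link_le by (rule sum_mono)
  also have "\<dots> = card C * (2 * c) + (\<Sum>\<sigma>\<in>sat. \<Sum>x\<in>C. codegree V (link V w x) \<sigma>)"
    by (simp add: sum.distrib sum.swap[of _ C])
  also have "\<dots> \<le> N * (2 * c) + (\<Sum>\<sigma>\<in>sat. real (Suc l) * codegree V w \<sigma>)"
  proof (intro add_mono mult_right_mono sum_mono)
    show "real (card C) \<le> N" using CV S(1) by (simp add: N_def card_mono)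
    fix \<sigma>
    have "(\<Sum>x\<in>C. codegree V (link V w x) \<sigma>) \<le> (\<Sum>x\<in>V. codegree V (link V w x) \<sigma>)"
      using CV S(1) l0 by (intro sum_mono2) (auto intro: codegree_nonneg)
    also have "\<dots> \<le> Suc l * codegree V w \<sigma>" using S by (intro sum_codegree_link) auto
    finally show "(\<Sum>x\<in>C. codegree V (link V w x) \<sigma>) \<le> Suc l * codegree V w \<sigma>" .
  qed (use c0 in auto)
  also have "N * (2 * c) = W / 4" using N by (simp add: c W_def N_def)
  finally have CW: "(\<Sum>x\<in>C. codegree V w {x}) \<le> W / 2" using sat_sum by simp
  have "W \<le> Suc l * W" using W by simp
  also have "\<dots> = (\<Sum>x\<in>V. codegree V w {x})"
    using S by (subst sum_codegree_singletons[of _ _ "Suc l"]) (auto simp: W_def)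
  also have "\<dots> = (\<Sum>x\<in>C. codegree V w {x}) + (\<Sum>x\<in>V - C. codegree V w {x})"
    using CV S(1) by (metis add.commute sum.subset_diff)
  also have "\<dots> \<le> W / 2 + (\<Sum>x\<in>V - C. K * W / N)"
  proof (intro add_mono sum_mono CW)
    fix x assume "x \<in> V - C"
    thus "codegree V w {x} \<le> K * W / N" using S(6)[of "{x}"] by (simp add: W_def N_def)
  qed
  also have "(\<Sum>x\<in>V - C. K * W / N) = card (V - C) * (K * W / N)" by simp
  finally have "W / 2 \<le> card (V - C) * (K * W / N)" by linarith
  hence "N / (2 * K) \<le> card (V - C)" using W N K by (simp add: field_simps)
  also have "real (card (V - C)) = N - card C"
    using CV S(1) fC by (simp add: N_def card_Diff_subset card_mono of_nat_diff)
  finally have "card C \<le> N - N / (2 * K)" by simp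
  thus ?thesis by (simp add: C_def B_def N_def algebra_simps)
qed

text \<open>One step of the reduction of uniformity: either the candidates form a small container, or the
near-optimal hypergraph is again spread, with one vertex per edge less.\<close>

lemma container_step:
  fixes w :: "'e set \<Rightarrow> real" and K \<tau> :: real and l :: nat
  defines "K' \<equiv> 2 * (real (l + 1) * 2 ^ (l + 3)) * K"
  assumes sp: "spread V (Suc l) w K \<tau>" and K: "1 \<le> K" and t: "0 < \<tau>" "1 \<le> \<tau> * card V"
  obtains Cand :: "'e set \<Rightarrow> 'e set" and w' :: "'e set \<Rightarrow> 'e set \<Rightarrow> real"
  where "\<And>F. Cand F \<subseteq> V"
    and "\<And>I. I \<subseteq> V \<Longrightarrow> \<exists>F\<subseteq>I. card F \<le> 16 * K * \<tau> * card V \<and> I \<subseteq> Cand F"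
    and "\<And>F. card (Cand F) \<le> (1 - 1 / (2 * K)) * card V \<or> spread V l (w' F) K' \<tau>"
    and "\<And>F e. 0 < w' F e \<Longrightarrow> \<exists>x\<in>F. 0 < w (insert x e)"
proof -
  note S = spreadD[OF sp]
  define A where "A = real (l + 1) * 2 ^ (l + 3)"
  define W where "W = codegree V w {}"
  define W0 where "W0 = 2 * K * \<tau> * codegree V w {}"
  define N where "N = real (card V)"
  define b where "b = (\<lambda>j. if j = (0::nat) then W0 else A * K * \<tau> ^ (j - 1) * W0 / N)"
  define c where "c = codegree V w {} / (8 * card V)"
  have W: "0 < W" using S(5) by (simp add: W_def)
  have N: "0 < N" using t unfolding N_def by (cases "card V = 0") auto
  have A: "0 < A" by (simp add: A_def)
  have W0p: "0 < W0" using W K t by (simp add: W_def W0_def)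
  have c0: "0 < c" using W N by (simp add: c_def W_def N_def)
  have bnn: "0 \<le> b j" for j using W0p K t A N by (auto simp: b_def)
  define w' where "w' = (\<lambda>F. SOME w'. feasible V l w b F w' \<and> capacity V l w b F \<le> codegree V w' {} + c)"
  have w': "feasible V l w b F (w' F)" "capacity V l w b F \<le> codegree V (w' F) {} + c" for F
  proof -
    have "\<exists>w'. feasible V l w b F w' \<and> capacity V l w b F \<le> codegree V w' {} + c"
      using near_optimal[of b c V l w F] bnn c0 by metis
    from someI_ex[OF this] show "feasible V l w b F (w' F)"
      "capacity V l w b F \<le> codegree V (w' F) {} + c" by (simp_all add: w'_def)
  qed
  have small: "card (candidates V l w b c F) \<le> (1 - 1 / (2 * K)) * card V \<or> spread V l (w' F) K' \<tau>" for F
  proof (cases "codegree V (w' F) {} \<le> W0 / 2")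
    case True
    have "card (candidates V l w b c F) \<le> (1 - 1 / (2 * K)) * card V"
      using candidates_small[OF sp K t W0_def c_def, folded A_def N_def, folded b_def,
          OF w'[of F] True]
      by (simp add: N_def)
    thus ?thesis ..
  next
    case False
    have "spread V l (w' F) K' \<tau>" unfolding spread_def
    proof (intro conjI allI impI)
      show "finite V" by (rule S(1))
      show "0 < codegree V (w' F) {}" using False W0p by simp
      show "0 \<le> w' F e" for e using w'(1)[of F] by (simp add: feasible_def)
      show "e \<subseteq> V" "card e = l" if "0 < w' F e" for e using w'(1)[of F] that by (auto simp: feasible_def)
      fix \<sigma> assume s: "\<sigma> \<subseteq> V" "\<sigma> \<noteq> {}"
      have "card \<sigma> \<noteq> 0" using s S(1) finite_subset by fastforce
      hence "codegree V (w' F) \<sigma> \<le> A * K * \<tau> ^ (card \<sigma> - 1) * W0 / N"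
        using w'(1)[of F] s(1) by (auto simp: feasible_def b_def dest!: spec[of _ \<sigma>])
      also have "\<dots> \<le> A * K * \<tau> ^ (card \<sigma> - 1) * (2 * codegree V (w' F) {}) / N"
        using False A K t N by (intro divide_right_mono mult_left_mono) auto
      finally show "codegree V (w' F) \<sigma> \<le> K' * \<tau> ^ (card \<sigma> - 1) * codegree V (w' F) {} / real (card V)"
        by (simp add: K'_def A_def N_def algebra_simps)
    qed
    thus ?thesis ..
  qed
  show ?thesis
  proof (rule that[of "candidates V l w b c" w'])
    show "candidates V l w b c F \<subseteq> V" for F by (auto simp: candidates_def)
    show "\<exists>F\<subseteq>I. card F \<le> 16 * K * \<tau> * card V \<and> I \<subseteq> candidates V l w b c F" if I: "I \<subseteq> V" for I
    proof -
      have "finite I" using I S(1) finite_subset by blast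
      then obtain F where F: "F \<subseteq> I" "c * card F \<le> b 0" "I \<subseteq> candidates V l w b c F"
        using fingerprint_exists[of I V b c l w] I bnn c0 by metis
      have "W * card F \<le> W * (16 * K * \<tau> * N)"
        using F(2) N by (simp add: b_def W0_def c_def W_def N_def field_simps)
      hence "card F \<le> 16 * K * \<tau> * card V" using W by (simp add: N_def)
      thus ?thesis using F by blast
    qed
    show "\<exists>x\<in>F. 0 < w (insert x e)" if "0 < w' F e" for F e
      using w'(1)[of F] that by (auto simp: feasible_def)
  qed (rule small)
qed

text \<open>The fingerprint of an independent set is the list of the sets \<open>F\<close> chosen in the successive
reductions of uniformity.  For uniformity one the container consists of the vertices of weight zero.
When a container is found early, the list is padded with copies of its head to have length \<open>l\<close>.
The condition \<open>1 \<le> \<tau> * card V\<close> says that a single vertex is a legitimate fingerprint; it is needed for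
the degrees to respect the bounds on a hypergraph of the total weight aimed at.\<close>

theorem containers:
  fixes K :: real
  assumes "1 \<le> K"
  shows "\<exists>\<delta>>0::real. \<exists>H>0::real. \<forall>V (w :: 'e set \<Rightarrow> real) (\<tau>::real). spread V (Suc l) w K \<tau> \<longrightarrow> 0 < \<tau> \<longrightarrow> 1 \<le> \<tau> * card V \<longrightarrow>
     (\<exists>Cont. (\<forall>Us. Cont Us \<subseteq> V \<and> real (card (Cont Us)) \<le> (1 - \<delta>) * card V) \<and>
        (\<forall>I\<subseteq>V. (\<forall>e\<subseteq>I. w e = 0) \<longrightarrow>
          (\<exists>Us. length Us = l \<and> (\<forall>U\<in>set Us. U \<subseteq> I \<and> real (card U) \<le> H * \<tau> * card V) \<and> I \<subseteq> Cont Us)))"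
  using assms
proof (induction l arbitrary: K)
  case 0
  show ?case
  proof (rule exI[of _ "1/K"], intro conjI exI[of _ 1] allI impI)
    show "0 < 1/K" "(0::real) < 1" using 0 by auto
    fix V and w :: "'e set \<Rightarrow> real" and \<tau> :: real
    assume sp: "spread V (Suc 0) w K \<tau>" and t: "0 < \<tau>" "1 \<le> \<tau> * card V"
    note S = spreadD[OF sp]
    define Z where "Z = {x\<in>V. w {x} = 0}"
    have N: "0 < card V" using t by (cases "card V = 0") auto
    have single: "codegree V w {x} = w {x}" if "x \<in> V" for x
    proof -
      have "codegree V w {x} = sum w {{x}}" unfolding codegree_def
      proof (rule sum.mono_neutral_right)
        show "\<forall>e\<in>{e. e \<subseteq> V \<and> {x} \<subseteq> e} - {{x}}. w e = 0"
        proof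
          fix e assume e: "e \<in> {e. e \<subseteq> V \<and> {x} \<subseteq> e} - {{x}}"
          show "w e = 0"
          proof (rule ccontr)
            assume "w e \<noteq> 0"
            hence "card e = 1" using S(2)[of e] S(4)[of e] by simp
            thus False using e by (auto simp: card_1_singleton_iff)
          qed
        qed
      qed (use that S(1) in auto)
      thus ?thesis by simp
    qed
    have W: "codegree V w {} > 0" by (rule S(5))
    have "codegree V w {} = (\<Sum>x\<in>V. codegree V w {x})"
      using S by (subst sum_codegree_singletons[of _ _ 1]) auto
    also have "\<dots> = (\<Sum>x\<in>V - Z. codegree V w {x})"
      using S(1) single by (intro sum.mono_neutral_right) (auto simp: Z_def)
    also have "\<dots> \<le> (\<Sum>x\<in>V - Z. K * codegree V w {} / card V)"
      using S(6)[of "{_}"] by (intro sum_mono) auto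
    finally have "codegree V w {} * 1 \<le> codegree V w {} * (card (V - Z) * K / card V)"
      by (simp add: field_simps)
    hence "1 \<le> card (V - Z) * K / card V" using W by (simp only: mult_le_cancel_left_pos)
    hence "card V / K \<le> card (V - Z)" using N 0 by (simp add: field_simps)
    also have "real (card (V - Z)) = real (card V) - real (card Z)"
    proof -
      have "Z \<subseteq> V" "finite Z" using S(1) by (auto simp: Z_def)
      thus ?thesis using S(1) by (simp add: card_Diff_subset card_mono of_nat_diff)
    qed
    finally have Z: "card Z \<le> (1 - 1/K) * card V" by (simp add: algebra_simps)
    show "\<exists>Cont. (\<forall>Us. Cont Us \<subseteq> V \<and> real (card (Cont Us)) \<le> (1 - 1/K) * card V) \<and>
        (\<forall>I\<subseteq>V. (\<forall>e\<subseteq>I. w e = 0) \<longrightarrow>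
          (\<exists>Us. length Us = 0 \<and> (\<forall>U\<in>set Us. U \<subseteq> I \<and> real (card U) \<le> 1 * \<tau> * card V) \<and> I \<subseteq> Cont Us))"
      using Z by (intro exI[of _ "\<lambda>_. Z"]) (auto simp: Z_def)
  qed
next
  case (Suc l)
  define K' where "K' = 2 * (real (Suc l + 1) * 2 ^ (Suc l + 3)) * K"
  have "1 * 1 \<le> real (Suc l + 1) * 2 ^ (Suc l + 3)" by (intro mult_mono) auto
  hence "1 \<le> 2 * (real (Suc l + 1) * 2 ^ (Suc l + 3))" by simp
  hence "1 * 1 \<le> 2 * (real (Suc l + 1) * 2 ^ (Suc l + 3)) * K"
    using Suc.prems by (intro mult_mono) auto
  hence "1 \<le> K'" by (simp add: K'_def)
  from Suc.IH[OF this] obtain \<delta> H :: real where \<delta>: "0 < \<delta>" and H: "0 < H" and IH: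
    "\<And>V (w :: 'e set \<Rightarrow> real) (\<tau>::real). spread V (Suc l) w K' \<tau> \<Longrightarrow> 0 < \<tau> \<Longrightarrow> 1 \<le> \<tau> * card V \<Longrightarrow>
     \<exists>Cont. (\<forall>Us. Cont Us \<subseteq> V \<and> real (card (Cont Us)) \<le> (1 - \<delta>) * card V) \<and>
        (\<forall>I\<subseteq>V. (\<forall>e\<subseteq>I. w e = 0) \<longrightarrow>
          (\<exists>Us. length Us = l \<and> (\<forall>U\<in>set Us. U \<subseteq> I \<and> real (card U) \<le> H * \<tau> * card V) \<and> I \<subseteq> Cont Us))"
    by (elim exE conjE) blast
  define \<delta>' where "\<delta>' = min \<delta> (1 / (2 * K))"
  define H' where "H' = max H (16 * K)"
  show ?case
  proof (rule exI[of _ \<delta>'], intro conjI exI[of _ H'] allI impI)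
    show "0 < \<delta>'" "0 < H'" using \<delta> H Suc.prems by (auto simp: \<delta>'_def H'_def)
    fix V and w :: "'e set \<Rightarrow> real" and \<tau> :: real
    assume sp: "spread V (Suc (Suc l)) w K \<tau>" and t: "0 < \<tau>" "1 \<le> \<tau> * card V"
    note S = spreadD[OF sp]
    obtain Cand w' where
      c1: "\<And>F. Cand F \<subseteq> V"
      and c2: "\<And>I. I \<subseteq> V \<Longrightarrow> \<exists>F\<subseteq>I. real (card F) \<le> 16 * K * \<tau> * card V \<and> I \<subseteq> Cand F"
      and c3: "\<And>F. real (card (Cand F)) \<le> (1 - 1 / (2 * K)) * card V \<or> spread V (Suc l) (w' F) K' \<tau>"
      and c4: "\<And>F e. 0 < w' F e \<Longrightarrow> \<exists>x\<in>F. 0 < w (insert x e)"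
      using container_step[OF sp Suc.prems t] unfolding K'_def by metis
    let ?small = "\<lambda>F. real (card (Cand F)) \<le> (1 - 1 / (2 * K)) * card V"
    let ?P = "\<lambda>F Cont. (\<forall>Us. Cont Us \<subseteq> V \<and> real (card (Cont Us)) \<le> (1 - \<delta>) * card V) \<and>
        (\<forall>I\<subseteq>V. (\<forall>e\<subseteq>I. w' F e = 0) \<longrightarrow>
          (\<exists>Us. length Us = l \<and> (\<forall>U\<in>set Us. U \<subseteq> I \<and> real (card U) \<le> H * \<tau> * card V) \<and> I \<subseteq> Cont Us))"
    define Rec where "Rec = (\<lambda>F. SOME Cont. ?P F Cont)"
    have Rec: "?P F (Rec F)" if "\<not> ?small F" for F
    proof -
      have "\<exists>Cont. ?P F Cont" using IH[of V "w' F" \<tau>] c3[of F] that t by blast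
      from someI_ex[OF this] show ?thesis unfolding Rec_def .
    qed
    define Cont where "Cont = (\<lambda>Us. if ?small (hd Us) then Cand (hd Us) else Rec (hd Us) (tl Us))"
    have le1: "(1 - \<delta>) * card V \<le> (1 - \<delta>') * card V" "(1 - 1 / (2 * K)) * card V \<le> (1 - \<delta>') * card V"
      by (auto simp: \<delta>'_def intro!: mult_right_mono)
    have le2: "H * \<tau> * card V \<le> H' * \<tau> * card V" "16 * K * \<tau> * card V \<le> H' * \<tau> * card V"
      using t unfolding H'_def by (intro mult_right_mono; simp)+
    show "\<exists>Cont. (\<forall>Us. Cont Us \<subseteq> V \<and> real (card (Cont Us)) \<le> (1 - \<delta>') * card V) \<and>
        (\<forall>I\<subseteq>V. (\<forall>e\<subseteq>I. w e = 0) \<longrightarrow>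
          (\<exists>Us. length Us = Suc l \<and> (\<forall>U\<in>set Us. U \<subseteq> I \<and> real (card U) \<le> H' * \<tau> * card V) \<and> I \<subseteq> Cont Us))"
    proof (intro exI[of _ Cont] conjI allI impI)
      fix Us
      show "Cont Us \<subseteq> V" using c1 Rec by (auto simp: Cont_def)
      show "real (card (Cont Us)) \<le> (1 - \<delta>') * card V"
      proof (cases "?small (hd Us)")
        case True
        thus ?thesis using le1(2) by (simp add: Cont_def)
      next
        case False
        hence "card (Rec (hd Us) (tl Us)) \<le> (1 - \<delta>) * card V" using Rec by blast
        thus ?thesis using le1(1) False by (simp add: Cont_def)
      qed
    next
      fix I assume I: "I \<subseteq> V" and ind: "\<forall>e\<subseteq>I. w e = 0"
      obtain F where F: "F \<subseteq> I" "real (card F) \<le> 16 * K * \<tau> * card V" "I \<subseteq> Cand F" using c2[OF I] by blast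
      show "\<exists>Us. length Us = Suc l \<and> (\<forall>U\<in>set Us. U \<subseteq> I \<and> real (card U) \<le> H' * \<tau> * card V) \<and> I \<subseteq> Cont Us"
      proof (cases "?small F")
        case True
        have "\<forall>U\<in>set (F # replicate l F). U \<subseteq> I \<and> real (card U) \<le> H' * \<tau> * card V"
          using F le2 by auto
        moreover have "I \<subseteq> Cont (F # replicate l F)" using F True by (simp add: Cont_def)
        ultimately show ?thesis by (intro exI[of _ "F # replicate l F"]) simp
      next
        case False
        have "w' F e = 0" if "e \<subseteq> I" for e
        proof (rule ccontr)
          assume ne: "w' F e \<noteq> 0"
          have "spread V (Suc l) (w' F) K' \<tau>" using c3 False by blast
          hence "0 < w' F e" using spreadD(2) ne by (simp add: less_le)
          from c4[OF this] obtain x where "x \<in> F" "0 < w (insert x e)" by blast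
          thus False using ind F(1) that by (metis insert_subset less_irrefl subset_iff)
        qed
        then obtain Us where Us: "length Us = l"
            "\<forall>U\<in>set Us. U \<subseteq> I \<and> real (card U) \<le> H * \<tau> * card V" "I \<subseteq> Rec F Us"
          using Rec[OF False] I by blast
        have "\<forall>U\<in>set (F # Us). U \<subseteq> I \<and> real (card U) \<le> H' * \<tau> * card V"
          using F Us(2) le2 by auto
        moreover have "I \<subseteq> Cont (F # Us)" using Us False by (simp add: Cont_def)
        ultimately show ?thesis using Us(1) by (intro exI[of _ "F # Us"]) simp
      qed
    qed
  qed
qed

section \<open>The partition function of a down-closed family\<close>

text \<open>The partition function of the hard-core model with fugacity \<open>q\<close> when \<open>\<I>\<close> is the family of
independent sets.\<close>

definition hard_core :: "'e set set \<Rightarrow> real \<Rightarrow> 'e set \<Rightarrow> real" where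
  "hard_core \<I> q V = (\<Sum>I | I \<in> \<I> \<and> I \<subseteq> V. q ^ card I)"

lemma sum_Pow_power_card:
  fixes x :: real
  assumes "finite V"
  shows "(\<Sum>U\<in>Pow V. x ^ card U) = (1 + x) ^ card V"
  using prod_add[OF assms, of "\<lambda>_. x" "\<lambda>_. 1"] by (simp add: add.commute)

lemma one_plus_power_le_exp:
  fixes x :: real
  assumes "0 \<le> x"
  shows "(1 + x) ^ n \<le> exp (x * n)"
proof -
  have "(1 + x) ^ n \<le> exp x ^ n" using assms by (intro power_mono exp_ge_add_one_self) auto
  thus ?thesis by (simp add: exp_of_nat2_mult)
qed

lemma hard_core_le_exp:
  assumes "finite V" "0 \<le> q"
  shows "hard_core \<I> q V \<le> exp (q * card V)"
proof -
  have "hard_core \<I> q V \<le> (\<Sum>U\<in>Pow V. q ^ card U)"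
    unfolding hard_core_def using assms by (intro sum_mono2) auto
  also have "\<dots> = (1 + q) ^ card V" using assms(1) by (rule sum_Pow_power_card)
  also have "\<dots> \<le> exp (q * card V)" using assms(2) by (rule one_plus_power_le_exp)
  finally show ?thesis .
qed

lemma card_Union_list_le:
  fixes h :: real
  assumes "\<And>U. U \<in> set Us \<Longrightarrow> real (card U) \<le> h"
  shows "real (card (\<Union>(set Us))) \<le> length Us * h"
  using assms
proof (induction Us)
  case (Cons U Us)
  have "real (card (\<Union>(set (U # Us)))) \<le> card U + card (\<Union>(set Us))"
    using card_Un_le[of U "\<Union>(set Us)"] by (simp flip: of_nat_add)
  also have "real (card U + card (\<Union>(set Us))) \<le> h + length Us * h"
    using Cons.IH Cons.prems[of U] Cons.prems by (simp add: add_mono)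
  finally show ?case by (simp add: algebra_simps)
qed simp

text \<open>A set \<open>U\<close> is the union of at most \<open>2^(l |U|)\<close> lists of \<open>l\<close> subsets, so the sum is at most that of
\<open>(2^l q)^|U|\<close> over the sets \<open>U\<close> with at most \<open>l h\<close> elements.  This is estimated by Chernoff's trick,
multiplying by \<open>\<mu>^(l h - |U|) \<ge> 1\<close> and then summing over all subsets.\<close>

lemma sum_fingerprints_le:
  fixes q h \<mu> :: real
  assumes V: "finite V" and q: "0 \<le> q" and \<mu>: "1 \<le> \<mu>"
  shows "(\<Sum>Us | set Us \<subseteq> {U. U \<subseteq> V \<and> real (card U) \<le> h} \<and> length Us = l. q ^ card (\<Union>(set Us)))
    \<le> \<mu> powr (l * h) * exp (2 ^ l * q / \<mu> * card V)"
proof -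
  let ?L = "{Us. set Us \<subseteq> {U. U \<subseteq> V \<and> real (card U) \<le> h} \<and> length Us = l}"
  have fL: "finite ?L" using V by (intro finite_lists_length_eq) simp
  have fin: "finite U" if "U \<subseteq> V" for U using that V finite_subset by blast
  have "(\<Sum>Us\<in>?L. q ^ card (\<Union>(set Us)))
      = (\<Sum>U\<in>(\<lambda>Us. \<Union>(set Us)) ` ?L. \<Sum>Us\<in>{Us\<in>?L. \<Union>(set Us) = U}. q ^ card (\<Union>(set Us)))"
    by (rule sum.image_gen[OF fL])
  also have "\<dots> \<le> (\<Sum>U\<in>(\<lambda>Us. \<Union>(set Us)) ` ?L. \<mu> powr (l * h) * (2 ^ l * q / \<mu>) ^ card U)"
  proof (rule sum_mono)
    fix U assume "U \<in> (\<lambda>Us. \<Union>(set Us)) ` ?L"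
    then obtain Us where Us: "Us \<in> ?L" "U = \<Union>(set Us)" by blast
    have UV: "U \<subseteq> V" using Us by auto
    have "real (card (\<Union>(set Us))) \<le> length Us * h"
      by (rule card_Union_list_le) (use Us(1) in blast)
    moreover have "length Us = l" using Us(1) by blast
    ultimately have cU: "real (card U) \<le> l * h" by (simp only: Us(2))
    have "(\<Sum>Us\<in>{Us\<in>?L. \<Union>(set Us) = U}. q ^ card (\<Union>(set Us)))
        = card {Us\<in>?L. \<Union>(set Us) = U} * q ^ card U" by simp
    also have "\<dots> \<le> 2 ^ (l * card U) * q ^ card U"
    proof (rule mult_right_mono)
      have "card {Us\<in>?L. \<Union>(set Us) = U} \<le> card {Us. set Us \<subseteq> Pow U \<and> length Us = l}"
        using fin[OF UV] by (intro card_mono finite_lists_length_eq) auto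
      also have "\<dots> = (2 ^ card U) ^ l" using fin[OF UV] by (simp add: card_lists_length_eq card_Pow)
      also have "\<dots> = 2 ^ (l * card U)" by (simp only: power_mult[symmetric] mult.commute[of l])
      finally show "real (card {Us\<in>?L. \<Union>(set Us) = U}) \<le> 2 ^ (l * card U)"
        using of_nat_mono by fastforce
    qed (use q in simp)
    also have "\<dots> = \<mu> ^ card U * (2 ^ l * q / \<mu>) ^ card U"
      using \<mu> by (simp only: power_mult power_mult_distrib[symmetric]) simp
    also have "\<dots> \<le> \<mu> powr (l * h) * (2 ^ l * q / \<mu>) ^ card U"
    proof (rule mult_right_mono)
      have "\<mu> ^ card U = \<mu> powr card U" using \<mu> by (simp add: powr_realpow)
      also have "\<dots> \<le> \<mu> powr (l * h)" using \<mu> cU by (intro powr_mono) auto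
      finally show "\<mu> ^ card U \<le> \<mu> powr (l * h)" .
    qed (use q \<mu> in simp)
    finally show "(\<Sum>Us\<in>{Us\<in>?L. \<Union>(set Us) = U}. q ^ card (\<Union>(set Us)))
      \<le> \<mu> powr (l * h) * (2 ^ l * q / \<mu>) ^ card U" .
  qed
  also have "\<dots> \<le> (\<Sum>U\<in>Pow V. \<mu> powr (l * h) * (2 ^ l * q / \<mu>) ^ card U)"
    using V q \<mu> by (intro sum_mono2) auto
  also have "\<dots> = \<mu> powr (l * h) * (1 + 2 ^ l * q / \<mu>) ^ card V"
    using V by (simp add: sum_distrib_left[symmetric] sum_Pow_power_card)
  also have "\<dots> \<le> \<mu> powr (l * h) * exp (2 ^ l * q / \<mu> * card V)"
    using q \<mu> by (intro mult_left_mono one_plus_power_le_exp) auto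
  finally show ?thesis .
qed

text \<open>Split an independent set into the union \<open>U\<close> of its fingerprint and the rest, which is an independent
subset of the container that is disjoint from \<open>U\<close>; disjointness makes the weight \<open>q^|I|\<close> a product.\<close>

lemma hard_core_container_bound:
  fixes q h B \<mu> :: real
  assumes V: "finite V" and q: "0 \<le> q" and \<mu>: "1 \<le> \<mu>" and B: "0 \<le> B"
    and down: "\<And>I J. I \<in> \<I> \<Longrightarrow> J \<subseteq> I \<Longrightarrow> J \<in> \<I>"
    and CV: "\<And>Us. Cont Us \<subseteq> V"
    and bound: "\<And>W Us. W \<subseteq> Cont Us \<Longrightarrow> hard_core \<I> q W \<le> B"
    and Cont: "\<And>I. I \<subseteq> V \<Longrightarrow> I \<in> \<I> \<Longrightarrow>
      \<exists>Us. length Us = l \<and> (\<forall>U\<in>set Us. U \<subseteq> I \<and> real (card U) \<le> h) \<and> I \<subseteq> Cont Us"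
  shows "hard_core \<I> q V \<le> \<mu> powr (l * h) * exp (2 ^ l * q / \<mu> * card V) * B"
proof -
  let ?L = "{Us. set Us \<subseteq> {U. U \<subseteq> V \<and> real (card U) \<le> h} \<and> length Us = l}"
  let ?W = "\<lambda>Us. Cont Us - \<Union>(set Us)"
  have fL: "finite ?L" using V by (intro finite_lists_length_eq) simp
  have fin: "finite U" if "U \<subseteq> V" for U using that V finite_subset by blast
  have fW: "finite {J. J \<in> \<I> \<and> J \<subseteq> ?W Us}" for Us
    by (rule finite_subset[of _ "Pow V"]) (use CV[of Us] V in auto)
  have "hard_core \<I> q V \<le> (\<Sum>(Us,J)\<in>(SIGMA Us:?L. {J. J \<in> \<I> \<and> J \<subseteq> ?W Us}). q ^ card (\<Union>(set Us)) * q ^ card J)"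
    unfolding hard_core_def
  proof (rule sum_le_included[where i = "\<lambda>(Us,J). \<Union>(set Us) \<union> J"])
    show "finite {I. I \<in> \<I> \<and> I \<subseteq> V}" using V by simp
    show "finite (SIGMA Us:?L. {J. J \<in> \<I> \<and> J \<subseteq> ?W Us})" using fL fW by (intro finite_SigmaI)
    show "\<forall>y\<in>SIGMA Us:?L. {J. J \<in> \<I> \<and> J \<subseteq> ?W Us}.
       0 \<le> (case y of (Us, J) \<Rightarrow> q ^ card (\<Union>(set Us)) * q ^ card J)" using q by (simp split: prod.split)
    show "\<forall>I\<in>{I. I \<in> \<I> \<and> I \<subseteq> V}. \<exists>y\<in>SIGMA Us:?L. {J. J \<in> \<I> \<and> J \<subseteq> ?W Us}.
       (case y of (Us, J) \<Rightarrow> \<Union>(set Us) \<union> J) = I \<and>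
       q ^ card I \<le> (case y of (Us, J) \<Rightarrow> q ^ card (\<Union>(set Us)) * q ^ card J)"
    proof
      fix I assume "I \<in> {I. I \<in> \<I> \<and> I \<subseteq> V}"
      hence I: "I \<in> \<I>" "I \<subseteq> V" by auto
      obtain Us where Us: "length Us = l" "\<forall>U\<in>set Us. U \<subseteq> I \<and> real (card U) \<le> h" "I \<subseteq> Cont Us"
        using Cont[OF I(2,1)] by blast
      let ?U = "\<Union>(set Us)"
      have UI: "?U \<subseteq> I" using Us(2) by auto
      have mem: "(Us, I - ?U) \<in> (SIGMA Us:?L. {J. J \<in> \<I> \<and> J \<subseteq> ?W Us})"
        using Us I down[of I "I - ?U"] by auto
      have "card I = card ?U + card (I - ?U)"
        using UI fin[OF I(2)] by (metis card_Diff_subset card_mono finite_subset le_add_diff_inverse)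
      hence "q ^ card I = q ^ card ?U * q ^ card (I - ?U)" by (simp add: power_add)
      thus "\<exists>y\<in>SIGMA Us:?L. {J. J \<in> \<I> \<and> J \<subseteq> ?W Us}.
       (case y of (Us, J) \<Rightarrow> \<Union>(set Us) \<union> J) = I \<and>
       q ^ card I \<le> (case y of (Us, J) \<Rightarrow> q ^ card (\<Union>(set Us)) * q ^ card J)"
        using mem UI by (intro bexI[of _ "(Us, I - ?U)"]) auto
    qed
  qed
  also have "\<dots> = (\<Sum>Us\<in>?L. \<Sum>J\<in>{J. J \<in> \<I> \<and> J \<subseteq> ?W Us}. q ^ card (\<Union>(set Us)) * q ^ card J)"
    using fL fW by (subst sum.Sigma) auto
  also have "\<dots> = (\<Sum>Us\<in>?L. q ^ card (\<Union>(set Us)) * hard_core \<I> q (?W Us))"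
    by (simp add: hard_core_def sum_distrib_left)
  also have "\<dots> \<le> (\<Sum>Us\<in>?L. q ^ card (\<Union>(set Us)) * B)"
    using q by (intro sum_mono mult_left_mono bound[OF Diff_subset]) auto
  also have "\<dots> = (\<Sum>Us\<in>?L. q ^ card (\<Union>(set Us))) * B" by (simp add: sum_distrib_right)
  also have "\<dots> \<le> \<mu> powr (l * h) * exp (2 ^ l * q / \<mu> * card V) * B"
    using sum_fingerprints_le[OF V q \<mu>, of h l] B by (rule mult_right_mono)
  finally show ?thesis .
qed

section \<open>Random embeddings of a pattern into a dense graph\<close>

lemma card_PiE_fixed_le:
  assumes "finite S" "finite B" "D \<subseteq> S"
  shows "card {y \<in> S \<rightarrow>\<^sub>E B. \<forall>i\<in>D. y i = u i} \<le> card B ^ card (S - D)"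
proof -
  have "card {y \<in> S \<rightarrow>\<^sub>E B. \<forall>i\<in>D. y i = u i} \<le> card (\<Pi>\<^sub>E i\<in>S. if i \<in> D then {u i} else B)"
    using assms by (intro card_mono finite_PiE) (auto simp: PiE_def Pi_def)
  also have "\<dots> = (\<Prod>i\<in>S. card (if i \<in> D then {u i} else B))"
    using assms(1) by (rule card_PiE)
  also have "\<dots> = (\<Prod>i\<in>S - D. card B)"
    using assms by (intro prod.mono_neutral_cong_right) auto
  finally show ?thesis by simp
qed

text \<open>Summation over the coordinates on which the summand does not depend and that are not prescribed.\<close>

lemma sum_PiE_restrict_le:
  fixes f :: "('s \<Rightarrow> 'v) \<Rightarrow> real"
  assumes S: "finite S" and B: "finite B" and sub: "D \<subseteq> S" "A \<subseteq> S" and f: "\<And>y. 0 \<le> f y"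
  shows "(\<Sum>y | y \<in> S \<rightarrow>\<^sub>E B \<and> (\<forall>i\<in>D. y i = u i). f (restrict y A))
    \<le> (\<Sum>y | y \<in> A \<rightarrow>\<^sub>E B \<and> (\<forall>i\<in>D \<inter> A. y i = u i). f y) * card B ^ card (S - (A \<union> D))"
proof -
  let ?Y = "{y. y \<in> S \<rightarrow>\<^sub>E B \<and> (\<forall>i\<in>D. y i = u i)}"
  let ?Z = "{y. y \<in> A \<rightarrow>\<^sub>E B \<and> (\<forall>i\<in>D \<inter> A. y i = u i)}"
  have fY: "finite ?Y" using finite_PiE[of S "\<lambda>_. B"] S B by (auto intro: finite_subset[of _ "S \<rightarrow>\<^sub>E B"])
  have fA: "finite A" using S sub finite_subset by blast
  have fZ: "finite ?Z" using finite_PiE[of A "\<lambda>_. B"] fA B by (auto intro: finite_subset[of _ "A \<rightarrow>\<^sub>E B"])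
  have maps: "(\<lambda>y. restrict y A) ` ?Y \<subseteq> ?Z" using sub by (auto simp: PiE_iff)
  have "(\<Sum>y\<in>?Y. f (restrict y A)) = (\<Sum>z\<in>?Z. \<Sum>y\<in>{y\<in>?Y. restrict y A = z}. f (restrict y A))"
    using sum.group[OF fY fZ maps, of "\<lambda>y. f (restrict y A)"] by simp
  also have "\<dots> \<le> (\<Sum>z\<in>?Z. f z * card B ^ card (S - (A \<union> D)))"
  proof (rule sum_mono)
    fix z assume "z \<in> ?Z"
    let ?u = "\<lambda>i. if i \<in> A then z i else u i"
    have "{y\<in>?Y. restrict y A = z} \<subseteq> {y \<in> S \<rightarrow>\<^sub>E B. \<forall>i\<in>A \<union> D. y i = ?u i}"
      by (auto simp: restrict_def)
    hence "card {y\<in>?Y. restrict y A = z} \<le> card {y \<in> S \<rightarrow>\<^sub>E B. \<forall>i\<in>A \<union> D. y i = ?u i}"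
      using finite_PiE[of S "\<lambda>_. B"] S B by (intro card_mono) auto
    also have "\<dots> \<le> card B ^ card (S - (A \<union> D))"
      using S B sub by (intro card_PiE_fixed_le) auto
    finally have "real (card {y\<in>?Y. restrict y A = z}) \<le> real (card B ^ card (S - (A \<union> D)))"
      by (rule of_nat_mono)
    hence "f z * card {y\<in>?Y. restrict y A = z} \<le> f z * card B ^ card (S - (A \<union> D))"
      using f by (intro mult_left_mono) auto
    moreover have "(\<Sum>y\<in>{y\<in>?Y. restrict y A = z}. f (restrict y A)) = f z * card {y\<in>?Y. restrict y A = z}"
    proof -
      have "(\<Sum>y\<in>{y\<in>?Y. restrict y A = z}. f (restrict y A)) = (\<Sum>y\<in>{y\<in>?Y. restrict y A = z}. f z)"
        by (rule sum.cong) auto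
      thus ?thesis by (simp add: mult.commute)
    qed
    ultimately show "(\<Sum>y\<in>{y\<in>?Y. restrict y A = z}. f (restrict y A)) \<le> f z * card B ^ card (S - (A \<union> D))"
      by (simp only:)
  qed
  finally show ?thesis by (simp add: sum_distrib_right)
qed

lemma sum_prod_PiE_fixed_le:
  fixes P :: "'t \<Rightarrow> 'v \<Rightarrow> real"
  assumes T: "finite T" and B: "\<And>i. i \<in> T \<Longrightarrow> finite (B i)" and sub: "D \<subseteq> T"
    and P0: "\<And>i v. i \<in> T \<Longrightarrow> 0 \<le> P i v" and P1: "\<And>i. i \<in> T \<Longrightarrow> (\<Sum>v\<in>B i. P i v) \<le> 1"
  shows "(\<Sum>t | t \<in> Pi\<^sub>E T B \<and> (\<forall>i\<in>D. t i = u i). \<Prod>i\<in>T. P i (t i)) \<le> (\<Prod>i\<in>D. P i (u i))"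
proof -
  have fD: "finite D" using T sub finite_subset by blast
  let ?B = "\<lambda>i. if i \<in> D then {u i} else B i"
  have fin: "finite (Pi\<^sub>E T ?B)" using T B by (intro finite_PiE) auto
  have "(\<Sum>t | t \<in> Pi\<^sub>E T B \<and> (\<forall>i\<in>D. t i = u i). \<Prod>i\<in>T. P i (t i)) \<le> (\<Sum>t\<in>Pi\<^sub>E T ?B. \<Prod>i\<in>T. P i (t i))"
  proof (rule sum_mono2[OF fin])
    show "{t \<in> Pi\<^sub>E T B. \<forall>i\<in>D. t i = u i} \<subseteq> Pi\<^sub>E T ?B"
      by (auto simp: PiE_def Pi_def)
    show "0 \<le> (\<Prod>i\<in>T. P i (t i))" for t by (rule prod_nonneg) (rule P0)
  qed
  also have "\<dots> = (\<Prod>i\<in>T. \<Sum>v\<in>?B i. P i v)"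
  proof (rule prod_sum_PiE[symmetric, OF T])
    show "finite (?B i)" if "i \<in> T" for i using B[OF that] by simp
  qed
  also have "\<dots> = (\<Prod>i\<in>D. \<Sum>v\<in>?B i. P i v) * (\<Prod>i\<in>T - D. \<Sum>v\<in>?B i. P i v)"
    by (subst prod.subset_diff[OF sub T]) (rule mult.commute)
  also have "\<dots> = (\<Prod>i\<in>D. P i (u i)) * (\<Prod>i\<in>T - D. \<Sum>v\<in>B i. P i v)"
    by (intro arg_cong2[where f = "(*)"] prod.cong) auto
  also have "\<dots> \<le> (\<Prod>i\<in>D. P i (u i)) * 1"
    using P0 P1 sub by (intro mult_left_mono prod_le_1 prod_nonneg conjI sum_nonneg ballI) auto
  finally show ?thesis by simp
qed

lemma sum_UN_le:
  fixes f :: "'a \<Rightarrow> real"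
  assumes "finite I" "\<And>i. i \<in> I \<Longrightarrow> finite (A i)" "\<And>x. 0 \<le> f x"
  shows "(\<Sum>x\<in>(\<Union>i\<in>I. A i). f x) \<le> (\<Sum>i\<in>I. \<Sum>x\<in>A i. f x)"
proof -
  have "(\<Sum>x\<in>(\<Union>i\<in>I. A i). f x) \<le> (\<Sum>(i,x)\<in>(SIGMA i:I. A i). f x)"
    by (rule sum_le_included[where i = snd]) (use assms in \<open>auto simp: Bex_def split: prod.splits\<close>)
  thus ?thesis using assms by (simp add: sum.Sigma)
qed

text \<open>A bipartite graph with a root that is adjacent to all of \<open>S\<close>, and in which every \<open>i \<in> T\<close> has
exactly the neighbours \<open>nb i\<close>.  The root is not an element of \<open>T\<close>; it accounts for the summand 1 in the
degree condition.\<close>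

locale pattern =
  fixes S :: "'s set" and T :: "'t set" and nb :: "'t \<Rightarrow> 's set" and r \<Delta> :: nat
  assumes finS: "finite S" and finT: "finite T" and neS: "S \<noteq> {}" and r2: "2 \<le> r"
    and nb: "\<And>i. i \<in> T \<Longrightarrow> nb i \<subseteq> S" and card_nb: "\<And>i. i \<in> T \<Longrightarrow> card (nb i) = r"
    and degree: "\<And>a. a \<in> S \<Longrightarrow> card {i\<in>T. a \<in> nb i} + 1 \<le> \<Delta>"
begin

text \<open>The edges of the pattern, with \<open>None\<close> for the root.\<close>

definition slots :: "('t option \<times> 's) set" where
  "slots = {None} \<times> S \<union> (\<Union>i\<in>T. {Some i} \<times> nb i)"

lemma finslots: "finite slots"
  unfolding slots_def using finS finT nb finite_subset by (intro finite_UnI finite_UN_I finite_cartesian_product) blast+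

lemma slotsD:
  assumes "(b, a) \<in> slots"
  shows "a \<in> S" "b = None \<or> (\<exists>i\<in>T. b = Some i \<and> a \<in> nb i)"
  using assms nb unfolding slots_def by blast+

lemma slots_ne: "slots \<noteq> {}" using neS by (auto simp: slots_def)

end

text \<open>A graph into which the pattern is to be embedded.\<close>

locale host = pattern S T nb r \<Delta>
  for S :: "'s set" and T :: "'t set" and nb r \<Delta> +
  fixes V :: "'v set" and E :: "'v set set"
  assumes finV: "finite V" and edges: "\<And>e. e \<in> E \<Longrightarrow> e \<subseteq> V \<and> card e = 2" and E_ne: "E \<noteq> {}"
begin

definition N :: "'v \<Rightarrow> 'v set" where "N x = {y. {x,y} \<in> E}"
definition deg :: "'v \<Rightarrow> nat" where "deg x = card (N x)"
text \<open>Half of the average degree.\<close>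

definition h :: real where "h = card E / card V"
definition X :: "'v set" where "X = {x\<in>V. h \<le> deg x}"
text \<open>Common neighbours of degree at least \<open>h\<close>.\<close>

definition com :: "'v set \<Rightarrow> 'v set" where "com A = {x\<in>X. A \<subseteq> N x}"
definition \<rho> :: "'v \<Rightarrow> real" where "\<rho> x = 1 / deg x"
text \<open>The total weight of the common neighbours of \<open>A\<close>, each vertex weighted by its degree to the power \<open>1 - r\<close>.\<close>

definition g :: "'v set \<Rightarrow> real" where "g A = (\<Sum>x\<in>com A. \<rho> x ^ (r - 1))"
text \<open>The threshold above which a set has many common neighbours.  It is low enough for the tuples below
the threshold to make up at most a quarter of all tuples in \<open>good_extensions\<close>.\<close>

definition g0 :: real where "g0 = card E / (4 * (real (card T) + 1) * card V ^ r)"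
text \<open>An upper bound for the probability with which a given vertex is chosen as the image of an element of \<open>T\<close>,
provided that the neighbours of this element are mapped to a set above the threshold.\<close>

definition \<eta> :: real where "\<eta> = (1 / h) ^ (r - 1) / g0"

lemma finE: "finite E" using edges finV by (intro finite_subset[of E "Pow V"]) auto

lemma N_sub: "N x \<subseteq> V" using edges by (auto simp: N_def)

lemma N_irrefl: "x \<notin> N x" using edges[of "{x}"] by (auto simp: N_def)

lemma finN: "finite (N x)" using N_sub finV finite_subset by blast

lemma E_pos: "0 < card E" using finE E_ne by (simp add: card_gt_0_iff)

lemma V_pos: "0 < card V"
proof -
  obtain e where "e \<in> E" using E_ne by blast
  hence "e \<subseteq> V" "card e = 2" using edges by auto
  hence "V \<noteq> {}" by auto
  thus ?thesis using finV by (simp add: card_gt_0_iff)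
qed

lemma h_pos: "0 < h" using E_pos V_pos by (simp add: h_def)
lemma g0_pos: "0 < g0" using E_pos V_pos by (simp add: g0_def)
lemma \<eta>_pos: "0 < \<eta>" using h_pos g0_pos by (simp add: \<eta>_def)

lemma finX: "finite X" using finV by (simp add: X_def)
lemma fincom: "finite (com A)" using finX by (simp add: com_def)

lemma handshake: "(\<Sum>x\<in>V. deg x) = 2 * card E"
proof -
  have "deg x = card {e\<in>E. x \<in> e}" for x
  proof -
    have "{e\<in>E. x \<in> e} = (\<lambda>y. {x,y}) ` N x"
    proof (intro equalityI subsetI)
      fix e assume e: "e \<in> {e\<in>E. x \<in> e}"
      hence "card e = 2" using edges by blast
      then obtain u v where "e = {u,v}" by (auto simp: card_2_iff)
      thus "e \<in> (\<lambda>y. {x,y}) ` N x" using e by (auto simp: N_def insert_commute)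
    qed (auto simp: N_def)
    moreover have "inj_on (\<lambda>y. {x,y}) (N x)" by (auto simp: inj_on_def doubleton_eq_iff)
    ultimately show ?thesis by (simp add: deg_def card_image)
  qed
  hence "(\<Sum>x\<in>V. deg x) = (\<Sum>x\<in>V. \<Sum>e\<in>E. if x \<in> e then 1 else 0)"
    using finE by (simp add: sum.inter_filter[symmetric])
  also have "\<dots> = (\<Sum>e\<in>E. \<Sum>x\<in>V. if x \<in> e then 1 else 0)" by (rule sum.swap)
  also have "\<dots> = (\<Sum>e\<in>E. 2)"
  proof (rule sum.cong[OF refl])
    fix e assume "e \<in> E"
    hence "{x\<in>V. x \<in> e} = e" "card e = 2" using edges by auto
    thus "(\<Sum>x\<in>V. if x \<in> e then 1 else (0::nat)) = 2" using finV by (simp add: sum.inter_filter[symmetric])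
  qed
  finally show ?thesis by simp
qed

text \<open>The vertices of degree less than half of the average contribute at most half of the degree sum.\<close>

lemma degree_sum_X: "real (card E) \<le> (\<Sum>x\<in>X. real (deg x))"
proof -
  have "2 * real (card E) = (\<Sum>x\<in>V. real (deg x))" using handshake by (simp flip: of_nat_sum)
  also have "\<dots> = (\<Sum>x\<in>X. real (deg x)) + (\<Sum>x\<in>V - X. real (deg x))"
    using finV by (subst sum.subset_diff[of X]) (auto simp: X_def)
  also have "(\<Sum>x\<in>V - X. real (deg x)) \<le> (\<Sum>x\<in>V. h)"
  proof -
    have "(\<Sum>x\<in>V - X. real (deg x)) \<le> (\<Sum>x\<in>V - X. h)" by (intro sum_mono) (auto simp: X_def)
    also have "\<dots> \<le> (\<Sum>x\<in>V. h)" using finV h_pos by (intro sum_mono2) auto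
    finally show ?thesis .
  qed
  also have "(\<Sum>x\<in>V. h) = card E" using V_pos by (simp add: h_def)
  finally show ?thesis by simp
qed

lemma deg_pos: "x \<in> X \<Longrightarrow> 0 < deg x" using h_pos by (auto simp: X_def intro: gr0I)

lemma \<rho>_nonneg: "0 \<le> \<rho> x" by (simp add: \<rho>_def)

lemma \<rho>_le: "x \<in> X \<Longrightarrow> \<rho> x \<le> 1 / h" using h_pos by (auto simp: \<rho>_def X_def intro!: divide_left_mono)

lemma \<rho>_deg: "x \<in> X \<Longrightarrow> \<rho> x ^ k * deg x ^ k = 1"
  using deg_pos[of x] by (simp add: \<rho>_def power_divide)

lemma g_nonneg: "0 \<le> g A" by (simp add: g_def sum_nonneg \<rho>_nonneg)

text \<open>The probability that \<open>i\<close> is mapped to \<open>v\<close>, given the images \<open>y\<close> of the elements of \<open>S\<close>.  It is to be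
read on the common neighbours of the images of \<open>nb i\<close>.\<close>

definition P :: "('s \<Rightarrow> 'v) \<Rightarrow> 't \<Rightarrow> 'v \<Rightarrow> real" where "P y i v = \<rho> v ^ (r - 1) / g (y ` nb i)"

lemma P_nonneg: "0 \<le> P y i v" by (simp add: P_def \<rho>_nonneg g_nonneg)

lemma P_sum: "(\<Sum>v\<in>com (y ` nb i). P y i v) \<le> 1"
  unfolding P_def sum_divide_distrib[symmetric] g_def[symmetric] by simp

lemma P_sum_eq: "g0 \<le> g (y ` nb i) \<Longrightarrow> (\<Sum>v\<in>com (y ` nb i). P y i v) = 1"
  unfolding P_def sum_divide_distrib[symmetric] g_def[symmetric] using g0_pos by simp

lemma P_le: "g0 \<le> g (y ` nb i) \<Longrightarrow> v \<in> X \<Longrightarrow> P y i v \<le> \<eta>"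
  unfolding P_def \<eta>_def using g0_pos \<rho>_nonneg \<rho>_le h_pos by (intro frac_le power_mono) auto

text \<open>The injective choices of images of \<open>S\<close> among the neighbours of \<open>x\<close> for which the image of every \<open>nb i\<close>
has many common neighbours.\<close>

definition Y :: "'v \<Rightarrow> ('s \<Rightarrow> 'v) set" where
  "Y x = {y \<in> S \<rightarrow>\<^sub>E N x. inj_on y S \<and> (\<forall>i\<in>T. g0 \<le> g (y ` nb i))}"

text \<open>The choices of images of \<open>T\<close> that complete \<open>x\<close> and \<open>y\<close> to a copy.\<close>

definition Tt :: "'v \<Rightarrow> ('s \<Rightarrow> 'v) \<Rightarrow> ('t \<Rightarrow> 'v) set" where
  "Tt x y = {t \<in> (\<Pi>\<^sub>E i\<in>T. com (y ` nb i)). inj_on t T \<and> x \<notin> t ` T \<and> t ` T \<inter> y ` S = {}}"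

lemma card_T_nb_le: "i \<in> T \<Longrightarrow> r \<le> card S" using card_nb nb finS card_mono by metis

lemma finPiES: "finite (S \<rightarrow>\<^sub>E N x)" using finS finN by (intro finite_PiE) auto

lemma finY: "finite (Y x)" using finPiES by (simp add: Y_def)

lemma finTt0: "finite (\<Pi>\<^sub>E i\<in>T. com (y ` nb i))" using finT fincom by (intro finite_PiE) auto

lemma finTt: "finite (Tt x y)" using finTt0 by (simp add: Tt_def)

text \<open>Count pairs of a vertex \<open>x\<close> and a tuple of neighbours of \<open>x\<close> from the side of the tuple: with the
weight \<open>deg^(1-r)\<close> on \<open>x\<close>, a tuple is counted with total weight \<open>g\<close>, which is small for a bad one.\<close>

lemma bad_extensions:
  assumes i: "i \<in> T"
  shows "(\<Sum>x\<in>X. \<rho> x ^ (card S - 1) * card {y \<in> S \<rightarrow>\<^sub>E N x. g (y ` nb i) < g0}) \<le> card V ^ r * g0"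
proof -
  let ?A = "nb i"
  have A: "?A \<subseteq> S" "card ?A = r" using nb card_nb i by auto
  have fA: "finite ?A" using A finS finite_subset by blast
  have rS: "r \<le> card S" using card_T_nb_le[OF i] .
  let ?bad = "\<lambda>y. if g (y ` ?A) < g0 then 1 else (0::real)"
  have one: "\<rho> x ^ (card S - 1) * card {y \<in> S \<rightarrow>\<^sub>E N x. g (y ` nb i) < g0}
      \<le> (\<Sum>y\<in>?A \<rightarrow>\<^sub>E V. if y ` ?A \<subseteq> N x then ?bad y * \<rho> x ^ (r - 1) else 0)" if x: "x \<in> X" for x
  proof -
    have "real (card {y \<in> S \<rightarrow>\<^sub>E N x. g (y ` nb i) < g0}) = (\<Sum>y\<in>S \<rightarrow>\<^sub>E N x. ?bad y)"
      using finPiES[of x] by (simp add: sum.inter_filter[symmetric])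
    also have "\<dots> = (\<Sum>y | y \<in> S \<rightarrow>\<^sub>E N x \<and> (\<forall>i\<in>{}. y i = undefined). ?bad (restrict y ?A))"
      by (intro sum.cong) auto
    also have "\<dots> \<le> (\<Sum>y | y \<in> ?A \<rightarrow>\<^sub>E N x \<and> (\<forall>i\<in>{} \<inter> ?A. y i = undefined). ?bad y) * card (N x) ^ card (S - (?A \<union> {}))"
      using finS finN A by (intro sum_PiE_restrict_le) auto
    also have "\<dots> = (\<Sum>y\<in>?A \<rightarrow>\<^sub>E N x. ?bad y) * deg x ^ (card S - r)"
      using A fA by (simp add: deg_def card_Diff_subset)
    finally have "\<rho> x ^ (card S - 1) * card {y \<in> S \<rightarrow>\<^sub>E N x. g (y ` nb i) < g0}
        \<le> \<rho> x ^ (card S - 1) * ((\<Sum>y\<in>?A \<rightarrow>\<^sub>E N x. ?bad y) * deg x ^ (card S - r))"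
      using \<rho>_nonneg by (intro mult_left_mono) auto
    also have "\<rho> x ^ (card S - 1) * ((\<Sum>y\<in>?A \<rightarrow>\<^sub>E N x. ?bad y) * deg x ^ (card S - r))
       = (\<Sum>y\<in>?A \<rightarrow>\<^sub>E N x. ?bad y) * \<rho> x ^ (r - 1) * (\<rho> x ^ (card S - r) * deg x ^ (card S - r))"
    proof -
      have "card S - 1 = (r - 1) + (card S - r)" using rS r2 by simp
      thus ?thesis by (simp only: power_add mult_ac)
    qed
    also have "\<dots> = (\<Sum>y\<in>?A \<rightarrow>\<^sub>E N x. ?bad y * \<rho> x ^ (r - 1))"
      using \<rho>_deg[OF x] by (simp add: sum_distrib_right)
    also have "\<dots> = (\<Sum>y\<in>?A \<rightarrow>\<^sub>E V. if y ` ?A \<subseteq> N x then ?bad y * \<rho> x ^ (r - 1) else 0)"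
    proof (rule sum.mono_neutral_cong_left)
      show "finite (?A \<rightarrow>\<^sub>E V)" using fA finV by (intro finite_PiE) auto
      show "?A \<rightarrow>\<^sub>E N x \<subseteq> ?A \<rightarrow>\<^sub>E V" using N_sub by (intro PiE_mono) auto
      show "\<forall>y\<in>(?A \<rightarrow>\<^sub>E V) - (?A \<rightarrow>\<^sub>E N x). (if y ` ?A \<subseteq> N x then ?bad y * \<rho> x ^ (r - 1) else 0) = 0"
        by (auto simp: PiE_iff)
      show "?bad y * \<rho> x ^ (r - 1) = (if y ` ?A \<subseteq> N x then ?bad y * \<rho> x ^ (r - 1) else 0)"
        if "y \<in> ?A \<rightarrow>\<^sub>E N x" for y using that by (auto simp: PiE_iff)
    qed
    finally show ?thesis .
  qed
  have "(\<Sum>x\<in>X. \<rho> x ^ (card S - 1) * card {y \<in> S \<rightarrow>\<^sub>E N x. g (y ` nb i) < g0})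
      \<le> (\<Sum>x\<in>X. \<Sum>y\<in>?A \<rightarrow>\<^sub>E V. if y ` ?A \<subseteq> N x then ?bad y * \<rho> x ^ (r - 1) else 0)"
    using one by (rule sum_mono)
  also have "\<dots> = (\<Sum>y\<in>?A \<rightarrow>\<^sub>E V. \<Sum>x\<in>X. if y ` ?A \<subseteq> N x then ?bad y * \<rho> x ^ (r - 1) else 0)"
    by (rule sum.swap)
  also have "\<dots> = (\<Sum>y\<in>?A \<rightarrow>\<^sub>E V. ?bad y * g (y ` ?A))"
  proof (rule sum.cong[OF refl])
    fix y
    have "(\<Sum>x\<in>X. if y ` ?A \<subseteq> N x then ?bad y * \<rho> x ^ (r - 1) else 0)
      = (\<Sum>x\<in>com (y ` ?A). ?bad y * \<rho> x ^ (r - 1))"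
      unfolding com_def using finX by (rule sum.inter_filter[symmetric])
    thus "(\<Sum>x\<in>X. if y ` ?A \<subseteq> N x then ?bad y * \<rho> x ^ (r - 1) else 0) = ?bad y * g (y ` ?A)"
      by (simp add: g_def sum_distrib_left)
  qed
  also have "\<dots> \<le> (\<Sum>y\<in>?A \<rightarrow>\<^sub>E V. g0)" using g0_pos by (intro sum_mono) auto
  also have "\<dots> = card V ^ r * g0" using fA A by (simp add: card_PiE)
  finally show ?thesis .
qed

lemma noninjective_extensions:
  "(\<Sum>x\<in>X. \<rho> x ^ (card S - 1) * card {y \<in> S \<rightarrow>\<^sub>E N x. \<not> inj_on y S}) \<le> real (card S) ^ 2 * card V"
proof -
  have one: "\<rho> x ^ (card S - 1) * card {y \<in> S \<rightarrow>\<^sub>E N x. \<not> inj_on y S} \<le> real (card S) ^ 2" if x: "x \<in> X" for x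
  proof -
    let ?I = "{(a,b). a \<in> S \<and> b \<in> S \<and> a \<noteq> b}"
    let ?Q = "\<lambda>(a,b). {y \<in> S \<rightarrow>\<^sub>E N x. y a = y b}"
    have I: "finite ?I" "card ?I \<le> card S ^ 2"
      using finS card_mono[of "S \<times> S" ?I] finite_subset[of ?I "S \<times> S"]
      by (auto simp: card_cartesian_product power2_eq_square)
    have Q: "card (?Q p) \<le> deg x ^ (card S - 1)" if p: "p \<in> ?I" for p
    proof -
      obtain a b where ab: "p = (a,b)" "a \<in> S" "b \<in> S" "a \<noteq> b" using p by auto
      have "card {y \<in> S \<rightarrow>\<^sub>E N x. y a = y b} \<le> card ((S - {a}) \<rightarrow>\<^sub>E N x)"
      proof (rule card_inj_on_le[where f = "\<lambda>y. restrict y (S - {a})"])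
        show "inj_on (\<lambda>y. restrict y (S - {a})) {y \<in> S \<rightarrow>\<^sub>E N x. y a = y b}"
        proof (rule inj_onI)
          fix y z assume y: "y \<in> {y \<in> S \<rightarrow>\<^sub>E N x. y a = y b}" and z: "z \<in> {y \<in> S \<rightarrow>\<^sub>E N x. y a = y b}"
            and eq: "restrict y (S - {a}) = restrict z (S - {a})"
          have off: "y c = z c" if "c \<in> S" "c \<noteq> a" for c
            using fun_cong[OF eq, of c] that by simp
          have "y a = z a" using off[of b] ab y z by simp
          have "y c = z c" if "c \<in> S" for c using off[OF that] \<open>y a = z a\<close> by (cases "c = a") auto
          with y z show "y = z" by (intro PiE_ext[of y S "\<lambda>_. N x" z]) auto
        qed
        show "finite ((S - {a}) \<rightarrow>\<^sub>E N x)" using finS finN by (intro finite_PiE) auto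
        show "(\<lambda>y. restrict y (S - {a})) ` {y \<in> S \<rightarrow>\<^sub>E N x. y a = y b} \<subseteq> (S - {a}) \<rightarrow>\<^sub>E N x"
          by (auto simp: PiE_def Pi_def)
      qed
      thus ?thesis using ab finS by (simp add: card_PiE deg_def)
    qed
    have "{y \<in> S \<rightarrow>\<^sub>E N x. \<not> inj_on y S} \<subseteq> (\<Union>p\<in>?I. ?Q p)" by (auto simp: inj_on_def)
    hence "card {y \<in> S \<rightarrow>\<^sub>E N x. \<not> inj_on y S} \<le> card (\<Union>p\<in>?I. ?Q p)"
      using I finPiES by (intro card_mono finite_UN_I) auto
    also have "\<dots> \<le> (\<Sum>p\<in>?I. card (?Q p))" using I(1) by (rule card_UN_le)
    also have "\<dots> \<le> (\<Sum>p\<in>?I. deg x ^ (card S - 1))" using Q by (rule sum_mono)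
    also have "\<dots> \<le> card S ^ 2 * deg x ^ (card S - 1)" using I by (simp add: mult_right_mono)
    finally have "real (card {y \<in> S \<rightarrow>\<^sub>E N x. \<not> inj_on y S}) \<le> real (card S ^ 2 * deg x ^ (card S - 1))"
      by (rule of_nat_mono)
    hence "\<rho> x ^ (card S - 1) * card {y \<in> S \<rightarrow>\<^sub>E N x. \<not> inj_on y S}
       \<le> \<rho> x ^ (card S - 1) * (real (card S) ^ 2 * deg x ^ (card S - 1))"
      using \<rho>_nonneg by (intro mult_left_mono) auto
    also have "\<dots> = real (card S) ^ 2" using \<rho>_deg[OF x, of "card S - 1"] by (simp add: mult_ac)
    finally show ?thesis .
  qed
  have "(\<Sum>x\<in>X. \<rho> x ^ (card S - 1) * card {y \<in> S \<rightarrow>\<^sub>E N x. \<not> inj_on y S}) \<le> (\<Sum>x\<in>X. real (card S) ^ 2)"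
    using one by (rule sum_mono)
  also have "\<dots> \<le> (\<Sum>x\<in>V. real (card S) ^ 2)" using finV by (intro sum_mono2) (auto simp: X_def)
  finally show ?thesis by (simp add: mult.commute)
qed

text \<open>Without any restriction on the tuples, each \<open>x\<close> contributes its degree.  Non-injective tuples and tuples
with few common neighbours take away at most a quarter each.\<close>

lemma good_extensions:
  assumes h: "4 * real (card S) ^ 2 \<le> h"
  shows "card E / 2 \<le> (\<Sum>x\<in>X. \<rho> x ^ (card S - 1) * card (Y x))"
proof -
  let ?c = "\<lambda>x. \<rho> x ^ (card S - 1)"
  have S1: "card S = Suc (card S - 1)" using finS neS by (simp add: card_gt_0_iff)
  have "real (card E) \<le> (\<Sum>x\<in>X. real (deg x))" by (rule degree_sum_X)
  also have "\<dots> = (\<Sum>x\<in>X. ?c x * card (S \<rightarrow>\<^sub>E N x))"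
  proof (rule sum.cong[OF refl])
    fix x assume x: "x \<in> X"
    have "?c x * card (S \<rightarrow>\<^sub>E N x) = ?c x * deg x ^ Suc (card S - 1)"
      using finS S1 by (simp add: card_PiE deg_def)
    also have "\<dots> = deg x" using \<rho>_deg[OF x, of "card S - 1"] by (simp add: mult_ac)
    finally show "real (deg x) = ?c x * card (S \<rightarrow>\<^sub>E N x)" ..
  qed
  also have "\<dots> \<le> (\<Sum>x\<in>X. ?c x * card (Y x) + (?c x * card {y \<in> S \<rightarrow>\<^sub>E N x. \<not> inj_on y S}
      + (\<Sum>i\<in>T. ?c x * card {y \<in> S \<rightarrow>\<^sub>E N x. g (y ` nb i) < g0})))"
  proof (rule sum_mono)
    fix x
    let ?B = "\<Union>i\<in>T. {y \<in> S \<rightarrow>\<^sub>E N x. g (y ` nb i) < g0}"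
    have "S \<rightarrow>\<^sub>E N x \<subseteq> Y x \<union> ({y \<in> S \<rightarrow>\<^sub>E N x. \<not> inj_on y S} \<union> ?B)"
      unfolding Y_def by (auto simp: not_less[symmetric])
    hence "card (S \<rightarrow>\<^sub>E N x) \<le> card (Y x \<union> ({y \<in> S \<rightarrow>\<^sub>E N x. \<not> inj_on y S} \<union> ?B))"
      using finPiES finY finT by (intro card_mono finite_UnI finite_UN_I) auto
    also have "\<dots> \<le> card (Y x) + (card {y \<in> S \<rightarrow>\<^sub>E N x. \<not> inj_on y S} + card ?B)"
      by (meson add_left_mono card_Un_le order_trans)
    also have "card ?B \<le> (\<Sum>i\<in>T. card {y \<in> S \<rightarrow>\<^sub>E N x. g (y ` nb i) < g0})"
      using finT by (rule card_UN_le)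
    finally have "real (card (S \<rightarrow>\<^sub>E N x)) \<le> real (card (Y x) + (card {y \<in> S \<rightarrow>\<^sub>E N x. \<not> inj_on y S}
       + (\<Sum>i\<in>T. card {y \<in> S \<rightarrow>\<^sub>E N x. g (y ` nb i) < g0})))" by (simp only: of_nat_le_iff)
    hence "?c x * card (S \<rightarrow>\<^sub>E N x) \<le> ?c x * real (card (Y x) + (card {y \<in> S \<rightarrow>\<^sub>E N x. \<not> inj_on y S}
       + (\<Sum>i\<in>T. card {y \<in> S \<rightarrow>\<^sub>E N x. g (y ` nb i) < g0})))"
      using \<rho>_nonneg by (intro mult_left_mono) auto
    thus "?c x * card (S \<rightarrow>\<^sub>E N x) \<le> ?c x * card (Y x) + (?c x * card {y \<in> S \<rightarrow>\<^sub>E N x. \<not> inj_on y S}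
      + (\<Sum>i\<in>T. ?c x * card {y \<in> S \<rightarrow>\<^sub>E N x. g (y ` nb i) < g0}))"
      by (simp add: distrib_left sum_distrib_left)
  qed
  also have "\<dots> = (\<Sum>x\<in>X. ?c x * card (Y x)) + ((\<Sum>x\<in>X. ?c x * card {y \<in> S \<rightarrow>\<^sub>E N x. \<not> inj_on y S})
      + (\<Sum>i\<in>T. \<Sum>x\<in>X. ?c x * card {y \<in> S \<rightarrow>\<^sub>E N x. g (y ` nb i) < g0}))"
    by (simp add: sum.distrib sum.swap[of _ X])
  also have "\<dots> \<le> (\<Sum>x\<in>X. ?c x * card (Y x)) + (real (card S) ^ 2 * card V + (\<Sum>i\<in>T. card V ^ r * g0))"
    using noninjective_extensions bad_extensions by (intro add_left_mono add_mono sum_mono) auto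
  also have "real (card S) ^ 2 * card V \<le> card E / 4"
    using h V_pos by (simp add: h_def field_simps)
  also have "(\<Sum>i\<in>T. card V ^ r * g0) \<le> card E / 4"
  proof -
    have "(\<Sum>i\<in>T. card V ^ r * g0) = card T / (card T + 1) * (card E / 4)"
    proof -
      have "card V ^ r * g0 = card E / (4 * (real (card T) + 1))" using V_pos by (simp add: g0_def)
      thus ?thesis by (simp add: mult.commute)
    qed
    also have "\<dots> \<le> 1 * (card E / 4)" by (intro mult_right_mono) auto
    finally show ?thesis by simp
  qed
  finally show ?thesis by simp
qed

text \<open>The images of the elements of \<open>T\<close> are chosen independently with the probabilities \<open>P\<close>.  Each of the
at most \<open>(|T| + |S| + 1)^2\<close> coincidences to be avoided has probability at most \<open>\<eta>\<close>.\<close>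

lemma extension_weight:
  assumes y: "y \<in> Y x" and \<eta>: "(real (card T) + card S + 1) ^ 2 * \<eta> \<le> 1 / 2"
  shows "1 / 2 \<le> (\<Sum>t\<in>Tt x y. \<Prod>i\<in>T. P y i (t i))"
proof -
  let ?f = "\<lambda>t. \<Prod>i\<in>T. P y i (t i)"
  let ?A = "\<Pi>\<^sub>E i\<in>T. com (y ` nb i)"
  have f0: "0 \<le> ?f t" for t by (intro prod_nonneg ballI P_nonneg)
  have good: "g0 \<le> g (y ` nb i)" if "i \<in> T" for i using y that by (simp add: Y_def)
  have fix_le: "(\<Sum>t | t \<in> ?A \<and> (\<forall>i\<in>D. t i = u i). ?f t) \<le> (\<Prod>i\<in>D. P y i (u i))" if "D \<subseteq> T" for D u
    using finT fincom that P_nonneg P_sum by (intro sum_prod_PiE_fixed_le) auto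
  let ?I1 = "{(i,j). i \<in> T \<and> j \<in> T \<and> i \<noteq> j}"
  let ?B1 = "\<lambda>(i,j). {t \<in> ?A. t i = t j}"
  let ?I2 = "T \<times> insert x (y ` S)"
  let ?B2 = "\<lambda>(i,v). {t \<in> ?A. t i = v}"
  have I1: "finite ?I1" "card ?I1 \<le> card T * card T"
    using finT card_mono[of "T \<times> T" ?I1] finite_subset[of ?I1 "T \<times> T"]
    by (auto simp: card_cartesian_product)
  have "card (insert x (y ` S)) \<le> card S + 1"
    using finS card_image_le[of S y] card_insert_le_m1[of "card S + 1" "y ` S" x] by simp
  hence I2: "finite ?I2" "card ?I2 \<le> card T * (card S + 1)"
    using finT finS unfolding card_cartesian_product by (simp, intro mult_le_mono) auto
  have U1: "(\<Union>p\<in>?I1. ?B1 p) \<subseteq> ?A" by (rule UN_least) (simp split: prod.split)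
  have U2: "(\<Union>p\<in>?I2. ?B2 p) \<subseteq> ?A" by (rule UN_least) (simp split: prod.split)
  have fB: "finite (\<Union>p\<in>?I1. ?B1 p)" "finite (\<Union>p\<in>?I2. ?B2 p)"
    by (rule finite_subset[OF U1 finTt0], rule finite_subset[OF U2 finTt0])
  have fB1: "finite (?B1 p)" and fB2: "finite (?B2 p')" for p p'
    using finTt0 by (simp_all split: prod.split)
  have B1: "(\<Sum>t\<in>?B1 p. ?f t) \<le> \<eta>" if pI: "p \<in> ?I1" for p
  proof -
    obtain i j where p: "p = (i,j)" "i \<in> T" "j \<in> T" "i \<noteq> j" using pI by auto
    have "?B1 p = (\<Union>v\<in>com (y ` nb i). {t. t \<in> ?A \<and> (\<forall>k\<in>{i,j}. t k = v)})"
      using p by (auto simp: PiE_iff)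
    hence "(\<Sum>t\<in>?B1 p. ?f t) \<le> (\<Sum>v\<in>com (y ` nb i). \<Sum>t | t \<in> ?A \<and> (\<forall>k\<in>{i,j}. t k = v). ?f t)"
      using fincom finTt0 f0 by (simp only:) (intro sum_UN_le, auto)
    also have "\<dots> \<le> (\<Sum>v\<in>com (y ` nb i). \<Prod>k\<in>{i,j}. P y k v)"
      using p by (intro sum_mono fix_le) auto
    also have "\<dots> = (\<Sum>v\<in>com (y ` nb i). P y i v * P y j v)" using p by simp
    also have "\<dots> \<le> (\<Sum>v\<in>com (y ` nb i). P y i v * \<eta>)"
      using P_nonneg P_le[OF good[OF p(3)]] by (intro sum_mono mult_left_mono) (auto simp: com_def)
    also have "\<dots> = (\<Sum>v\<in>com (y ` nb i). P y i v) * \<eta>" by (simp add: sum_distrib_right)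
    also have "\<dots> \<le> 1 * \<eta>" using P_sum \<eta>_pos by (intro mult_right_mono) auto
    finally show ?thesis by simp
  qed
  have B2: "(\<Sum>t\<in>?B2 p. ?f t) \<le> \<eta>" if pI: "p \<in> ?I2" for p
  proof -
    obtain i v where p: "p = (i,v)" "i \<in> T" using pI by auto
    show ?thesis
    proof (cases "v \<in> X")
      case True
      have "(\<Sum>t\<in>?B2 p. ?f t) = (\<Sum>t | t \<in> ?A \<and> (\<forall>k\<in>{i}. t k = v). ?f t)" using p by simp
      also have "\<dots> \<le> (\<Prod>k\<in>{i}. P y k v)" using p by (intro fix_le) auto
      also have "\<dots> \<le> \<eta>" using P_le[OF good[OF p(2)] True] by simp
      finally show ?thesis .
    next
      case False
      hence "?B2 p = {}" using p by (auto simp: PiE_iff com_def)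
      thus ?thesis using \<eta>_pos by (simp only: sum.empty less_imp_le)
    qed
  qed
  have "1 = (\<Prod>i\<in>T. \<Sum>v\<in>com (y ` nb i). P y i v)" using P_sum_eq[OF good] by simp
  also have "\<dots> = (\<Sum>t\<in>?A. ?f t)" using finT fincom by (rule prod_sum_PiE)
  also have "\<dots> \<le> (\<Sum>t\<in>Tt x y \<union> ((\<Union>p\<in>?I1. ?B1 p) \<union> (\<Union>p\<in>?I2. ?B2 p)). ?f t)"
  proof (rule sum_mono2)
    show "finite (Tt x y \<union> ((\<Union>p\<in>?I1. ?B1 p) \<union> (\<Union>p\<in>?I2. ?B2 p)))"
      by (intro finite_UnI finTt fB)
    show "?A \<subseteq> Tt x y \<union> ((\<Union>p\<in>?I1. ?B1 p) \<union> (\<Union>p\<in>?I2. ?B2 p))"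
    proof
      fix t assume t: "t \<in> ?A"
      show "t \<in> Tt x y \<union> ((\<Union>p\<in>?I1. ?B1 p) \<union> (\<Union>p\<in>?I2. ?B2 p))"
      proof (cases "t \<in> Tt x y")
        case False
        hence "\<not> inj_on t T \<or> x \<in> t ` T \<or> t ` T \<inter> y ` S \<noteq> {}" using t unfolding Tt_def by blast
        then consider i j where "i \<in> T" "j \<in> T" "i \<noteq> j" "t i = t j"
          | i where "i \<in> T" "t i \<in> insert x (y ` S)"
          unfolding inj_on_def by (elim disjE) blast+
        hence "t \<in> (\<Union>p\<in>?I1. ?B1 p) \<or> t \<in> (\<Union>p\<in>?I2. ?B2 p)"
        proof cases
          case (1 i j)
          have "(i, j) \<in> ?I1" "t \<in> ?B1 (i, j)" using 1 t by simp_all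
          thus ?thesis by blast
        next
          case (2 i)
          have "(i, t i) \<in> ?I2" "t \<in> ?B2 (i, t i)" using 2 t by simp_all
          thus ?thesis by blast
        qed
        thus ?thesis by blast
      qed simp
    qed
  qed (use f0 in auto)
  also have "\<dots> \<le> (\<Sum>t\<in>Tt x y. ?f t) + ((\<Sum>p\<in>?I1. \<Sum>t\<in>?B1 p. ?f t) + (\<Sum>p\<in>?I2. \<Sum>t\<in>?B2 p. ?f t))"
  proof -
    have un: "sum ?f (A \<union> B) \<le> sum ?f A + sum ?f B" if "finite A" "finite B" for A B
      using that f0 sum.union_inter[of A B ?f] sum_nonneg[of "A \<inter> B" ?f] by simp
    have "sum ?f (\<Union>p\<in>?I1. ?B1 p) \<le> (\<Sum>p\<in>?I1. sum ?f (?B1 p))"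
      by (rule sum_UN_le[OF I1(1) fB1 f0])
    moreover have "sum ?f (\<Union>p\<in>?I2. ?B2 p) \<le> (\<Sum>p\<in>?I2. sum ?f (?B2 p))"
      by (rule sum_UN_le[OF I2(1) fB2 f0])
    ultimately show ?thesis
      using un[OF finTt finite_UnI[OF fB], of x y] un[OF fB] by linarith
  qed
  also have "\<dots> \<le> (\<Sum>t\<in>Tt x y. ?f t) + ((\<Sum>p\<in>?I1. \<eta>) + (\<Sum>p\<in>?I2. \<eta>))"
    by (intro add_left_mono add_mono sum_mono B1 B2)
  also have "(\<Sum>p\<in>?I1. \<eta>) + (\<Sum>p\<in>?I2. \<eta>) = real (card ?I1 + card ?I2) * \<eta>"
    by (simp only: sum_constant of_nat_add distrib_right)
  also have "\<dots> \<le> (real (card T) + card S + 1) ^ 2 * \<eta>"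
  proof (intro mult_right_mono)
    have "real (card ?I1 + card ?I2) \<le> real (card T * card T + card T * (card S + 1))"
      using add_mono[OF I1(2) I2(2)] by (rule of_nat_mono)
    also have "\<dots> \<le> real ((card T + card S + 1) ^ 2)"
      by (simp only: of_nat_le_iff power2_eq_square) (simp add: algebra_simps)
    also have "\<dots> = (real (card T) + card S + 1) ^ 2" by (simp add: add_ac)
    finally show "real (card ?I1 + card ?I2) \<le> (real (card T) + card S + 1) ^ 2" .
  qed (use \<eta>_pos in simp)
  finally show ?thesis using \<eta> by simp
qed

subsection \<open>The hypergraph of weighted copies\<close>

text \<open>The image of a vertex of the pattern on the side of the root.\<close>

definition apex :: "'v \<Rightarrow> ('t \<Rightarrow> 'v) \<Rightarrow> 't option \<Rightarrow> 'v" where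
  "apex x t b = (case b of None \<Rightarrow> x | Some i \<Rightarrow> t i)"

definition place :: "'v \<times> ('s \<Rightarrow> 'v) \<times> ('t \<Rightarrow> 'v) \<Rightarrow> 't option \<times> 's \<Rightarrow> 'v set" where
  "place c p = (case c of (x, y, t) \<Rightarrow> {apex x t (fst p), y (snd p)})"

text \<open>A copy is given by the image of the root and the embeddings of \<open>S\<close> and of \<open>T\<close>.\<close>

definition copies :: "('v \<times> ('s \<Rightarrow> 'v) \<times> ('t \<Rightarrow> 'v)) set" where
  "copies = (SIGMA x:X. SIGMA y:Y x. Tt x y)"

text \<open>Up to normalisation, the probability of the copy in the following process: choose \<open>x\<close> with probability
proportional to its degree, then each image of an element of \<open>S\<close> uniformly among the neighbours of \<open>x\<close>, then
the images of \<open>T\<close> with the probabilities \<open>P\<close>.\<close>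

definition wt :: "'v \<times> ('s \<Rightarrow> 'v) \<times> ('t \<Rightarrow> 'v) \<Rightarrow> real" where
  "wt c = (case c of (x, y, t) \<Rightarrow> \<rho> x ^ (card S - 1) * (\<Prod>i\<in>T. P y i (t i)))"

definition weight :: "'v set set \<Rightarrow> real" where
  "weight e = (\<Sum>c | c \<in> copies \<and> place c ` slots = e. wt c)"

lemma fincopies: "finite copies"
  unfolding copies_def by (intro finite_SigmaI finX finY finTt)

lemma wt_nonneg: "0 \<le> wt c"
  by (simp add: wt_def \<rho>_nonneg P_nonneg prod_nonneg split: prod.split)

lemma weight_nonneg: "0 \<le> weight e"
  by (simp add: weight_def sum_nonneg wt_nonneg)

lemma sum_copies:
  "(\<Sum>c\<in>copies. f c) = (\<Sum>x\<in>X. \<Sum>y\<in>Y x. \<Sum>t\<in>Tt x y. f (x, y, t))"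
proof -
  have "(\<Sum>x\<in>X. \<Sum>y\<in>Y x. \<Sum>t\<in>Tt x y. f (x, y, t))
      = (\<Sum>x\<in>X. \<Sum>(y, t)\<in>(SIGMA y:Y x. Tt x y). f (x, y, t))"
    by (intro sum.cong refl sum.Sigma finY ballI finTt)
  also have "\<dots> = (\<Sum>(x, y, t)\<in>copies. f (x, y, t))"
    unfolding copies_def by (intro sum.Sigma finX ballI finite_SigmaI finY finTt)
  finally show ?thesis by (simp add: case_prod_unfold)
qed

lemma copies_adjacent:
  assumes c: "(x, y, t) \<in> copies" and s: "(b, a) \<in> slots"
  shows "y a \<in> N (apex x t b)"
  using slotsD(2)[OF s]
proof (elim disjE bexE)
  assume "b = None"
  thus ?thesis using c slotsD(1)[OF s] by (auto simp: copies_def Y_def apex_def PiE_iff)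
next
  fix i assume i: "i \<in> T" "b = Some i \<and> a \<in> nb i"
  have "t i \<in> com (y ` nb i)" using c i(1) by (auto simp: copies_def Tt_def PiE_iff)
  thus ?thesis using i by (auto simp: com_def apex_def)
qed

lemma place_edge:
  assumes "c \<in> copies" "p \<in> slots"
  shows "place c p \<in> E"
proof -
  obtain x y t b a where [simp]: "c = (x,y,t)" "p = (b,a)" by (metis prod.exhaust)
  show ?thesis using copies_adjacent[of x y t b a] assms by (simp add: place_def N_def)
qed

lemma apex_notin:
  assumes c: "(x, y, t) \<in> copies" and s: "(b, a) \<in> slots"
  shows "apex x t b \<notin> y ` S"
  using slotsD(2)[OF s]
proof (elim disjE bexE)
  assume "b = None"
  moreover have "y \<in> S \<rightarrow>\<^sub>E N x" using c by (auto simp: copies_def Y_def)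
  ultimately show ?thesis using N_irrefl by (auto simp: apex_def PiE_iff)
next
  fix i assume i: "i \<in> T" "b = Some i \<and> a \<in> nb i"
  thus ?thesis using c by (auto simp: copies_def Tt_def apex_def)
qed

lemma apex_inj:
  assumes c: "(x, y, t) \<in> copies" and s: "(b, a) \<in> slots" "(b', a') \<in> slots" and eq: "apex x t b = apex x t b'"
  shows "b = b'"
proof -
  have t: "inj_on t T" "x \<notin> t ` T" using c by (auto simp: copies_def Tt_def)
  show ?thesis using slotsD(2)[OF s(1)] slotsD(2)[OF s(2)] eq t
    by (elim disjE bexE) (auto simp: apex_def inj_on_def)
qed

text \<open>An image of the root or of \<open>T\<close> is never an image of \<open>S\<close>, so that an edge of the copy determines which
of its ends plays which role.\<close>

lemma inj_place:
  assumes "c \<in> copies"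
  shows "inj_on (place c) slots"
proof (rule inj_onI)
  fix p p' assume p: "p \<in> slots" "p' \<in> slots" and eq: "place c p = place c p'"
  obtain x y t where c: "c = (x,y,t)" by (metis prod.exhaust)
  obtain b a b' a' where [simp]: "p = (b,a)" "p' = (b',a')" by (metis prod.exhaust)
  have cc: "(x,y,t) \<in> copies" using assms c by simp
  have S: "a \<in> S" "a' \<in> S" using p slotsD(1) by auto
  have "apex x t b \<notin> y ` S" "apex x t b' \<notin> y ` S" using apex_notin[OF cc] p by auto
  hence "apex x t b \<noteq> y a'" "apex x t b' \<noteq> y a" using S by auto
  hence e: "apex x t b = apex x t b'" "y a = y a'"
    using eq by (auto simp: place_def c doubleton_eq_iff)
  have "inj_on y S" using cc by (auto simp: copies_def Y_def)
  hence "a = a'" using e(2) S by (auto simp: inj_on_def)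
  thus "p = p'" using apex_inj[OF cc _ _ e(1)] p by simp
qed

lemma codegree_weight:
  "codegree E weight \<sigma> = (\<Sum>c | c \<in> copies \<and> \<sigma> \<subseteq> place c ` slots. wt c)"
proof -
  let ?C = "{c. c \<in> copies \<and> \<sigma> \<subseteq> place c ` slots}"
  let ?E = "{e. e \<subseteq> E \<and> \<sigma> \<subseteq> e}"
  have fE: "finite ?E" using finE by simp
  have fC: "finite ?C" using fincopies by simp
  have maps: "(\<lambda>c. place c ` slots) ` ?C \<subseteq> ?E" using place_edge by blast
  have "(\<Sum>c\<in>?C. wt c) = (\<Sum>e\<in>?E. \<Sum>c\<in>{c\<in>?C. place c ` slots = e}. wt c)"
    using sum.group[OF fC fE maps, of wt] by simp
  also have "\<dots> = (\<Sum>e\<in>?E. weight e)"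
    unfolding weight_def by (intro sum.cong refl) auto
  finally show ?thesis by (simp add: codegree_def)
qed

lemma weight_support:
  assumes "0 < weight e"
  shows "e \<subseteq> E \<and> card e = card slots" "\<exists>c\<in>copies. place c ` slots = e"
proof -
  show *: "\<exists>c\<in>copies. place c ` slots = e"
  proof (rule ccontr)
    assume "\<not> ?thesis"
    hence "{c. c \<in> copies \<and> place c ` slots = e} = {}" by blast
    thus False using assms by (simp only: weight_def sum.empty)
  qed
  then obtain c where c: "c \<in> copies" "e = place c ` slots" by blast
  thus "e \<subseteq> E \<and> card e = card slots"
    using place_edge[OF c(1)] card_image[OF inj_place[OF c(1)]] by blast
qed

lemma total_weight:
  assumes h: "4 * real (card S) ^ 2 \<le> h" and \<eta>: "(real (card T) + card S + 1) ^ 2 * \<eta> \<le> 1 / 2"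
  shows "card E / 4 \<le> codegree E weight {}"
proof -
  have "card E / 4 \<le> (\<Sum>x\<in>X. \<rho> x ^ (card S - 1) * card (Y x)) / 2" using good_extensions[OF h] by simp
  also have "\<dots> = (\<Sum>x\<in>X. \<Sum>y\<in>Y x. \<rho> x ^ (card S - 1) * (1 / 2))"
    by (simp add: sum_divide_distrib mult.commute)
  also have "\<dots> \<le> (\<Sum>x\<in>X. \<Sum>y\<in>Y x. \<rho> x ^ (card S - 1) * (\<Sum>t\<in>Tt x y. \<Prod>i\<in>T. P y i (t i)))"
    using extension_weight[OF _ \<eta>] \<rho>_nonneg by (intro sum_mono mult_left_mono) auto
  also have "\<dots> = (\<Sum>c\<in>copies. wt c)"
    by (simp add: sum_copies wt_def sum_distrib_left)
  also have "\<dots> = codegree E weight {}" by (simp add: codegree_weight)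
  finally show ?thesis .
qed

lemma tail_sum:
  assumes y: "y \<in> Y x" and sub: "D \<subseteq> T" and vX: "\<And>i. i \<in> D \<Longrightarrow> v i \<in> X"
  shows "(\<Sum>t | t \<in> Tt x y \<and> (\<forall>i\<in>D. t i = v i). \<Prod>i\<in>T. P y i (t i)) \<le> (\<Prod>i\<in>D. P y i (v i))"
    "i \<in> D \<Longrightarrow> P y i (v i) \<le> \<eta>"
proof -
  have "(\<Sum>t | t \<in> Tt x y \<and> (\<forall>i\<in>D. t i = v i). \<Prod>i\<in>T. P y i (t i))
      \<le> (\<Sum>t | t \<in> (\<Pi>\<^sub>E i\<in>T. com (y ` nb i)) \<and> (\<forall>i\<in>D. t i = v i). \<Prod>i\<in>T. P y i (t i))"
  proof (rule sum_mono2)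
    show "finite {t. t \<in> (\<Pi>\<^sub>E i\<in>T. com (y ` nb i)) \<and> (\<forall>i\<in>D. t i = v i)}"
      using finTt0 by simp
    show "0 \<le> (\<Prod>i\<in>T. P y i (t i))" for t by (intro prod_nonneg P_nonneg)
  qed (auto simp: Tt_def)
  also have "\<dots> \<le> (\<Prod>i\<in>D. P y i (v i))"
    by (rule sum_prod_PiE_fixed_le[OF finT fincom sub P_nonneg P_sum])
  finally show "(\<Sum>t | t \<in> Tt x y \<and> (\<forall>i\<in>D. t i = v i). \<Prod>i\<in>T. P y i (t i)) \<le> (\<Prod>i\<in>D. P y i (v i))" .
  show "P y i (v i) \<le> \<eta>" if "i \<in> D"
    using y sub that vX by (intro P_le) (auto simp: Y_def)
qed

text \<open>When \<open>x\<close> is prescribed, each prescribed image of an element of \<open>S\<close> costs a factor \<open>1 / deg x\<close>, except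
for one that is compensated by the choice of \<open>x\<close> proportionally to its degree.\<close>

lemma rooted_sum:
  assumes S': "S' \<subseteq> S" "S' \<noteq> {}" and T': "T' \<subseteq> T" and x0: "x0 \<in> X" and vX: "\<And>i. i \<in> T' \<Longrightarrow> v i \<in> X"
  shows "(\<Sum>y | y \<in> Y x0 \<and> (\<forall>a\<in>S'. y a = u a). \<Sum>t | t \<in> Tt x0 y \<and> (\<forall>i\<in>T'. t i = v i). wt (x0, y, t))
     \<le> (1 / h) ^ (card S' - 1) * \<eta> ^ card T'"
proof -
  let ?c = "\<rho> x0 ^ (card S - 1)"
  have cS: "1 \<le> card S'" "card S' \<le> card S"
    using S' finS by (auto simp: Suc_le_eq card_gt_0_iff card_mono intro: finite_subset)
  have fY: "finite {y. y \<in> Y x0 \<and> (\<forall>a\<in>S'. y a = u a)}" using finY by simp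
  have "(\<Sum>y | y \<in> Y x0 \<and> (\<forall>a\<in>S'. y a = u a). \<Sum>t | t \<in> Tt x0 y \<and> (\<forall>i\<in>T'. t i = v i). wt (x0, y, t))
     \<le> (\<Sum>y | y \<in> Y x0 \<and> (\<forall>a\<in>S'. y a = u a). ?c * \<eta> ^ card T')"
  proof (rule sum_mono)
    fix y assume "y \<in> {y. y \<in> Y x0 \<and> (\<forall>a\<in>S'. y a = u a)}"
    hence y: "y \<in> Y x0" by simp
    have "(\<Sum>t | t \<in> Tt x0 y \<and> (\<forall>i\<in>T'. t i = v i). wt (x0, y, t))
      = ?c * (\<Sum>t | t \<in> Tt x0 y \<and> (\<forall>i\<in>T'. t i = v i). \<Prod>i\<in>T. P y i (t i))"
      by (simp add: wt_def sum_distrib_left)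
    also have "\<dots> \<le> ?c * (\<Prod>i\<in>T'. P y i (v i))"
      using \<rho>_nonneg tail_sum(1)[OF y T' vX] by (intro mult_left_mono) auto
    also have "\<dots> \<le> ?c * (\<Prod>i\<in>T'. \<eta>)"
      using \<rho>_nonneg tail_sum(2)[OF y T' vX] P_nonneg by (intro mult_left_mono prod_mono) auto
    finally show "(\<Sum>t | t \<in> Tt x0 y \<and> (\<forall>i\<in>T'. t i = v i). wt (x0, y, t)) \<le> ?c * \<eta> ^ card T'" by simp
  qed
  also have "\<dots> = real (card {y. y \<in> Y x0 \<and> (\<forall>a\<in>S'. y a = u a)}) * (?c * \<eta> ^ card T')" by simp
  also have "\<dots> \<le> real (deg x0 ^ (card S - card S')) * (?c * \<eta> ^ card T')"
  proof (intro mult_right_mono of_nat_mono)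
    have "card {y. y \<in> Y x0 \<and> (\<forall>a\<in>S'. y a = u a)} \<le> card {y \<in> S \<rightarrow>\<^sub>E N x0. \<forall>a\<in>S'. y a = u a}"
      using finPiES by (intro card_mono) (auto simp: Y_def)
    also have "\<dots> \<le> card (N x0) ^ card (S - S')" by (rule card_PiE_fixed_le[OF finS finN S'(1)])
    also have "card (S - S') = card S - card S'"
      using S'(1) finS by (intro card_Diff_subset) (auto intro: finite_subset)
    finally show "card {y. y \<in> Y x0 \<and> (\<forall>a\<in>S'. y a = u a)} \<le> deg x0 ^ (card S - card S')"
      by (simp add: deg_def)
  qed (use \<rho>_nonneg \<eta>_pos in simp)
  also have "\<dots> = \<rho> x0 ^ (card S' - 1) * \<eta> ^ card T' * (\<rho> x0 ^ (card S - card S') * deg x0 ^ (card S - card S'))"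
  proof -
    have "card S - 1 = (card S' - 1) + (card S - card S')" using cS by simp
    thus ?thesis by (simp add: power_add)
  qed
  also have "\<dots> = \<rho> x0 ^ (card S' - 1) * \<eta> ^ card T'" by (simp only: \<rho>_deg[OF x0] mult_1_right)
  also have "\<dots> \<le> (1 / h) ^ (card S' - 1) * \<eta> ^ card T'"
    using \<rho>_le[OF x0] \<rho>_nonneg \<eta>_pos by (intro mult_right_mono power_mono) auto
  finally show ?thesis .
qed

text \<open>When \<open>x\<close> is not prescribed, some prescribed \<open>i0 \<in> T\<close> takes over its role.  Given the image of \<open>nb i0\<close>,
the root and \<open>i0\<close> are both chosen among the common neighbours with weight \<open>deg^(1-r)\<close>.  The sum over \<open>x\<close>
cancels the denominator \<open>g\<close>, and what is left is the weight of choosing \<open>i0\<close> first and then the image of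
\<open>nb i0\<close> among its neighbours.\<close>

lemma unrooted_sum:
  assumes S': "S' \<subseteq> S" and T': "T' \<subseteq> T" and i0: "i0 \<in> T'" "S' \<inter> nb i0 \<noteq> {}"
    and vX: "\<And>i. i \<in> T' \<Longrightarrow> v i \<in> X"
  shows "(\<Sum>x\<in>X. \<Sum>y | y \<in> Y x \<and> (\<forall>a\<in>S'. y a = u a). \<Sum>t | t \<in> Tt x y \<and> (\<forall>i\<in>T'. t i = v i). wt (x, y, t))
     \<le> (1 / h) ^ (card S' - 1) * \<eta> ^ (card T' - 1)"
proof -
  let ?A = "nb i0" and ?w = "v i0"
  have iT: "i0 \<in> T" using i0 T' by auto
  have A: "?A \<subseteq> S" "card ?A = r" using nb card_nb iT by auto
  have fA: "finite ?A" using A finS finite_subset by blast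
  have fS': "finite S'" using S' finS finite_subset by blast
  have fT': "finite T'" using T' finT finite_subset by blast
  have wX: "?w \<in> X" using vX i0 by auto
  \<comment> \<open>Up to the constant \<open>?K\<close>, a bound for the weight of the completions of \<open>y\<close>; it depends on \<open>y\<close> through
    the image of \<open>nb i0\<close> alone.\<close>
  define F where "F = (\<lambda>y. if y ` ?A \<subseteq> N ?w then 1 / g (y ` ?A) else 0)"
  have F0: "0 \<le> F y" for y by (simp add: F_def g_nonneg)
  define k1 where "k1 = card (S' - ?A)"
  define k2 where "k2 = card (S - (?A \<union> S'))"
  define k3 where "k3 = card (S' \<inter> ?A)"
  have S_split: "card S = r + k1 + k2"
  proof -
    have "S = (?A \<union> (S' - ?A)) \<union> (S - (?A \<union> S'))" using A S' by auto
    hence "card S = card (?A \<union> (S' - ?A)) + k2"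
      unfolding k2_def using fA fS' finS by (subst card_Un_disjoint[symmetric]) auto
    also have "card (?A \<union> (S' - ?A)) = r + k1"
      unfolding k1_def using fA fS' A by (subst card_Un_disjoint) auto
    finally show ?thesis .
  qed
  have S'_split: "card S' = k1 + k3"
    unfolding k1_def k3_def using fS' card_Int_Diff[of S' ?A] by simp
  have k3: "1 \<le> k3" "k3 \<le> r"
    using i0(2) fS' card_mono[OF fA, of "S' \<inter> ?A"] A(2) by (auto simp: k3_def Suc_le_eq card_gt_0_iff)
  let ?Z = "\<lambda>x. {y. y \<in> ?A \<rightarrow>\<^sub>E N x \<and> (\<forall>a\<in>S' \<inter> ?A. y a = u a)}"
  let ?ZV = "{y. y \<in> ?A \<rightarrow>\<^sub>E V \<and> (\<forall>a\<in>S' \<inter> ?A. y a = u a)}"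
  let ?K = "\<rho> ?w ^ (r - 1) * \<eta> ^ (card T' - 1)"
  have K0: "0 \<le> ?K" using \<rho>_nonneg \<eta>_pos by simp
  have tails: "(\<Sum>t | t \<in> Tt x y \<and> (\<forall>i\<in>T'. t i = v i). wt (x, y, t))
     \<le> \<rho> x ^ (card S - 1) * (F y * ?K)" if y: "y \<in> Y x" for x y
  proof (cases "y ` ?A \<subseteq> N ?w")
    case True
    have "(\<Sum>t | t \<in> Tt x y \<and> (\<forall>i\<in>T'. t i = v i). wt (x, y, t))
      = \<rho> x ^ (card S - 1) * (\<Sum>t | t \<in> Tt x y \<and> (\<forall>i\<in>T'. t i = v i). \<Prod>i\<in>T. P y i (t i))"
      by (simp add: wt_def sum_distrib_left)
    also have "\<dots> \<le> \<rho> x ^ (card S - 1) * (\<Prod>i\<in>T'. P y i (v i))"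
      using \<rho>_nonneg tail_sum(1)[OF y T' vX] by (intro mult_left_mono) auto
    also have "(\<Prod>i\<in>T'. P y i (v i)) = P y i0 ?w * (\<Prod>i\<in>T' - {i0}. P y i (v i))"
      using fT' i0(1) by (rule prod.remove)
    also have "\<rho> x ^ (card S - 1) * \<dots> \<le> \<rho> x ^ (card S - 1) * (P y i0 ?w * (\<Prod>i\<in>T' - {i0}. \<eta>))"
      using \<rho>_nonneg tail_sum(2)[OF y T' vX] P_nonneg by (intro mult_left_mono prod_mono) auto
    also have "\<dots> = \<rho> x ^ (card S - 1) * (F y * ?K)"
      using True fT' i0(1) by (simp add: F_def P_def)
    finally show ?thesis .
  next
    case False
    have "{t. t \<in> Tt x y \<and> (\<forall>i\<in>T'. t i = v i)} = {}"
    proof (rule ccontr)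
      assume "\<not> ?thesis"
      then obtain t where t: "t \<in> Tt x y" "t i0 = ?w" using i0(1) by auto
      have "t i0 \<in> com (y ` ?A)" using t(1) iT by (auto simp: Tt_def PiE_iff)
      thus False using False t(2) by (simp add: com_def)
    qed
    thus ?thesis using F0 K0 \<rho>_nonneg by (simp only: sum.empty) simp
  qed
  have one: "(\<Sum>y | y \<in> Y x \<and> (\<forall>a\<in>S'. y a = u a). \<Sum>t | t \<in> Tt x y \<and> (\<forall>i\<in>T'. t i = v i). wt (x, y, t))
      \<le> (1 / h) ^ k1 * ?K * (\<Sum>y\<in>?ZV. if y ` ?A \<subseteq> N x then F y * \<rho> x ^ (r - 1) else 0)" if x: "x \<in> X" for x
  proof -
    have "(\<Sum>y | y \<in> Y x \<and> (\<forall>a\<in>S'. y a = u a). \<Sum>t | t \<in> Tt x y \<and> (\<forall>i\<in>T'. t i = v i). wt (x, y, t))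
      \<le> (\<Sum>y | y \<in> Y x \<and> (\<forall>a\<in>S'. y a = u a). \<rho> x ^ (card S - 1) * (F y * ?K))"
      using tails by (intro sum_mono) auto
    also have "\<dots> \<le> (\<Sum>y | y \<in> S \<rightarrow>\<^sub>E N x \<and> (\<forall>a\<in>S'. y a = u a). \<rho> x ^ (card S - 1) * (F y * ?K))"
    proof (rule sum_mono2)
      show "finite {y. y \<in> S \<rightarrow>\<^sub>E N x \<and> (\<forall>a\<in>S'. y a = u a)}" using finPiES by simp
      show "0 \<le> \<rho> x ^ (card S - 1) * (F y * ?K)" for y using F0 K0 \<rho>_nonneg by simp
    qed (auto simp: Y_def)
    also have "\<dots> = \<rho> x ^ (card S - 1) * ?K * (\<Sum>y | y \<in> S \<rightarrow>\<^sub>E N x \<and> (\<forall>a\<in>S'. y a = u a). F y)"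
      by (simp add: sum_distrib_left mult_ac)
    also have "(\<Sum>y | y \<in> S \<rightarrow>\<^sub>E N x \<and> (\<forall>a\<in>S'. y a = u a). F y)
        = (\<Sum>y | y \<in> S \<rightarrow>\<^sub>E N x \<and> (\<forall>a\<in>S'. y a = u a). F (restrict y ?A))"
      by (intro sum.cong refl) (simp add: F_def)
    also have "\<rho> x ^ (card S - 1) * ?K * \<dots> \<le> \<rho> x ^ (card S - 1) * ?K *
       ((\<Sum>y\<in>?Z x. F y) * card (N x) ^ card (S - (?A \<union> S')))"
      using sum_PiE_restrict_le[where f = F and u = u, OF finS finN[of x] S' A(1) F0] \<rho>_nonneg K0
      by (intro mult_left_mono) auto
    also have "\<dots> = ?K * (\<Sum>y\<in>?Z x. F y) * (\<rho> x ^ (r - 1) * \<rho> x ^ k1 * (\<rho> x ^ k2 * deg x ^ k2))"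
    proof -
      have "card S - 1 = (r - 1) + k1 + k2" using S_split r2 by simp
      thus ?thesis by (simp add: power_add deg_def k2_def)
    qed
    also have "\<dots> = ?K * (\<Sum>y\<in>?Z x. F y) * \<rho> x ^ (r - 1) * \<rho> x ^ k1"
      by (simp only: \<rho>_deg[OF x] mult_1_right mult.assoc)
    also have "\<dots> \<le> ?K * (\<Sum>y\<in>?Z x. F y) * \<rho> x ^ (r - 1) * (1 / h) ^ k1"
      using \<eta>_pos K0 F0 \<rho>_nonneg \<rho>_le[OF x] by (intro mult_left_mono power_mono mult_nonneg_nonneg sum_nonneg) auto
    also have "\<dots> = (1 / h) ^ k1 * ?K * (\<Sum>y\<in>?Z x. F y * \<rho> x ^ (r - 1))"
      by (simp add: sum_distrib_right[symmetric])
    also have "(\<Sum>y\<in>?Z x. F y * \<rho> x ^ (r - 1)) = (\<Sum>y\<in>?ZV. if y ` ?A \<subseteq> N x then F y * \<rho> x ^ (r - 1) else 0)"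
    proof (rule sum.mono_neutral_cong_left)
      have "finite (?A \<rightarrow>\<^sub>E V)" using fA finV by (intro finite_PiE) auto
      thus "finite ?ZV" by simp
      show "?Z x \<subseteq> ?ZV" using PiE_mono[of ?A "\<lambda>_. N x" "\<lambda>_. V"] N_sub by auto
      show "\<forall>y\<in>?ZV - ?Z x. (if y ` ?A \<subseteq> N x then F y * \<rho> x ^ (r - 1) else 0) = 0"
        by (auto simp: PiE_iff)
      show "F y * \<rho> x ^ (r - 1) = (if y ` ?A \<subseteq> N x then F y * \<rho> x ^ (r - 1) else 0)"
        if "y \<in> ?Z x" for y using that by (auto simp: PiE_iff)
    qed
    finally show ?thesis .
  qed
  have "(\<Sum>x\<in>X. \<Sum>y | y \<in> Y x \<and> (\<forall>a\<in>S'. y a = u a). \<Sum>t | t \<in> Tt x y \<and> (\<forall>i\<in>T'. t i = v i). wt (x, y, t))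
     \<le> (\<Sum>x\<in>X. (1 / h) ^ k1 * ?K * (\<Sum>y\<in>?ZV. if y ` ?A \<subseteq> N x then F y * \<rho> x ^ (r - 1) else 0))"
    using one by (rule sum_mono)
  also have "\<dots> = (1 / h) ^ k1 * ?K * (\<Sum>y\<in>?ZV. \<Sum>x\<in>X. if y ` ?A \<subseteq> N x then F y * \<rho> x ^ (r - 1) else 0)"
    by (simp only: sum_distrib_left[symmetric] sum.swap[of _ X])
  finally have e0: "(\<Sum>x\<in>X. \<Sum>y | y \<in> Y x \<and> (\<forall>a\<in>S'. y a = u a). \<Sum>t | t \<in> Tt x y \<and> (\<forall>i\<in>T'. t i = v i). wt (x, y, t))
    \<le> (1 / h) ^ k1 * ?K * (\<Sum>y\<in>?ZV. \<Sum>x\<in>X. if y ` ?A \<subseteq> N x then F y * \<rho> x ^ (r - 1) else 0)" .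
  have e1: "(\<Sum>y\<in>?ZV. \<Sum>x\<in>X. if y ` ?A \<subseteq> N x then F y * \<rho> x ^ (r - 1) else 0) \<le> (\<Sum>y\<in>?ZV. if y ` ?A \<subseteq> N ?w then 1 else 0)"
  proof (rule sum_mono)
    fix y
    have "(\<Sum>x\<in>X. if y ` ?A \<subseteq> N x then F y * \<rho> x ^ (r - 1) else 0)
      = (\<Sum>x\<in>com (y ` ?A). F y * \<rho> x ^ (r - 1))"
      unfolding com_def using finX by (rule sum.inter_filter[symmetric])
    also have "\<dots> = F y * g (y ` ?A)" by (simp add: g_def sum_distrib_left)
    also have "\<dots> \<le> (if y ` ?A \<subseteq> N ?w then 1 else 0)" by (simp add: F_def)
    finally show "(\<Sum>x\<in>X. if y ` ?A \<subseteq> N x then F y * \<rho> x ^ (r - 1) else 0) \<le> (if y ` ?A \<subseteq> N ?w then 1 else 0)" .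
  qed
  have e2: "(\<Sum>y\<in>?ZV. if y ` ?A \<subseteq> N ?w then 1 else (0::real)) \<le> real (deg ?w ^ (r - k3))"
  proof -
    have fZ: "finite ?ZV" using finite_PiE[of ?A "\<lambda>_. V"] fA finV by simp
    have "(\<Sum>y\<in>?ZV. if y ` ?A \<subseteq> N ?w then 1 else (0::real)) = real (card {y\<in>?ZV. y ` ?A \<subseteq> N ?w})"
      using fZ by (simp add: sum.inter_filter[symmetric])
    also have "\<dots> \<le> real (card {y \<in> ?A \<rightarrow>\<^sub>E N ?w. \<forall>a\<in>S' \<inter> ?A. y a = u a})"
    proof (intro of_nat_mono card_mono)
      show "finite {y \<in> ?A \<rightarrow>\<^sub>E N ?w. \<forall>a\<in>S' \<inter> ?A. y a = u a}"
        using finite_PiE[of ?A "\<lambda>_. N ?w"] fA finN by simp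
      show "{y\<in>?ZV. y ` ?A \<subseteq> N ?w} \<subseteq> {y \<in> ?A \<rightarrow>\<^sub>E N ?w. \<forall>a\<in>S' \<inter> ?A. y a = u a}"
        by (auto simp: PiE_iff)
    qed
    also have "\<dots> \<le> real (card (N ?w) ^ card (?A - S' \<inter> ?A))"
      by (intro of_nat_mono card_PiE_fixed_le[OF fA finN]) auto
    also have "card (?A - S' \<inter> ?A) = r - k3"
      using fA A by (subst card_Diff_subset) (auto simp: k3_def)
    finally show ?thesis by (simp add: deg_def)
  qed
  note e0
  also have "(1 / h) ^ k1 * ?K * (\<Sum>y\<in>?ZV. \<Sum>x\<in>X. if y ` ?A \<subseteq> N x then F y * \<rho> x ^ (r - 1) else 0)
    \<le> (1 / h) ^ k1 * ?K * real (deg ?w ^ (r - k3))"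
    using \<rho>_nonneg \<eta>_pos h_pos by (intro mult_left_mono[OF order.trans[OF e1 e2]] mult_nonneg_nonneg) auto
  also have "\<dots> = (1 / h) ^ k1 * \<eta> ^ (card T' - 1) * \<rho> ?w ^ (k3 - 1) * (\<rho> ?w ^ (r - k3) * deg ?w ^ (r - k3))"
  proof -
    have "r - 1 = (k3 - 1) + (r - k3)" using k3 by simp
    hence "\<rho> ?w ^ (r - 1) = \<rho> ?w ^ (k3 - 1) * \<rho> ?w ^ (r - k3)" by (simp only: power_add)
    thus ?thesis by simp
  qed
  also have "\<dots> = (1 / h) ^ k1 * \<eta> ^ (card T' - 1) * \<rho> ?w ^ (k3 - 1)"
    by (simp only: \<rho>_deg[OF wX] mult_1_right)
  also have "\<dots> \<le> (1 / h) ^ k1 * \<eta> ^ (card T' - 1) * (1 / h) ^ (k3 - 1)"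
    using h_pos \<eta>_pos \<rho>_nonneg \<rho>_le[OF wX] by (intro mult_left_mono power_mono) auto
  also have "\<dots> = (1 / h) ^ (card S' - 1) * \<eta> ^ (card T' - 1)"
  proof -
    have "card S' - 1 = k1 + (k3 - 1)" using k3 S'_split by simp
    thus ?thesis by (simp add: power_add)
  qed
  finally show ?thesis .
qed

text \<open>Both bounds come from singling out one vertex that meets \<open>J\<close>.  For the first, let \<open>a\<close> be a vertex of
\<open>S\<close>: at most \<open>t'\<close> edges of \<open>J\<close> contain it, and at most \<open>\<Delta>\<close> contain each of the others.  For the
second, single out the root if it meets \<open>J\<close> and any vertex of the other side otherwise; at most \<open>s'\<close>
edges of \<open>J\<close> contain it and at most \<open>r\<close> contain each of the others.\<close>

lemma slots_count:
  assumes J: "J \<subseteq> slots" "J \<noteq> {}"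
  defines "s' \<equiv> card (snd ` J)" and "t' \<equiv> card (fst ` J)"
  shows "1 \<le> s'" "s' \<le> card S" "1 \<le> t'" "t' \<le> card T + 1"
    "card J \<le> (s' - 1) * \<Delta> + t'" "card J \<le> s' + r * (t' - 1)"
proof -
  have fJ: "finite J" using J finslots finite_subset by blast
  show "1 \<le> s'" "1 \<le> t'" using J(2) fJ by (simp_all add: s'_def t'_def Suc_le_eq card_gt_0_iff)
  have SJ: "snd ` J \<subseteq> S" using J(1) slotsD(1) by fastforce
  show "s' \<le> card S" unfolding s'_def using SJ finS by (rule card_mono[rotated])
  have TJ: "fst ` J \<subseteq> insert None (Some ` T)" using J(1) slotsD(2) by fastforce
  have "t' \<le> card (insert None (Some ` T))" unfolding t'_def using TJ finT by (intro card_mono) auto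
  also have "\<dots> \<le> card T + 1" using finT by (simp add: card_insert_if card_image)
  finally show "t' \<le> card T + 1" .
  obtain b1 a1 where ba: "(b1, a1) \<in> J" using J(2) by auto
  show "card J \<le> (s' - 1) * \<Delta> + t'"
  proof -
    let ?R = "\<lambda>a. {b. (b, a) \<in> slots}"
    have R: "finite (?R a) \<and> card (?R a) \<le> \<Delta>" if a: "a \<in> S" for a
    proof -
      have "?R a = insert None (Some ` {i\<in>T. a \<in> nb i})" using a by (auto simp: slots_def)
      thus ?thesis using degree[OF a] finT by (simp add: card_insert_if card_image image_iff)
    qed
    let ?U = "(\<lambda>b. (b, a1)) ` (fst ` J) \<union> (\<Union>a\<in>snd ` J - {a1}. (\<lambda>b. (b, a)) ` ?R a)"
    have sub: "J \<subseteq> ?U"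
    proof
      fix p assume p: "p \<in> J"
      obtain b a where [simp]: "p = (b, a)" by (metis prod.exhaust)
      have "(b, a) \<in> slots" "b \<in> fst ` J" "a \<in> snd ` J" using p J(1) by (auto intro: rev_image_eqI)
      thus "p \<in> ?U" by (cases "a = a1") auto
    qed
    have fU: "finite ?U" using fJ R SJ by (intro finite_UnI finite_UN_I finite_imageI) auto
    have "card J \<le> card ?U" using sub fU by (intro card_mono)
    also have "\<dots> \<le> card ((\<lambda>b. (b, a1)) ` (fst ` J)) + card (\<Union>a\<in>snd ` J - {a1}. (\<lambda>b. (b, a)) ` ?R a)"
      by (rule card_Un_le)
    also have "card ((\<lambda>b. (b, a1)) ` (fst ` J)) \<le> t'" unfolding t'_def using fJ by (intro card_image_le) simp
    also have "card (\<Union>a\<in>snd ` J - {a1}. (\<lambda>b. (b, a)) ` ?R a) \<le> (\<Sum>a\<in>snd ` J - {a1}. card ((\<lambda>b. (b, a)) ` ?R a))"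
      using fJ by (intro card_UN_le) simp
    also have "\<dots> \<le> (\<Sum>a\<in>snd ` J - {a1}. \<Delta>)"
    proof (rule sum_mono)
      fix a assume "a \<in> snd ` J - {a1}"
      hence "a \<in> S" using SJ by auto
      thus "card ((\<lambda>b. (b, a)) ` ?R a) \<le> \<Delta>" using R[of a] card_image_le[of "?R a" "\<lambda>b. (b, a)"] by linarith
    qed
    also have "(\<Sum>a\<in>snd ` J - {a1}. \<Delta>) = (s' - 1) * \<Delta>"
      using ba fJ by (simp add: s'_def card_Diff_singleton rev_image_eqI)
    finally show ?thesis by simp
  qed
  show "card J \<le> s' + r * (t' - 1)"
  proof -
    \<comment> \<open>Singling out the root whenever possible leaves vertices of degree \<open>r\<close> only.\<close>
    define b0 where "b0 = (if None \<in> fst ` J then None else b1)"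
    have b0: "b0 \<in> fst ` J" using ba by (auto simp: b0_def intro: rev_image_eqI)
    let ?R = "\<lambda>b. {a. (b, a) \<in> slots}"
    have R: "finite (?R b) \<and> card (?R b) \<le> r" if b: "b \<in> fst ` J - {b0}" for b
    proof -
      have "b \<noteq> None"
      proof
        assume "b = None"
        hence "b0 = None" using b by (simp add: b0_def)
        thus False using b \<open>b = None\<close> by simp
      qed
      moreover have "b \<in> insert None (Some ` T)" using b TJ by auto
      ultimately obtain i where i: "i \<in> T" "b = Some i" by auto
      have "?R b = nb i" using i by (auto simp: slots_def)
      thus ?thesis using card_nb[OF i(1)] nb[OF i(1)] finS finite_subset by auto
    qed
    let ?U = "(\<lambda>a. (b0, a)) ` (snd ` J) \<union> (\<Union>b\<in>fst ` J - {b0}. (\<lambda>a. (b, a)) ` ?R b)"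
    have sub: "J \<subseteq> ?U"
    proof
      fix p assume p: "p \<in> J"
      obtain b a where [simp]: "p = (b, a)" by (metis prod.exhaust)
      have "(b, a) \<in> slots" "b \<in> fst ` J" "a \<in> snd ` J" using p J(1) by (auto intro: rev_image_eqI)
      thus "p \<in> ?U" by (cases "b = b0") auto
    qed
    have fU: "finite ?U" using fJ R by (intro finite_UnI finite_UN_I finite_imageI) auto
    have "card J \<le> card ?U" using sub fU by (intro card_mono)
    also have "\<dots> \<le> card ((\<lambda>a. (b0, a)) ` (snd ` J)) + card (\<Union>b\<in>fst ` J - {b0}. (\<lambda>a. (b, a)) ` ?R b)"
      by (rule card_Un_le)
    also have "card ((\<lambda>a. (b0, a)) ` (snd ` J)) \<le> s'" unfolding s'_def using fJ by (intro card_image_le) simp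
    also have "card (\<Union>b\<in>fst ` J - {b0}. (\<lambda>a. (b, a)) ` ?R b) \<le> (\<Sum>b\<in>fst ` J - {b0}. card ((\<lambda>a. (b, a)) ` ?R b))"
      using fJ by (intro card_UN_le) simp
    also have "\<dots> \<le> (\<Sum>b\<in>fst ` J - {b0}. r)"
    proof (rule sum_mono)
      fix b assume "b \<in> fst ` J - {b0}"
      thus "card ((\<lambda>a. (b, a)) ` ?R b) \<le> r" using R[of b] card_image_le[of "?R b" "\<lambda>a. (b, a)"] by linarith
    qed
    also have "(\<Sum>b\<in>fst ` J - {b0}. r) = r * (t' - 1)"
      using b0 fJ by (simp add: t'_def card_Diff_singleton)
    finally show ?thesis by simp
  qed
qed

text \<open>The map \<open>\<phi>\<close> tells for every edge in \<open>\<sigma>\<close> which pattern edge is mapped to it and which of its ends is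
the image of the vertex in \<open>S\<close>.\<close>

definition matches :: "('v set \<Rightarrow> ('t option \<times> 's) \<times> 'v) \<Rightarrow> 'v set set \<Rightarrow> 'v \<times> ('s \<Rightarrow> 'v) \<times> ('t \<Rightarrow> 'v) \<Rightarrow> bool" where
  "matches \<phi> \<sigma> c \<longleftrightarrow> (\<forall>e\<in>\<sigma>. place c (fst (\<phi> e)) = e \<and> fst (snd c) (snd (fst (\<phi> e))) = snd (\<phi> e))"

text \<open>A matching copy determines the images of all pattern vertices that are incident with the pattern
edges used, so all matching copies agree there.\<close>

lemma matching_weight:
  assumes \<sigma>: "\<sigma> \<noteq> {}" "finite \<sigma>" and \<phi>: "\<And>e. e \<in> \<sigma> \<Longrightarrow> fst (\<phi> e) \<in> slots" and B0: "0 \<le> B"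
    and B: "\<And>s' t'. 1 \<le> s' \<Longrightarrow> s' \<le> card S \<Longrightarrow> 1 \<le> t' \<Longrightarrow> t' \<le> card T + 1 \<Longrightarrow>
      card \<sigma> \<le> (s' - 1) * \<Delta> + t' \<Longrightarrow> card \<sigma> \<le> s' + r * (t' - 1) \<Longrightarrow>
      (1 / h) ^ (s' - 1) * \<eta> ^ (t' - 1) \<le> B"
  shows "(\<Sum>c | c \<in> copies \<and> matches \<phi> \<sigma> c. wt c) \<le> B"
proof (cases "\<exists>c\<in>copies. matches \<phi> \<sigma> c")
  case False
  hence "{c. c \<in> copies \<and> matches \<phi> \<sigma> c} = {}" by blast
  thus ?thesis using B0 by (simp only: sum.empty)
next
  case True
  then obtain x0 u v where c0: "(x0, u, v) \<in> copies" "matches \<phi> \<sigma> (x0, u, v)" by (metis prod.exhaust)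
  define J where "J = (\<lambda>e. fst (\<phi> e)) ` \<sigma>"
  define S' where "S' = snd ` J"
  define T' where "T' = {i. Some i \<in> fst ` J}"
  have J: "J \<subseteq> slots" "J \<noteq> {}" using \<phi> \<sigma>(1) by (auto simp: J_def)
  have fJ: "finite J" using \<sigma>(2) by (simp add: J_def)
  have cJ: "card J = card \<sigma>"
  proof -
    have "inj_on (\<lambda>e. fst (\<phi> e)) \<sigma>" using c0(2) unfolding matches_def inj_on_def by metis
    thus ?thesis by (simp add: J_def card_image)
  qed
  note cnt = slots_count[OF J, folded S'_def, unfolded cJ]
  have bound: "(1 / h) ^ (card S' - 1) * \<eta> ^ (card (fst ` J) - 1) \<le> B"
    by (rule B[OF cnt])
  have agree_u: "y a = u a" if "matches \<phi> \<sigma> (x, y, t)" "(b, a) \<in> J" for x y t b a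
  proof -
    from that(2) obtain e where e: "e \<in> \<sigma>" "fst (\<phi> e) = (b, a)" by (auto simp: J_def)
    show ?thesis using that(1) c0(2) e unfolding matches_def by force
  qed
  have agree_apex: "apex x t b = apex x0 v b" if m: "matches \<phi> \<sigma> (x, y, t)" and b: "(b, a) \<in> J" for x y t b a
  proof -
    from b obtain e where e: "e \<in> \<sigma>" "fst (\<phi> e) = (b, a)" by (auto simp: J_def)
    have "place (x, y, t) (b, a) = e" "place (x0, u, v) (b, a) = e"
      using m c0(2) e unfolding matches_def by force+
    hence "{apex x t b, y a} = {apex x0 v b, u a}" by (simp add: place_def)
    thus ?thesis using agree_u[OF m b] by (auto simp: doubleton_eq_iff)
  qed
  have S'S: "S' \<subseteq> S" using J(1) slotsD(1) unfolding S'_def by fastforce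
  have S'ne: "S' \<noteq> {}" using J(2) by (simp add: S'_def)
  have T'T: "T' \<subseteq> T" using J(1) slotsD(2) unfolding T'_def by fastforce
  have fT': "finite T'" using T'T finT finite_subset by blast
  have x0X: "x0 \<in> X" using c0(1) by (simp add: copies_def)
  have vX: "v i \<in> X" if "i \<in> T'" for i
    using c0(1) that T'T by (auto simp: copies_def Tt_def PiE_iff com_def)
  have mu: "\<forall>a\<in>S'. y a = u a" if "matches \<phi> \<sigma> (x, y, t)" for x y t
    using agree_u[OF that] by (auto simp: S'_def)
  have mv: "\<forall>i\<in>T'. t i = v i" if m: "matches \<phi> \<sigma> (x, y, t)" for x y t
  proof
    fix i assume "i \<in> T'"
    then obtain a where "(Some i, a) \<in> J" by (auto simp: T'_def)
    thus "t i = v i" using agree_apex[OF m] by (fastforce simp: apex_def)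
  qed
  show ?thesis
  proof (cases "None \<in> fst ` J")
    case True
    then obtain a where a: "(None, a) \<in> J" by auto
    have "fst ` J = insert None (Some ` T')"
    proof (intro equalityI subsetI)
      fix b assume "b \<in> fst ` J" thus "b \<in> insert None (Some ` T')" by (cases b) (auto simp: T'_def)
    next
      fix b assume "b \<in> insert None (Some ` T')"
      thus "b \<in> fst ` J" using True by (auto simp: T'_def)
    qed
    hence cT: "card (fst ` J) - 1 = card T'" using fT' by (simp add: card_insert_if card_image)
    have mx: "x = x0" if "matches \<phi> \<sigma> (x, y, t)" for x y t
      using agree_apex[OF that a] by (simp add: apex_def)
    have "(\<Sum>c | c \<in> copies \<and> matches \<phi> \<sigma> c. wt c) \<le>
      (\<Sum>(y,t)\<in>(SIGMA y:{y. y \<in> Y x0 \<and> (\<forall>a\<in>S'. y a = u a)}. {t. t \<in> Tt x0 y \<and> (\<forall>i\<in>T'. t i = v i)}). wt (x0, y, t))"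
    proof (rule sum_le_included[where i = "\<lambda>(y,t). (x0, y, t)"])
      show "finite {c. c \<in> copies \<and> matches \<phi> \<sigma> c}" using fincopies by simp
      show "finite (SIGMA y:{y. y \<in> Y x0 \<and> (\<forall>a\<in>S'. y a = u a)}. {t. t \<in> Tt x0 y \<and> (\<forall>i\<in>T'. t i = v i)})"
        using finY finTt by (intro finite_SigmaI) auto
      show "\<forall>c\<in>{c. c \<in> copies \<and> matches \<phi> \<sigma> c}.
        \<exists>z\<in>SIGMA y:{y. y \<in> Y x0 \<and> (\<forall>a\<in>S'. y a = u a)}. {t. t \<in> Tt x0 y \<and> (\<forall>i\<in>T'. t i = v i)}.
          (case z of (y, t) \<Rightarrow> (x0, y, t)) = c \<and> wt c \<le> (case z of (y, t) \<Rightarrow> wt (x0, y, t))"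
      proof
        fix c assume c: "c \<in> {c. c \<in> copies \<and> matches \<phi> \<sigma> c}"
        obtain x y t where [simp]: "c = (x, y, t)" by (metis prod.exhaust)
        have m: "matches \<phi> \<sigma> (x, y, t)" "(x, y, t) \<in> copies" using c by auto
        have "x = x0" using mx[OF m(1)] .
        moreover have "y \<in> Y x" "t \<in> Tt x y" using m(2) by (auto simp: copies_def)
        ultimately show "\<exists>z\<in>SIGMA y:{y. y \<in> Y x0 \<and> (\<forall>a\<in>S'. y a = u a)}. {t. t \<in> Tt x0 y \<and> (\<forall>i\<in>T'. t i = v i)}.
          (case z of (y, t) \<Rightarrow> (x0, y, t)) = c \<and> wt c \<le> (case z of (y, t) \<Rightarrow> wt (x0, y, t))"
          using mu[OF m(1)] mv[OF m(1)] by (intro bexI[of _ "(y, t)"]) simp_all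
      qed
    qed (simp add: wt_nonneg split: prod.split)
    also have "\<dots> = (\<Sum>y | y \<in> Y x0 \<and> (\<forall>a\<in>S'. y a = u a). \<Sum>t | t \<in> Tt x0 y \<and> (\<forall>i\<in>T'. t i = v i). wt (x0, y, t))"
      using finY finTt by (intro sum.Sigma[symmetric]) auto
    also have "\<dots> \<le> (1 / h) ^ (card S' - 1) * \<eta> ^ card T'"
      by (rule rooted_sum[OF S'S S'ne T'T x0X vX])
    finally show ?thesis using bound cT by simp
  next
    case False
    have "fst ` J = Some ` T'"
    proof (intro equalityI subsetI)
      fix b assume "b \<in> fst ` J" thus "b \<in> Some ` T'" using False by (cases b) (auto simp: T'_def)
    next
      fix b assume "b \<in> Some ` T'"
      thus "b \<in> fst ` J" by (auto simp: T'_def)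
    qed
    hence cT: "card (fst ` J) = card T'" by (simp add: card_image)
    obtain b a where ba: "(b, a) \<in> J" using J(2) by auto
    hence "b \<in> fst ` J" by (auto intro: rev_image_eqI)
    with \<open>fst ` J = Some ` T'\<close> obtain i0 where i0: "b = Some i0" "i0 \<in> T'" by auto
    have "a \<in> nb i0" using slotsD(2)[of b a] ba J(1) i0(1) by auto
    moreover have "a \<in> S'" using ba by (auto simp: S'_def intro: rev_image_eqI)
    ultimately have i0': "S' \<inter> nb i0 \<noteq> {}" by blast
    let ?D = "SIGMA x:X. SIGMA y:{y. y \<in> Y x \<and> (\<forall>a\<in>S'. y a = u a)}. {t. t \<in> Tt x y \<and> (\<forall>i\<in>T'. t i = v i)}"
    have "(\<Sum>c | c \<in> copies \<and> matches \<phi> \<sigma> c. wt c) \<le> (\<Sum>c\<in>?D. wt c)"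
    proof (rule sum_mono2)
      show "finite ?D" using finX finY finTt by (intro finite_SigmaI) auto
      show "{c. c \<in> copies \<and> matches \<phi> \<sigma> c} \<subseteq> ?D"
      proof
        fix c assume c: "c \<in> {c. c \<in> copies \<and> matches \<phi> \<sigma> c}"
        obtain x y t where [simp]: "c = (x, y, t)" by (metis prod.exhaust)
        have m: "matches \<phi> \<sigma> (x, y, t)" "(x, y, t) \<in> copies" using c by auto
        have "x \<in> X" "y \<in> Y x" "t \<in> Tt x y" using m(2) by (auto simp: copies_def)
        thus "c \<in> ?D" using mu[OF m(1)] mv[OF m(1)] by simp
      qed
    qed (rule wt_nonneg)
    also have "\<dots> = (\<Sum>x\<in>X. \<Sum>z\<in>(SIGMA y:{y. y \<in> Y x \<and> (\<forall>a\<in>S'. y a = u a)}. {t. t \<in> Tt x y \<and> (\<forall>i\<in>T'. t i = v i)}). wt (x, z))"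
      using finX finY finTt by (subst sum.Sigma) (auto intro!: finite_SigmaI)
    also have "\<dots> = (\<Sum>x\<in>X. \<Sum>y | y \<in> Y x \<and> (\<forall>a\<in>S'. y a = u a). \<Sum>t | t \<in> Tt x y \<and> (\<forall>i\<in>T'. t i = v i). wt (x, y, t))"
      using finY finTt by (intro sum.cong refl, subst sum.Sigma) auto
    also have "\<dots> \<le> (1 / h) ^ (card S' - 1) * \<eta> ^ (card T' - 1)"
      by (rule unrooted_sum[OF S'S T'T i0(2) i0' vX])
    finally show ?thesis using bound cT by simp
  qed
qed

text \<open>There are at most \<open>2 |slots|\<close> choices of \<open>\<phi>\<close> for every edge in \<open>\<sigma>\<close>.\<close>

lemma codegree_weight_le:
  assumes \<sigma>: "\<sigma> \<subseteq> E" "\<sigma> \<noteq> {}" and B0: "0 \<le> B"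
    and B: "\<And>s' t'. 1 \<le> s' \<Longrightarrow> s' \<le> card S \<Longrightarrow> 1 \<le> t' \<Longrightarrow> t' \<le> card T + 1 \<Longrightarrow>
      card \<sigma> \<le> (s' - 1) * \<Delta> + t' \<Longrightarrow> card \<sigma> \<le> s' + r * (t' - 1) \<Longrightarrow>
      (1 / h) ^ (s' - 1) * \<eta> ^ (t' - 1) \<le> B"
  shows "codegree E weight \<sigma> \<le> real (2 * card slots) ^ card \<sigma> * B"
proof -
  have f\<sigma>: "finite \<sigma>" using \<sigma>(1) finE finite_subset by blast
  let ?\<Phi> = "\<Pi>\<^sub>E e\<in>\<sigma>. slots \<times> e"
  have fe: "finite e" "card e = 2" if "e \<in> \<sigma>" for e
    using that \<sigma>(1) edges[of e] finite_subset[OF _ finV] by auto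
  have f\<Phi>: "finite ?\<Phi>" using f\<sigma> finslots fe by (intro finite_PiE) auto
  have "codegree E weight \<sigma> = (\<Sum>c | c \<in> copies \<and> \<sigma> \<subseteq> place c ` slots. wt c)"
    by (rule codegree_weight)
  also have "\<dots> \<le> (\<Sum>c\<in>(\<Union>\<phi>\<in>?\<Phi>. {c. c \<in> copies \<and> matches \<phi> \<sigma> c}). wt c)"
  proof (rule sum_mono2)
    show "finite (\<Union>\<phi>\<in>?\<Phi>. {c. c \<in> copies \<and> matches \<phi> \<sigma> c})"
      using f\<Phi> fincopies by (intro finite_UN_I) auto
    show "{c. c \<in> copies \<and> \<sigma> \<subseteq> place c ` slots} \<subseteq> (\<Union>\<phi>\<in>?\<Phi>. {c. c \<in> copies \<and> matches \<phi> \<sigma> c})"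
    proof
      fix c assume c: "c \<in> {c. c \<in> copies \<and> \<sigma> \<subseteq> place c ` slots}"
      obtain x y t where [simp]: "c = (x, y, t)" by (metis prod.exhaust)
      define f where "f = (\<lambda>e. SOME p. p \<in> slots \<and> place c p = e)"
      have f: "f e \<in> slots \<and> place c (f e) = e" if "e \<in> \<sigma>" for e
      proof -
        have "e \<in> place c ` slots" using c that by blast
        hence "\<exists>p. p \<in> slots \<and> place c p = e" by blast
        thus ?thesis unfolding f_def by (rule someI_ex)
      qed
      define \<phi> where "\<phi> = restrict (\<lambda>e. (f e, y (snd (f e)))) \<sigma>"
      have "y (snd (f e)) \<in> e" if "e \<in> \<sigma>" for e
      proof -
        have "y (snd (f e)) \<in> place c (f e)" by (simp add: place_def)
        thus ?thesis using f[OF that] by simp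
      qed
      hence "\<phi> \<in> ?\<Phi>" using f by (auto simp: \<phi>_def)
      moreover have "matches \<phi> \<sigma> c" using f by (simp add: matches_def \<phi>_def)
      ultimately show "c \<in> (\<Union>\<phi>\<in>?\<Phi>. {c. c \<in> copies \<and> matches \<phi> \<sigma> c})" using c by blast
    qed
  qed (rule wt_nonneg)
  also have "\<dots> \<le> (\<Sum>\<phi>\<in>?\<Phi>. \<Sum>c | c \<in> copies \<and> matches \<phi> \<sigma> c. wt c)"
    using f\<Phi> fincopies by (intro sum_UN_le wt_nonneg) auto
  also have "\<dots> \<le> (\<Sum>\<phi>\<in>?\<Phi>. B)"
  proof (rule sum_mono)
    fix \<phi> assume \<phi>: "\<phi> \<in> ?\<Phi>"
    have "fst (\<phi> e) \<in> slots" if "e \<in> \<sigma>" for e using PiE_mem[OF \<phi> that] by auto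
    thus "(\<Sum>c | c \<in> copies \<and> matches \<phi> \<sigma> c. wt c) \<le> B"
      by (rule matching_weight[OF \<sigma>(2) f\<sigma> _ B0 B])
  qed
  also have "\<dots> = real (card ?\<Phi>) * B" by simp
  also have "card ?\<Phi> = (2 * card slots) ^ card \<sigma>"
    using f\<sigma> fe by (simp add: card_PiE card_cartesian_product mult.commute)
  finally show ?thesis by simp
qed

end

section \<open>The fingerprint density\<close>

text \<open>The proportion of the elements of a graph with \<open>k n^(2-1/r)\<close> edges that a fingerprint may use, up
to a constant factor.  The first term is forced by the stars centred at an image of a vertex of \<open>S\<close>,
since every further edge of such a star lowers the codegree by \<open>\<eta> = O(k^(-r))\<close>.  The second term takes care of
all other sets of edges that do not span enough vertices.\<close>

definition fingerprint_density :: "nat \<Rightarrow> nat \<Rightarrow> real \<Rightarrow> real \<Rightarrow> real" where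
  "fingerprint_density r \<Delta> k n = max (k powr - real r)
     (k powr - 1 * n powr - ((1 - 1 / r) * ((real r - 1) / (real r * real \<Delta> - 1))))"

text \<open>The logarithmic form of the inequality between codegrees and powers of the fingerprint density:
\<open>\<theta>\<close>, \<open>\<kappa>\<close> and \<open>\<nu>\<close> stand for \<open>- ln \<tau>\<close>, \<open>ln k\<close> and \<open>ln n\<close>, while \<open>a\<close>, \<open>b\<close> and \<open>m\<close> stand for
\<open>s' - 1\<close>, \<open>t' - 1\<close> and \<open>j - 1\<close>.  It is the combination of the two bounds on \<open>\<theta>\<close> with weights
\<open>((r-1) m - \<beta>) / (r-1)\<close> and \<open>\<beta> / (r-1)\<close>, where \<open>\<beta>\<close> is the positive part of \<open>r (m - b) - a\<close>.
The two bounds on \<open>m\<close> say that the first weight is nonnegative and that the second is not too large.\<close>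

lemma exponent_tradeoff:
  fixes a b m r D \<kappa> \<nu> \<theta> :: real
  assumes r: "2 \<le> r" and D: "1 \<le> D" and nn: "0 \<le> a" "0 \<le> b" "0 \<le> m" "0 \<le> \<kappa>" "0 \<le> \<nu>"
    and \<theta>: "\<theta> \<le> r * \<kappa>" "\<theta> \<le> \<kappa> + (1 - 1 / r) * ((r - 1) / (r * D - 1)) * \<nu>"
    and m: "m \<le> a * D + b" "m \<le> a + r * b"
  shows "m * \<theta> \<le> a * (\<kappa> + (1 - 1 / r) * \<nu>) + r * b * \<kappa>"
proof (cases "r * (m - b) \<le> a")
  case True
  have "m * \<theta> \<le> m * (r * \<kappa>)" using \<theta>(1) nn by (intro mult_left_mono)
  also have "\<dots> = (m * r) * \<kappa>" by simp
  also have "\<dots> \<le> (a + r * b) * \<kappa>" using True nn by (intro mult_right_mono) (auto simp: algebra_simps)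
  also have "\<dots> \<le> (a + r * b) * \<kappa> + a * ((1 - 1 / r) * \<nu>)" using nn r by simp
  also have "\<dots> = a * (\<kappa> + (1 - 1 / r) * \<nu>) + r * b * \<kappa>" by (simp only: distrib_left distrib_right)
  finally show ?thesis .
next
  case False
  define \<beta> where "\<beta> = r * (m - b) - a"
  define \<gamma> where "\<gamma> = (1 - 1 / r) * ((r - 1) / (r * D - 1))"
  have \<beta>: "0 \<le> \<beta>" using False by (simp add: \<beta>_def)
  have rD: "0 < r * D - 1"
  proof -
    have "2 * 1 \<le> r * D" using r D by (intro mult_mono) auto
    thus ?thesis by simp
  qed
  have "\<beta> \<le> a * (r * D - 1)"
  proof -
    have "r * m \<le> r * (a * D + b)" using m(1) r by (intro mult_left_mono) auto
    thus ?thesis by (simp add: \<beta>_def algebra_simps)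
  qed
  hence "\<beta> * \<gamma> \<le> a * (r * D - 1) * \<gamma>"
    using rD r by (intro mult_right_mono) (auto simp: \<gamma>_def)
  also have "\<dots> = (r - 1) * (a * (1 - 1 / r))" using rD by (simp add: \<gamma>_def)
  finally have bg: "\<beta> * \<gamma> \<le> (r - 1) * (a * (1 - 1 / r))" .
  have "(r - 1) * (m * \<theta>) = (r * b + a - m) * \<theta> + \<beta> * \<theta>" by (simp add: \<beta>_def algebra_simps)
  also have "\<dots> \<le> (r * b + a - m) * (r * \<kappa>) + \<beta> * (\<kappa> + \<gamma> * \<nu>)"
    using \<theta> m(2) \<beta> by (intro add_mono mult_left_mono) (auto simp: \<gamma>_def)
  also have "\<dots> = (r - 1) * (a * \<kappa> + r * b * \<kappa>) + \<beta> * \<gamma> * \<nu>" by (simp add: \<beta>_def algebra_simps)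
  also have "\<dots> \<le> (r - 1) * (a * \<kappa> + r * b * \<kappa>) + (r - 1) * (a * (1 - 1 / r)) * \<nu>"
    using bg nn by (intro add_left_mono mult_right_mono)
  also have "\<dots> = (r - 1) * (a * (\<kappa> + (1 - 1 / r) * \<nu>) + r * b * \<kappa>)" by (simp add: algebra_simps)
  finally show ?thesis using r by simp
qed

lemma placement_le_fingerprint_density:
  fixes k n :: real
  assumes r: "2 \<le> r" and D: "1 \<le> \<Delta>" and k: "1 \<le> k" and n: "1 \<le> n" and j: "1 \<le> j" "1 \<le> s" "1 \<le> t"
    and m: "j \<le> (s - 1) * \<Delta> + t" "j \<le> s + r * (t - 1)"
  shows "(1 / (k * n powr (1 - 1 / r))) ^ (s - 1) * (k powr - real r) ^ (t - 1) \<le> fingerprint_density r \<Delta> k n ^ (j - 1)"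
proof -
  define \<tau> where "\<tau> = fingerprint_density r \<Delta> k n"
  define \<gamma> where "\<gamma> = (1 - 1 / real r) * ((real r - 1) / (real r * real \<Delta> - 1))"
  have \<tau>0: "0 < \<tau>" using k by (simp add: \<tau>_def fingerprint_density_def less_max_iff_disj)
  have "ln (k powr - real r) \<le> ln \<tau>" using k \<tau>0 by (subst ln_le_cancel_iff) (auto simp: \<tau>_def fingerprint_density_def)
  hence t1: "- ln \<tau> \<le> real r * ln k" using k by (simp add: ln_powr)
  have "ln (k powr - 1 * n powr - \<gamma>) \<le> ln \<tau>"
    using k n \<tau>0 by (subst ln_le_cancel_iff) (auto simp: \<tau>_def fingerprint_density_def \<gamma>_def)
  moreover have "ln (k powr - 1 * n powr - \<gamma>) = ln (k powr - 1) + ln (n powr - \<gamma>)"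
    using k n by (intro ln_mult_pos) auto
  moreover have "ln (k powr - 1) = - 1 * ln k" "ln (n powr - \<gamma>) = - \<gamma> * ln n"
    using k n by (intro ln_powr; simp)+
  ultimately have t2: "- ln \<tau> \<le> ln k + \<gamma> * ln n" by simp
  have rj: "real (j - 1) = real j - 1" "real (s - 1) = real s - 1" "real (t - 1) = real t - 1"
    using j by (auto simp: of_nat_diff)
  have m1: "real (j - 1) \<le> real (s - 1) * real \<Delta> + real (t - 1)"
  proof -
    have "real j \<le> real ((s - 1) * \<Delta> + t)" using m(1) by (rule of_nat_mono)
    hence "real j \<le> real (s - 1) * real \<Delta> + real t" by (simp only: of_nat_add of_nat_mult)
    thus ?thesis unfolding rj by linarith
  qed
  have m2: "real (j - 1) \<le> real (s - 1) + real r * real (t - 1)"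
  proof -
    have "real j \<le> real (s + r * (t - 1))" using m(2) by (rule of_nat_mono)
    hence "real j \<le> real s + real r * real (t - 1)" by (simp only: of_nat_add of_nat_mult)
    thus ?thesis unfolding rj by linarith
  qed
  have main: "real (j - 1) * (- ln \<tau>) \<le> real (s - 1) * (ln k + (1 - 1 / real r) * ln n) + real r * real (t - 1) * ln k"
    using r D k n t1 t2 m1 m2 by (intro exponent_tradeoff[where D = \<Delta>]) (auto simp: \<gamma>_def)
  have "(1 / (k * n powr (1 - 1 / r))) ^ (s - 1) * (k powr - real r) ^ (t - 1)
     = exp (real (s - 1) * (- (ln k + (1 - 1 / real r) * ln n))) * exp (real (t - 1) * (- real r * ln k))"
  proof -
    have "1 / (k * n powr (1 - 1 / r)) = exp (- (ln k + (1 - 1 / real r) * ln n))"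
    proof -
      have "k * n powr (1 - 1 / r) = exp (ln k + (1 - 1 / real r) * ln n)"
        using k n by (simp add: powr_def exp_add)
      thus ?thesis by (simp only: exp_minus inverse_eq_divide)
    qed
    moreover have "k powr - real r = exp (- real r * ln k)" using k by (simp add: powr_def)
    ultimately show ?thesis by (simp only: exp_of_nat_mult)
  qed
  also have "\<dots> = exp (- (real (s - 1) * (ln k + (1 - 1 / real r) * ln n) + real r * real (t - 1) * ln k))"
    by (simp add: exp_add[symmetric] algebra_simps)
  also have "\<dots> \<le> exp (real (j - 1) * ln \<tau>)" using main by simp
  also have "\<dots> = \<tau> ^ (j - 1)" using \<tau>0 by (simp add: exp_of_nat_mult)
  finally show ?thesis by (simp add: \<tau>_def)
qed

context pattern
begin

text \<open>The factor 4 is lost in the total weight, the first power counts the placements of a set of edges, and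
the second collects the constants in \<open>\<eta>\<close>.\<close>

definition spread_const :: real where
  "spread_const = 4 * real (2 * card slots) ^ card slots * (4 * (real (card T) + 1)) ^ card T"

lemma card_slots_pos: "1 \<le> card slots"
  using slots_ne finslots by (simp add: Suc_le_eq card_gt_0_iff)

lemma spread_const_ge_1: "1 \<le> spread_const"
proof -
  have "1 * 1 * 1 \<le> 4 * real (2 * card slots) ^ card slots * (4 * (real (card T) + 1)) ^ card T"
    using card_slots_pos by (intro mult_mono one_le_power mult_nonneg_nonneg zero_le_power) auto
  thus ?thesis by (simp add: spread_const_def)
qed

lemma \<Delta>_pos: "1 \<le> \<Delta>" using neS degree by fastforce

end

context host
begin

lemma h_eq:
  assumes k: "real (card E) = k * card V powr (2 - 1 / r)"
  shows "h = k * card V powr (1 - 1 / r)"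
proof -
  have "real (card V) powr (2 - 1 / r) = card V powr (1 + (1 - 1 / r))" by (simp add: algebra_simps)
  also have "\<dots> = card V * card V powr (1 - 1 / r)" using V_pos by (simp only: powr_add) simp
  finally show ?thesis using V_pos k by (simp add: h_def)
qed

lemma \<eta>_eq:
  assumes k: "real (card E) = k * card V powr (2 - 1 / r)" "0 < k"
  shows "\<eta> = 4 * (real (card T) + 1) * k powr - real r"
proof -
  let ?n = "real (card V)" and ?e = "real (card E)"
  have n: "0 < ?n" and e: "0 < ?e" using V_pos E_pos by auto
  obtain r' where r': "r = Suc r'" using r2 by (cases r) auto
  have "\<eta> = 4 * (real (card T) + 1) * (?n ^ r' * ?n ^ r / ?e ^ r)"
    unfolding \<eta>_def h_def g0_def using n e by (simp add: r' power_divide field_simps)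
  also have "?e ^ r = k ^ r * (?n powr (2 - 1 / r)) ^ r" using k by (simp add: power_mult_distrib)
  also have "(?n powr (2 - 1 / r)) ^ r = ?n powr ((2 - 1 / r) * r)"
    using n by (simp add: powr_realpow[symmetric] powr_powr)
  also have "(2 - 1 / r) * r = real (r' + r)" using r2 r' by (simp add: field_simps)
  also have "?n powr real (r' + r) = ?n ^ r' * ?n ^ r" using n by (simp only: powr_realpow power_add)
  also have "?n ^ r' * ?n ^ r / (k ^ r * (?n ^ r' * ?n ^ r)) = 1 / k ^ r" using n by simp
  also have "\<dots> = k powr - real r" using k(2) by (simp add: powr_minus powr_realpow inverse_eq_divide)
  finally show ?thesis .
qed

text \<open>Balanced supersaturation.  The conditions on \<open>k\<close> bound it below by a constant that depends
on the pattern only.\<close>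

theorem spread_weight:
  assumes k: "real (card E) = k * card V powr (2 - 1 / r)" "1 \<le> k" "4 * real (card S) ^ 2 \<le> k"
    "(real (card T) + card S + 1) ^ 2 * (4 * (real (card T) + 1) * k powr - real r) \<le> 1 / 2"
  shows "spread E (card slots) weight spread_const (fingerprint_density r \<Delta> k (card V))"
proof -
  let ?\<tau> = "fingerprint_density r \<Delta> k (card V)"
  let ?C = "4 * (real (card T) + 1)"
  let ?L = "real (2 * card slots)"
  have n: "1 \<le> real (card V)" using V_pos by simp
  have k0: "0 < k" using k by simp
  have \<tau>0: "0 < ?\<tau>" using k by (simp add: fingerprint_density_def less_max_iff_disj)
  have h: "h = k * card V powr (1 - 1 / r)" by (rule h_eq[OF k(1)])
  have \<eta>: "\<eta> = ?C * k powr - real r" by (rule \<eta>_eq[OF k(1) k0])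
  have "1 \<le> card V powr (1 - 1 / r)" using n r2 by (intro ge_one_powr_ge_zero) auto
  hence "k * 1 \<le> h" unfolding h using k0 by (intro mult_left_mono) auto
  hence W: "card E / 4 \<le> codegree E weight {}"
    using k by (intro total_weight) (auto simp: \<eta>)
  have Epos: "0 < real (card E)" using E_pos by simp
  have Wpos: "0 < codegree E weight {}" using W Epos by linarith
  show ?thesis unfolding spread_def
  proof (intro conjI allI impI)
    show "finite E" by (rule finE)
    show "0 < codegree E weight {}" by (rule Wpos)
    show "0 \<le> weight e" for e by (rule weight_nonneg)
    show "e \<subseteq> E" "card e = card slots" if "0 < weight e" for e using weight_support(1)[OF that] by auto
    fix \<sigma> assume \<sigma>: "\<sigma> \<subseteq> E" "\<sigma> \<noteq> {}"
    have f\<sigma>: "finite \<sigma>" using \<sigma>(1) finE finite_subset by blast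
    have j: "1 \<le> card \<sigma>" using \<sigma> f\<sigma> by (simp add: Suc_le_eq card_gt_0_iff)
    have "codegree E weight \<sigma> \<le> ?L ^ card slots * (?C ^ card T * ?\<tau> ^ (card \<sigma> - 1))"
    proof (cases "card \<sigma> \<le> card slots")
      case True
      have "codegree E weight \<sigma> \<le> ?L ^ card \<sigma> * (?C ^ card T * ?\<tau> ^ (card \<sigma> - 1))"
      proof (rule codegree_weight_le[OF \<sigma>])
        show "0 \<le> ?C ^ card T * ?\<tau> ^ (card \<sigma> - 1)" using \<tau>0 by simp
        fix s' t' :: nat
        assume st: "1 \<le> s'" "s' \<le> card S" "1 \<le> t'" "t' \<le> card T + 1"
          and c: "card \<sigma> \<le> (s' - 1) * \<Delta> + t'" "card \<sigma> \<le> s' + r * (t' - 1)"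
        have "(1 / h) ^ (s' - 1) * \<eta> ^ (t' - 1)
            = ?C ^ (t' - 1) * ((1 / (k * card V powr (1 - 1 / r))) ^ (s' - 1) * (k powr - real r) ^ (t' - 1))"
          unfolding h \<eta> power_mult_distrib by simp
        also have "\<dots> \<le> ?C ^ card T * ?\<tau> ^ (card \<sigma> - 1)"
        proof (rule mult_mono)
          show "?C ^ (t' - 1) \<le> ?C ^ card T" using st by (intro power_increasing) auto
          show "(1 / (k * card V powr (1 - 1 / r))) ^ (s' - 1) * (k powr - real r) ^ (t' - 1) \<le> ?\<tau> ^ (card \<sigma> - 1)"
            by (rule placement_le_fingerprint_density[OF r2 \<Delta>_pos k(2) n j st(1,3) c])
        qed (use k in auto)
        finally show "(1 / h) ^ (s' - 1) * \<eta> ^ (t' - 1) \<le> ?C ^ card T * ?\<tau> ^ (card \<sigma> - 1)" .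
      qed
      also have "\<dots> \<le> ?L ^ card slots * (?C ^ card T * ?\<tau> ^ (card \<sigma> - 1))"
        using True card_slots_pos \<tau>0 by (intro mult_right_mono power_increasing) auto
      finally show ?thesis .
    next
      case False
      have "codegree E weight \<sigma> = 0" unfolding codegree_def
      proof (rule sum.neutral, rule ballI, rule ccontr)
        fix e assume e: "e \<in> {e. e \<subseteq> E \<and> \<sigma> \<subseteq> e}" and "weight e \<noteq> 0"
        hence "0 < weight e" using weight_nonneg[of e] by simp
        hence "card e = card slots" using weight_support(1) by blast
        moreover have "card \<sigma> \<le> card e" using e finE finite_subset by (intro card_mono) auto
        ultimately show False using False by simp
      qed
      thus ?thesis using \<tau>0 by simp
    qed
    also have "\<dots> = spread_const * ?\<tau> ^ (card \<sigma> - 1) * (card E / 4) / card E"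
      using Epos by (simp add: spread_const_def)
    also have "\<dots> \<le> spread_const * ?\<tau> ^ (card \<sigma> - 1) * codegree E weight {} / card E"
      using W \<tau>0 spread_const_ge_1 by (intro divide_right_mono mult_left_mono) auto
    finally show "codegree E weight \<sigma> \<le> spread_const * ?\<tau> ^ (card \<sigma> - 1) * codegree E weight {} / card E" .
  qed
qed

end

lemma one_plus_ln_le:
  fixes z :: real
  assumes "1 \<le> z"
  shows "z powr - 1 * (1 + ln z) \<le> 2 * z powr - (1/2)"
proof -
  have "ln z = 2 * ln (sqrt z)" using assms by (simp add: ln_sqrt)
  also have "\<dots> \<le> 2 * (sqrt z - 1)" using ln_le_minus_one[of "sqrt z"] assms by simp
  finally have "1 + ln z \<le> 2 * z powr (1/2)" using assms by (simp add: powr_half_sqrt)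
  hence "z powr - 1 * (1 + ln z) \<le> z powr - 1 * (2 * z powr (1/2))" by (rule mult_left_mono) simp
  also have "\<dots> = 2 * z powr (- 1 + 1/2)" by (simp only: powr_add)
  finally show ?thesis by simp
qed

text \<open>The numerical side of the iteration.  An edge set of size \<open>z * M0\<close> has \<open>dens z * n^(2-1/r)\<close> edges,
and \<open>p * M0 = m0\<close>.\<close>

locale scale =
  fixes r \<Delta> :: nat and n p :: real
  assumes r2: "2 \<le> r" and D1: "1 \<le> \<Delta>" and n3: "3 \<le> n" and p0: "0 < p" and p1: "p \<le> 1"
    and thr: "n powr - ((real r - 1) / (real r * real \<Delta> - 1)) * ln n powr 4 \<le> p"
begin

definition M0 where "M0 = p powr - (1 / r) * n powr (2 - 1 / r)"
definition m0 where "m0 = p powr (1 - 1 / r) * n powr (2 - 1 / r)"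
definition \<gamma> where "\<gamma> = (1 - 1 / real r) * ((real r - 1) / (real r * real \<Delta> - 1))"

lemma ln_ge_1: "1 \<le> ln n"
proof -
  have "exp 1 \<le> n" using exp_le n3 by linarith
  hence "ln (exp 1) \<le> ln n" using n3 by (subst ln_le_cancel_iff) auto
  thus ?thesis by simp
qed

lemma M0_pos: "0 < M0" and m0_pos: "0 < m0" using p0 n3 by (auto simp: M0_def m0_def)

lemma p_M0: "p * M0 = m0"
proof -
  have "p powr (1 - 1 / r) = p powr (1 + - (1 / r))" by simp
  also have "\<dots> = p powr 1 * p powr - (1 / r)" by (rule powr_add)
  finally show ?thesis using p0 by (simp add: M0_def m0_def)
qed

lemma rD: "1 \<le> real r * real \<Delta> - 1" "real r - 1 \<le> real r * real \<Delta> - 1"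
proof -
  have "2 * 1 \<le> real r * real \<Delta>" "real r * 1 \<le> real r * real \<Delta>"
    using r2 D1 by (intro mult_mono; simp)+
  thus "1 \<le> real r * real \<Delta> - 1" "real r - 1 \<le> real r * real \<Delta> - 1" by auto
qed

lemma np_ge_ln: "ln n \<le> n * p"
proof -
  have "n powr - 1 \<le> n powr - ((real r - 1) / (real r * real \<Delta> - 1))"
  proof (intro powr_mono)
    have "(real r - 1) / (real r * real \<Delta> - 1) \<le> 1" using rD by (subst divide_le_eq_1_pos) auto
    thus "- 1 \<le> - ((real r - 1) / (real r * real \<Delta> - 1))" by simp
  qed (use n3 in simp)
  hence "n powr - 1 * ln n powr 4 \<le> p" using thr by (meson mult_right_mono order_trans powr_ge_zero)
  hence "ln n powr 4 \<le> n * p" using n3 by (simp add: powr_minus_divide divide_le_eq mult.commute)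
  moreover have "ln n powr 1 \<le> ln n powr 4" using ln_ge_1 by (intro powr_mono) auto
  ultimately show ?thesis using ln_ge_1 by simp
qed

lemma p_ge: "1 / n \<le> p"
proof -
  have "1 \<le> n * p" using np_ge_ln ln_ge_1 by linarith
  thus ?thesis using n3 by (simp add: divide_le_eq mult.commute)
qed

lemma m0_ge: "n \<le> m0"
proof -
  have "n powr - x = (1 / n) powr x" for x
    using n3 by (simp add: powr_minus_divide powr_divide)
  hence "n powr - (1 - 1 / r) = (1 / n) powr (1 - 1 / r)" .
  also have "\<dots> \<le> p powr (1 - 1 / r)"
    using p_ge n3 r2 by (intro powr_mono2) auto
  finally have "n powr - (1 - 1 / r) * n powr (2 - 1 / r) \<le> m0"
    unfolding m0_def by (intro mult_right_mono) auto
  moreover have "n powr - (1 - 1 / r) * n powr (2 - 1 / r) = n powr (- (1 - 1 / r) + (2 - 1 / r))"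
    by (simp only: powr_add)
  ultimately show ?thesis using n3 by simp
qed

lemma M0_ge: "n \<le> M0"
proof -
  have "m0 \<le> 1 * M0" using p1 M0_pos unfolding p_M0[symmetric] by (intro mult_right_mono) auto
  thus ?thesis using m0_ge by simp
qed

text \<open>This is where the precise exponent in the lower bound on \<open>p\<close> matters.  Raising that bound to the power \<open>1 - 1/r \<ge> 1/2\<close>
turns \<open>(ln n)^4\<close> into at least \<open>(ln n)^2\<close>: one logarithm pays for the size of the union bound, the other for the
number of steps.\<close>

lemma log_term_le: "n powr (2 - 1 / r) * n powr - \<gamma> * ln n powr 2 \<le> m0"
proof -
  have i0: "1 / 2 \<le> 1 - 1 / real r" using r2 by (simp add: field_simps)
  have "n powr - \<gamma> * ln n powr 2 \<le> n powr - \<gamma> * ln n powr (4 * (1 - 1 / real r))"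
    using ln_ge_1 i0 by (intro mult_left_mono powr_mono) auto
  also have "\<dots> = (n powr - ((real r - 1) / (real r * real \<Delta> - 1)) * ln n powr 4) powr (1 - 1 / real r)"
  proof -
    have "(n powr - a * ln n powr 4) powr x = n powr (- (x * a)) * ln n powr (4 * x)" for a x
      using n3 ln_ge_1 by (subst powr_mult) (simp_all only: powr_powr, simp_all add: mult.commute)
    thus ?thesis by (simp only: \<gamma>_def)
  qed
  also have "\<dots> \<le> p powr (1 - 1 / real r)"
    using thr i0 by (intro powr_mono2) auto
  finally have "n powr - \<gamma> * ln n powr 2 * n powr (2 - 1 / r) \<le> m0"
    unfolding m0_def by (intro mult_right_mono) auto
  thus ?thesis by (simp add: mult_ac)
qed

definition dens where "dens z = z * p powr - (1 / r)"

lemma dens_M0: "z * M0 = dens z * n powr (2 - 1 / r)" by (simp add: dens_def M0_def)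

lemma dens_ge: "0 < z \<Longrightarrow> z \<le> dens z"
proof -
  assume z: "0 < z"
  have "1 powr - (1/r) \<le> p powr - (1 / r)"
    using p0 p1 by (intro powr_mono2') auto
  hence "z * 1 \<le> z * p powr - (1 / r)" using z by (intro mult_left_mono) auto
  thus "z \<le> dens z" by (simp add: dens_def)
qed

lemma dens_powr: "0 < z \<Longrightarrow> dens z powr - real r = z powr - real r * p"
proof -
  assume z: "0 < z"
  have "dens z powr - real r = z powr - real r * (p powr - (1 / r)) powr - real r"
    using z by (simp add: dens_def powr_mult)
  also have "(p powr - (1 / r)) powr - real r = p" using p0 r2 by (simp add: powr_powr)
  finally show "dens z powr - real r = z powr - real r * p" .
qed

abbreviation \<tau> where "\<tau> k \<equiv> fingerprint_density r \<Delta> k n"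

lemma dens_le:
  assumes z: "0 < z" and N: "z * M0 \<le> n ^ 2"
  shows "dens z \<le> n powr (1 / r)"
proof -
  have "dens z * n powr (2 - 1 / r) \<le> n powr (1 / r) * n powr (2 - 1 / r)"
  proof -
    have "n powr (1 / r) * n powr (2 - 1 / r) = n powr (1 / r + (2 - 1 / r))" by (simp only: powr_add)
    also have "\<dots> = n ^ 2" using n3 by simp
    finally show ?thesis using N by (simp add: dens_M0)
  qed
  thus ?thesis using n3 by simp
qed

lemma \<tau>_M0_ge_1:
  assumes z: "1 \<le> z" and N: "z * M0 \<le> n ^ 2"
  shows "1 \<le> \<tau> (dens z) * (z * M0)"
proof -
  have k: "1 \<le> dens z" "dens z \<le> n powr (1 / r)" using dens_ge[of z] dens_le[OF _ N] z by auto
  have ri: "0 < real r" using r2 by simp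
  have "n powr ((1 / r) * (1 - real r)) = (n powr (1 / r)) powr (1 - real r)" by (simp add: powr_powr)
  also have "\<dots> \<le> dens z powr (1 - real r)" using k r2 by (intro powr_mono2') auto
  also have "\<dots> = dens z powr - real r * dens z" using k by (simp add: powr_diff powr_minus_divide)
  finally have "n powr ((1 / r) * (1 - real r)) * n powr (2 - 1 / r) \<le> dens z powr - real r * dens z * n powr (2 - 1 / r)"
    by (intro mult_right_mono) auto
  also have "n powr ((1 / r) * (1 - real r)) * n powr (2 - 1 / r) = n powr ((1 / r) * (1 - real r) + (2 - 1 / r))"
    by (simp only: powr_add)
  also have "(1 / r) * (1 - real r) + (2 - 1 / r) = 1" using ri by (simp add: field_simps)
  also have "dens z powr - real r * dens z * n powr (2 - 1 / r) = dens z powr - real r * (z * M0)"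
    by (simp add: dens_M0)
  also have "\<dots> \<le> \<tau> (dens z) * (z * M0)"
    using z M0_pos by (intro mult_right_mono) (auto simp: fingerprint_density_def)
  finally show ?thesis using n3 by simp
qed

text \<open>The first term of the fingerprint density contributes \<open>z^(1-r) (1 + ln z) m0\<close>, which is
\<open>O(z^(-1/2) m0)\<close> since \<open>r \<ge> 2\<close>; this decays geometrically along the iteration.  The second
contributes \<open>O(m0 / ln n)\<close> in every step.\<close>

lemma step_cost:
  assumes z: "1 \<le> z" and N: "z * M0 \<le> n ^ 2"
  shows "\<tau> (dens z) * (z * M0) * (1 + ln z) \<le> m0 * (2 * z powr - (1/2) + 2 / ln n)"
proof -
  have k: "1 \<le> dens z" "dens z \<le> n powr (1 / r)" using dens_ge[of z] dens_le[OF _ N] z by auto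
  have lz: "0 \<le> ln z" using z by simp
  have "\<tau> (dens z) \<le> z powr - real r * p + dens z powr - 1 * n powr - \<gamma>"
    using dens_powr[of z] z p0 by (auto simp: fingerprint_density_def \<gamma>_def)
  hence "\<tau> (dens z) * (z * M0) \<le> (z powr - real r * p + dens z powr - 1 * n powr - \<gamma>) * (z * M0)"
    using z M0_pos by (intro mult_right_mono) auto
  also have "\<dots> = (z powr - real r * z) * m0 + (dens z powr - 1 * dens z) * n powr (2 - 1 / r) * n powr - \<gamma>"
  proof -
    have "dens z powr - 1 * n powr - \<gamma> * (z * M0) = (dens z powr - 1 * dens z) * n powr (2 - 1 / r) * n powr - \<gamma>"
      by (simp only: dens_M0 mult_ac)
    moreover have "(c * p + a) * (z * M0) = (c * z) * m0 + a * (z * M0)" for a c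
      unfolding p_M0[symmetric] by (simp add: algebra_simps)
    ultimately show ?thesis by (simp only:)
  qed
  also have "dens z powr - 1 * dens z = 1" using k by (simp add: powr_minus_divide)
  also have "z powr - real r * z = z powr (1 - real r)" using z by (simp add: powr_diff powr_minus_divide)
  also have "z powr (1 - real r) * m0 \<le> z powr - 1 * m0"
    using z r2 m0_pos by (intro mult_right_mono powr_mono) auto
  finally have "\<tau> (dens z) * (z * M0) \<le> z powr - 1 * m0 + 1 * n powr (2 - 1 / r) * n powr - \<gamma>" by simp
  hence "\<tau> (dens z) * (z * M0) * (1 + ln z) \<le> (z powr - 1 * m0 + 1 * n powr (2 - 1 / r) * n powr - \<gamma>) * (1 + ln z)"
    using lz by (intro mult_right_mono) auto
  also have "\<dots> = m0 * (z powr - 1 * (1 + ln z)) + n powr (2 - 1 / r) * n powr - \<gamma> * (1 + ln z)"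
    by (simp add: algebra_simps)
  also have "\<dots> \<le> m0 * (2 * z powr - (1/2)) + n powr (2 - 1 / r) * n powr - \<gamma> * (2 * ln n)"
  proof (intro add_mono mult_left_mono)
    show "z powr - 1 * (1 + ln z) \<le> 2 * z powr - (1/2)" by (rule one_plus_ln_le[OF z])
    have "z \<le> n powr (1 / r)" using k dens_ge[of z] z by linarith
    also have "\<dots> \<le> n powr 1" using n3 r2 by (intro powr_mono) auto
    finally have "z \<le> n" using n3 by simp
    hence "ln z \<le> ln n" using z by simp
    thus "1 + ln z \<le> 2 * ln n" using ln_ge_1 by simp
  qed (use m0_pos in auto)
  also have "n powr (2 - 1 / r) * n powr - \<gamma> * (2 * ln n)
      = (n powr (2 - 1 / r) * n powr - \<gamma> * ln n powr 2) * (2 / ln n)"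
    using ln_ge_1 by (simp add: power2_eq_square)
  also have "\<dots> \<le> m0 * (2 / ln n)"
    using log_term_le ln_ge_1 by (intro mult_right_mono) auto
  finally show ?thesis by (simp add: distrib_left)
qed

text \<open>The first term of the fingerprint density is \<open>p / z^r\<close>, so the ratio of \<open>p\<close> to the density is at most
\<open>z^r\<close>: the logarithm is that of \<open>z\<close> and not of \<open>n\<close>.\<close>

lemma log_factor_le:
  fixes l :: nat
  assumes z: "1 \<le> z"
  shows "ln (1 + 2 ^ l * (exp 1 * p) / \<tau> (dens z)) \<le> real l + 2 + r * ln z"
proof -
  have \<tau>: "z powr - real r * p \<le> \<tau> (dens z)" using dens_powr[of z] z by (simp add: fingerprint_density_def)
  have zp: "0 < z powr - real r * p" using z p0 by simp
  have "2 ^ l * (exp 1 * p) / \<tau> (dens z) \<le> 2 ^ l * (exp 1 * p) / (z powr - real r * p)"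
    using \<tau> zp p0 by (intro divide_left_mono) auto
  also have "\<dots> = 2 ^ l * exp 1 * z powr r" using p0 z by (simp add: powr_minus_divide)
  finally have "1 + 2 ^ l * (exp 1 * p) / \<tau> (dens z) \<le> 1 + 2 ^ l * exp 1 * z powr r" by simp
  also have "\<dots> \<le> exp (real l + 2 + r * ln z)"
  proof -
    have "1 \<le> 2 ^ l * exp 1 * z powr r"
    proof -
      have "1 * 1 * 1 \<le> 2 ^ l * exp 1 * z powr r"
        using z by (intro mult_mono ge_one_powr_ge_zero mult_nonneg_nonneg) auto
      thus ?thesis by simp
    qed
    hence "1 + 2 ^ l * exp 1 * z powr r \<le> 2 * (2 ^ l * exp 1 * z powr r)" by linarith
    also have "\<dots> = 2 ^ Suc l * exp 1 * z powr r" by simp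
    also have "\<dots> \<le> exp (real (Suc l)) * exp 1 * z powr r"
    proof (intro mult_right_mono)
      have "(2::real) \<le> exp 1" using exp_ge_add_one_self[of 1] by simp
      hence "2 ^ Suc l \<le> exp (1::real) ^ Suc l" by (intro power_mono) auto
      thus "2 ^ Suc l \<le> exp (real (Suc l))" by (simp add: exp_of_nat_mult[symmetric] del: power_Suc of_nat_Suc)
    qed auto
    also have "\<dots> = exp (real l + 2 + r * ln z)"
      using z by (simp add: powr_def exp_add[symmetric] add_ac)
    finally show ?thesis .
  qed
  finally have "1 + 2 ^ l * (exp 1 * p) / \<tau> (dens z) \<le> exp (real l + 2 + r * ln z)" .
  moreover have "0 < 1 + 2 ^ l * (exp 1 * p) / \<tau> (dens z)"
    using \<tau> zp p0 by (intro add_pos_nonneg divide_nonneg_nonneg) auto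
  ultimately have "ln (1 + 2 ^ l * (exp 1 * p) / \<tau> (dens z)) \<le> ln (exp (real l + 2 + r * ln z))"
    by (subst ln_le_cancel_iff) auto
  thus ?thesis by simp
qed

end

section \<open>The partition function of pattern-free graphs\<close>

context pattern
begin

text \<open>Injective embeddings of the pattern, including its root, into the graph with edge set \<open>I\<close>.\<close>

definition embeds :: "'v set set \<Rightarrow> bool" where
  "embeds I \<longleftrightarrow> (\<exists>x y t. inj_on y S \<and> inj_on t T \<and> x \<notin> y ` S \<and> x \<notin> t ` T \<and> t ` T \<inter> y ` S = {} \<and>
     (\<forall>a\<in>S. {x, y a} \<in> I) \<and> (\<forall>i\<in>T. \<forall>a\<in>nb i. {t i, y a} \<in> I))"

lemma embeds_mono:
  assumes "embeds J" "J \<subseteq> I"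
  shows "embeds I"
proof -
  obtain x y t where E: "inj_on y S \<and> inj_on t T \<and> x \<notin> y ` S \<and> x \<notin> t ` T \<and> t ` T \<inter> y ` S = {} \<and>
     (\<forall>a\<in>S. {x, y a} \<in> J) \<and> (\<forall>i\<in>T. \<forall>a\<in>nb i. {t i, y a} \<in> J)"
    using assms(1) unfolding embeds_def by (elim exE)
  show ?thesis unfolding embeds_def
    by (rule exI[of _ x], rule exI[of _ y], rule exI[of _ t]) (use E assms(2) in auto)
qed

end

context host
begin

lemma copy_embeds:
  assumes "c \<in> copies" "place c ` slots \<subseteq> I"
  shows "embeds I"
proof -
  obtain x y t where c: "c = (x, y, t)" by (metis prod.exhaust)
  have cc: "(x, y, t) \<in> copies" using assms c by simp
  have y: "y \<in> S \<rightarrow>\<^sub>E N x" "inj_on y S" and t: "inj_on t T" "x \<notin> t ` T" "t ` T \<inter> y ` S = {}"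
    using cc by (auto simp: copies_def Y_def Tt_def)
  have "x \<notin> y ` S" using y(1) N_irrefl by (auto simp: PiE_iff)
  moreover have "{x, y a} \<in> I" if "a \<in> S" for a
  proof -
    have "place c (None, a) \<in> I" using assms(2) that by (auto simp: slots_def)
    thus ?thesis by (simp add: c place_def apex_def)
  qed
  moreover have "{t i, y a} \<in> I" if "i \<in> T" "a \<in> nb i" for i a
  proof -
    have "place c (Some i, a) \<in> I" using assms(2) that by (auto simp: slots_def)
    thus ?thesis by (simp add: c place_def apex_def)
  qed
  ultimately show ?thesis unfolding embeds_def using y(2) t by blast
qed

end

context pattern
begin

text \<open>Induction on the number of edges, with the bound \<open>exp (m0 \<Phi>(z))\<close> for edge sets with at most \<open>z M0\<close>
elements.  The potential \<open>\<Phi>\<close> is chosen so that passing from \<open>z\<close> to \<open>(1 - \<delta>) z\<close> decreases it by exactly the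
cost of one step: the term \<open>A1 (1 - z^(-1/2))\<close> pays for the geometrically decaying part of the cost and
\<open>A2 ln z / ln n\<close> for the part that is the same in all steps.  It is bounded for \<open>z \<le> n\<close>.\<close>

theorem hard_core_bound:
  "\<exists>A>0::real. \<forall>(V :: 'v set) p \<I>. finite V \<longrightarrow> 3 \<le> card V \<longrightarrow> 0 < p \<longrightarrow> p \<le> 1 \<longrightarrow>
     card V powr - ((real r - 1) / (real r * real \<Delta> - 1)) * ln (card V) powr 4 \<le> p \<longrightarrow>
     (\<forall>I\<in>\<I>. \<forall>J\<subseteq>I. J \<in> \<I>) \<longrightarrow> (\<forall>I\<in>\<I>. \<not> embeds I) \<longrightarrow>
     hard_core \<I> (exp 1 * p) {e. e \<subseteq> V \<and> card e = 2}
       \<le> exp (A * (p powr (1 - 1 / r) * card V powr (2 - 1 / r)))"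
proof -
  obtain l where l: "card slots = Suc l" using card_slots_pos by (cases "card slots") auto
  obtain \<delta>0 H :: real where \<delta>0: "0 < \<delta>0" and H: "0 < H" and cont:
    "\<And>E (w :: 'v set set \<Rightarrow> real) \<tau>. spread E (Suc l) w spread_const \<tau> \<Longrightarrow> 0 < \<tau> \<Longrightarrow> 1 \<le> \<tau> * card E \<Longrightarrow>
     (\<exists>Cont. (\<forall>Us. Cont Us \<subseteq> E \<and> real (card (Cont Us)) \<le> (1 - \<delta>0) * card E) \<and>
        (\<forall>I\<subseteq>E. (\<forall>e\<subseteq>I. w e = 0) \<longrightarrow>
          (\<exists>Us. length Us = l \<and> (\<forall>U\<in>set Us. U \<subseteq> I \<and> real (card U) \<le> H * \<tau> * card E) \<and> I \<subseteq> Cont Us)))"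
    using containers[OF spread_const_ge_1, of l, where 'e = "'v set"] by (elim exE conjE) blast
  define \<delta> where "\<delta> = min \<delta>0 (1/2)"
  have \<delta>: "0 < \<delta>" "\<delta> \<le> 1/2" "\<delta> \<le> \<delta>0" using \<delta>0 by (auto simp: \<delta>_def)
  \<comment> \<open>From \<open>a * M0\<close> edges on, \<open>spread_weight\<close> applies; \<open>a \<ge> 2\<close> keeps \<open>(1 - \<delta>) z \<ge> 1\<close> in the induction.\<close>
  define a where "a = max 2 (max (4 * real (card S) ^ 2) ((real (card T) + card S + 1) ^ 2 * (8 * (real (card T) + 1))))"
  have a2: "2 \<le> a" by (simp add: a_def)
  define c1 where "c1 = l * H * (l + 2 + r) + 1"
  have c1: "0 < c1" using H by (simp add: c1_def add_nonneg_pos)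
  define A1 where "A1 = 2 * c1 / ((1 - \<delta>) powr - (1/2) - 1)"
  define A2 where "A2 = 2 * c1 / (- ln (1 - \<delta>))"
  have d1: "0 < (1 - \<delta>) powr - (1/2) - 1"
  proof -
    have "1 powr - (1/2) < (1 - \<delta>) powr - (1/2)" using \<delta> by (intro powr_less_mono2_neg) auto
    thus ?thesis by simp
  qed
  have d2: "0 < - ln (1 - \<delta>)" using \<delta> by simp
  have A1: "0 < A1" and A2: "0 < A2" unfolding A1_def A2_def using c1 d1 d2 by (intro divide_pos_pos; simp)+
  define A0 where "A0 = exp 1 * a"
  have A0: "0 < A0" using a2 by (simp add: A0_def)
  show ?thesis
  proof (intro exI[of _ "A0 + A1 + A2"] conjI allI impI)
    show "0 < A0 + A1 + A2" using A0 A1 A2 by simp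
    fix V :: "'v set" and p :: real and \<I> :: "'v set set set"
    assume V: "finite V" "3 \<le> card V" and p: "0 < p" "p \<le> 1"
      and thr: "card V powr - ((real r - 1) / (real r * real \<Delta> - 1)) * ln (card V) powr 4 \<le> p"
      and down: "\<forall>I\<in>\<I>. \<forall>J\<subseteq>I. J \<in> \<I>" and free: "\<forall>I\<in>\<I>. \<not> embeds I"
    interpret sc: scale r \<Delta> "real (card V)" p
      using r2 \<Delta>_pos V p thr by unfold_locales auto
    let ?n = "real (card V)"
    let ?q = "exp 1 * p"
    let ?K = "{e. e \<subseteq> V \<and> card e = 2}"
    define \<Phi> where "\<Phi> = (\<lambda>z. A0 + A1 * (1 - z powr - (1/2)) + A2 * (ln z / ln ?n))"
    have ln1: "1 \<le> ln ?n" by (rule sc.ln_ge_1)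
    have \<Phi>_mono: "\<Phi> z \<le> \<Phi> z'" if "1 \<le> z" "z \<le> z'" for z z'
    proof -
      have "z' powr - (1/2) \<le> z powr - (1/2)" using that by (intro powr_mono2') auto
      moreover have "ln z \<le> ln z'" using that by simp
      ultimately show ?thesis unfolding \<Phi>_def using A1 A2 ln1
        by (intro add_mono mult_left_mono divide_right_mono) auto
    qed
    have \<Phi>1: "\<Phi> 1 = A0" by (simp add: \<Phi>_def)
    have q0: "0 \<le> ?q" using p by simp
    have fK: "finite ?K" using V by simp
    have cardK: "real (card ?K) \<le> ?n ^ 2"
    proof -
      have "card ?K = card V choose 2" using V(1) by (rule n_subsets)
      also have "\<dots> \<le> card V ^ 2" by (rule binomial_le_pow) (use V(2) in linarith)
      finally show ?thesis by (metis of_nat_le_iff of_nat_power)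
    qed
    have main: "hard_core \<I> ?q E \<le> exp (sc.m0 * \<Phi> z)" if "E \<subseteq> ?K" "1 \<le> z" "real (card E) \<le> z * sc.M0" for E z
      using that
    proof (induction "card E" arbitrary: E z rule: less_induct)
      case less
      have fE: "finite E" using less.prems(1) fK finite_subset by blast
      show ?case
      proof (cases "card E < a * sc.M0")
        case True
        have "hard_core \<I> ?q E \<le> exp (?q * card E)" by (rule hard_core_le_exp[OF fE q0])
        also have "\<dots> \<le> exp (?q * (a * sc.M0))" using True q0 by (simp only: exp_le_cancel_iff) (intro mult_left_mono, auto)
        also have "?q * (a * sc.M0) = sc.m0 * \<Phi> 1" by (simp add: \<Phi>1 A0_def sc.p_M0[symmetric])
        also have "exp \<dots> \<le> exp (sc.m0 * \<Phi> z)"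
          using sc.m0_pos \<Phi>_mono[of 1 z] less.prems by (simp only: exp_le_cancel_iff) (intro mult_left_mono, auto)
        finally show ?thesis .
      next
        case False
        define y where "y = card E / sc.M0"
        have yE: "y * sc.M0 = card E" using sc.M0_pos by (simp add: y_def)
        have ya: "a \<le> y" using False sc.M0_pos by (simp add: y_def field_simps)
        have y1: "1 \<le> y" using ya a2 by simp
        have yz: "y \<le> z" using less.prems(3) sc.M0_pos by (simp add: y_def field_simps)
        have Epos: "0 < card E" using yE y1 sc.M0_pos by (metis mult_pos_pos of_nat_0_less_iff zero_less_one less_le_trans)
        have EN: "y * sc.M0 \<le> ?n ^ 2"
        proof -
          have "real (card E) \<le> card ?K" using less.prems(1) fK by (simp add: card_mono)
          thus ?thesis using cardK yE by linarith
        qed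
        interpret host S T nb r \<Delta> V E
          using V less.prems(1) Epos by unfold_locales auto
        let ?k = "sc.dens y"
        let ?\<tau> = "sc.\<tau> ?k"
        have k: "a \<le> ?k" using sc.dens_ge[of y] ya y1 by linarith
        have k1: "1 \<le> ?k" using k a2 by linarith
        have kE: "real (card E) = ?k * ?n powr (2 - 1 / r)" using sc.dens_M0[of y] yE by simp
        have "(real (card T) + card S + 1) ^ 2 * (4 * (real (card T) + 1) * ?k powr - real r) \<le> 1 / 2"
        proof -
          let ?B = "(real (card T) + card S + 1) ^ 2 * (8 * (real (card T) + 1))"
          have B: "?B \<le> ?k" "0 < ?B" using k by (auto simp: a_def)
          have "?k powr - real r \<le> ?k powr - 1" using k1 r2 by (intro powr_mono) auto
          also have "\<dots> = 1 / ?k" using k1 by (simp add: powr_minus_divide)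
          finally have "?B * ?k powr - real r \<le> ?B * (1 / ?k)" using B by (intro mult_left_mono) auto
          also have "\<dots> \<le> 1" using B k1 by simp
          finally have "?B * ?k powr - real r \<le> 1" .
          moreover have "Q * (4 * c * x) = Q * (8 * c) * x / 2" for Q c x :: real by simp
          ultimately show ?thesis by (simp only:)
        qed
        hence "spread E (card slots) weight spread_const (fingerprint_density r \<Delta> ?k ?n)"
          using k by (intro spread_weight[OF kE k1]) (auto simp: a_def)
        hence sp: "spread E (Suc l) weight spread_const ?\<tau>" by (simp add: l)
        have \<tau>0: "0 < ?\<tau>" using k1 by (simp add: fingerprint_density_def less_max_iff_disj)
        have \<tau>1: "1 \<le> ?\<tau> * card E" using sc.\<tau>_M0_ge_1[OF y1 EN] yE by simp
        from cont[OF sp \<tau>0 \<tau>1] obtain Cont where CC: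
          "(\<forall>Us. Cont Us \<subseteq> E \<and> real (card (Cont Us)) \<le> (1 - \<delta>0) * card E) \<and>
           (\<forall>I\<subseteq>E. (\<forall>e\<subseteq>I. weight e = 0) \<longrightarrow>
             (\<exists>Us. length Us = l \<and> (\<forall>U\<in>set Us. U \<subseteq> I \<and> real (card U) \<le> H * ?\<tau> * card E) \<and> I \<subseteq> Cont Us))"
          by (rule exE)
        have C1: "Cont Us \<subseteq> E" and C2: "real (card (Cont Us)) \<le> (1 - \<delta>0) * card E" for Us
          using conjunct1[OF CC] by simp_all
        note C3 = conjunct2[OF CC, rule_format]
        define B where "B = exp (sc.m0 * \<Phi> ((1 - \<delta>) * y))"
        \<comment> \<open>With this choice \<open>2^l q / \<mu> \<le> \<tau>\<close>, so the exponential factor is at most \<open>exp (\<tau> N)\<close>.\<close>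
        define \<mu> where "\<mu> = 1 + 2 ^ l * ?q / ?\<tau>"
        have \<mu>1: "1 \<le> \<mu>" using \<tau>0 p by (simp add: \<mu>_def)
        have y'1: "1 \<le> (1 - \<delta>) * y"
        proof -
          have "(1/2) * 2 \<le> (1 - \<delta>) * y" using \<delta> ya a2 by (intro mult_mono) auto
          thus ?thesis by simp
        qed
        have bound: "hard_core \<I> ?q W \<le> B" if W: "W \<subseteq> Cont Us" for W Us
          unfolding B_def
        proof (rule less.hyps)
          have "real (card W) \<le> card (Cont Us)"
            using W C1[of Us] fE by (meson card_mono finite_subset of_nat_le_iff)
          also have "\<dots> \<le> (1 - \<delta>0) * card E" by (rule C2)
          also have "\<dots> \<le> (1 - \<delta>) * card E" using \<delta> by (intro mult_right_mono) auto
          finally have W1: "real (card W) \<le> (1 - \<delta>) * card E" .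
          also have "\<dots> < 1 * real (card E)" using \<delta> Epos by (intro mult_strict_right_mono) auto
          finally show "card W < card E" by simp
          show "W \<subseteq> ?K" using W C1 less.prems(1) by blast
          show "1 \<le> (1 - \<delta>) * y" by (rule y'1)
          show "real (card W) \<le> (1 - \<delta>) * y * sc.M0" using W1 unfolding yE[symmetric] by (simp only: mult.assoc)
        qed
        have "hard_core \<I> ?q E \<le> \<mu> powr (l * (H * ?\<tau> * card E)) * exp (2 ^ l * ?q / \<mu> * card E) * B"
        proof (rule hard_core_container_bound[OF fE q0 \<mu>1])
          show "0 \<le> B" by (simp add: B_def)
          show "\<And>I J. I \<in> \<I> \<Longrightarrow> J \<subseteq> I \<Longrightarrow> J \<in> \<I>" using down by blast
          fix I assume I: "I \<subseteq> E" "I \<in> \<I>"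
          have "\<forall>e\<subseteq>I. weight e = 0"
          proof (intro allI impI, rule ccontr)
            fix e assume e: "e \<subseteq> I" "weight e \<noteq> 0"
            hence "0 < weight e" using weight_nonneg[of e] by simp
            then obtain c where "c \<in> copies" "place c ` slots = e" using weight_support(2) by blast
            hence "embeds I" using e by (intro copy_embeds[of c]) auto
            thus False using free I by blast
          qed
          thus "\<exists>Us. length Us = l \<and> (\<forall>U\<in>set Us. U \<subseteq> I \<and> real (card U) \<le> H * ?\<tau> * card E) \<and> I \<subseteq> Cont Us"
            by (intro C3[OF I(1)]) simp
        qed (rule C1, rule bound)
        also have "\<mu> powr (l * (H * ?\<tau> * card E)) * exp (2 ^ l * ?q / \<mu> * card E) * B
           = exp (l * (H * ?\<tau> * card E) * ln \<mu> + 2 ^ l * ?q / \<mu> * card E) * B"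
          using \<mu>1 by (simp add: powr_def exp_add)
        also have "\<dots> \<le> exp (sc.m0 * (c1 * (2 * y powr - (1/2) + 2 / ln ?n))) * B"
        proof (intro mult_right_mono)
          have "2 ^ l * ?q / \<mu> \<le> ?\<tau>"
          proof -
            have "2 ^ l * ?q \<le> ?\<tau> * \<mu>" using \<tau>0 by (simp add: \<mu>_def distrib_left)
            thus ?thesis using \<mu>1 by (simp add: divide_le_eq)
          qed
          hence "l * (H * ?\<tau> * card E) * ln \<mu> + 2 ^ l * ?q / \<mu> * card E
             \<le> l * (H * ?\<tau> * card E) * (real l + 2 + r * ln y) + ?\<tau> * card E"
            using H \<tau>0 sc.log_factor_le[OF y1, of l]
            by (intro add_mono mult_left_mono mult_right_mono) (auto simp: \<mu>_def)
          also have "\<dots> = ?\<tau> * card E * (l * H * (real l + 2 + r * ln y) + 1)"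
            by (simp add: algebra_simps)
          also have "\<dots> \<le> ?\<tau> * card E * (c1 * (1 + ln y))"
          proof (intro mult_left_mono)
            have ly: "0 \<le> ln y" using y1 by simp
            have "real l + 2 + r * ln y \<le> (real l + 2 + r) * (1 + ln y)"
              using ly by (simp add: algebra_simps)
            hence "l * H * (real l + 2 + r * ln y) \<le> l * H * ((real l + 2 + r) * (1 + ln y))"
              using H by (intro mult_left_mono) auto
            thus "l * H * (real l + 2 + r * ln y) + 1 \<le> c1 * (1 + ln y)"
              using ly by (simp add: c1_def algebra_simps)
          qed (use \<tau>0 in simp)
          also have "\<dots> = c1 * (?\<tau> * (y * sc.M0) * (1 + ln y))" by (simp add: yE)
          also have "\<dots> \<le> c1 * (sc.m0 * (2 * y powr - (1/2) + 2 / ln ?n))"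
            using c1 sc.step_cost[OF y1 EN] by (intro mult_left_mono) auto
          finally show "exp (l * (H * ?\<tau> * card E) * ln \<mu> + 2 ^ l * ?q / \<mu> * card E)
            \<le> exp (sc.m0 * (c1 * (2 * y powr - (1/2) + 2 / ln ?n)))" by (simp add: mult_ac)
        qed (simp add: B_def)
        also have "\<dots> = exp (sc.m0 * (c1 * (2 * y powr - (1/2) + 2 / ln ?n) + \<Phi> ((1 - \<delta>) * y)))"
          by (simp add: B_def exp_add[symmetric] distrib_left)
        also have "c1 * (2 * y powr - (1/2) + 2 / ln ?n) + \<Phi> ((1 - \<delta>) * y) = \<Phi> y"
        proof -
          have e1: "((1 - \<delta>) * y) powr - (1/2) = (1 - \<delta>) powr - (1/2) * y powr - (1/2)"
            by (rule powr_mult)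
          have e2: "ln ((1 - \<delta>) * y) = ln (1 - \<delta>) + ln y" using \<delta> y1 by (intro ln_mult_pos) auto
          have e3: "A1 * ((1 - \<delta>) powr - (1/2) - 1) = 2 * c1" using d1 by (simp add: A1_def)
          have e4: "A2 * (- ln (1 - \<delta>)) = 2 * c1" using d2 by (simp add: A2_def)
          have "c1 * (2 * y powr - (1/2) + 2 / ln ?n) = 2 * c1 * y powr - (1/2) + 2 * c1 / ln ?n"
            by (simp add: distrib_left)
          also have "\<dots> = A1 * ((1 - \<delta>) powr - (1/2) - 1) * y powr - (1/2) + A2 * (- ln (1 - \<delta>)) / ln ?n"
            by (simp only: e3 e4)
          also have "\<dots> = \<Phi> y - \<Phi> ((1 - \<delta>) * y)"
            unfolding \<Phi>_def e1 e2 by (simp add: algebra_simps add_divide_distrib)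
          finally show ?thesis by simp
        qed
        also have "exp (sc.m0 * \<Phi> y) \<le> exp (sc.m0 * \<Phi> z)"
          using sc.m0_pos \<Phi>_mono[OF y1 yz] by (simp only: exp_le_cancel_iff) (intro mult_left_mono, auto)
        finally show ?thesis .
      qed
    qed
    have n3: "3 \<le> ?n" using V by simp
    have "hard_core \<I> ?q ?K \<le> exp (sc.m0 * \<Phi> ?n)"
    proof (rule main)
      have "?n ^ 2 \<le> ?n * sc.M0" using sc.M0_ge n3 by (simp add: power2_eq_square mult_left_mono)
      thus "real (card ?K) \<le> ?n * sc.M0" using cardK by linarith
    qed (use n3 in auto)
    also have "\<dots> \<le> exp (sc.m0 * (A0 + A1 + A2))"
    proof -
      have "\<Phi> ?n \<le> A0 + A1 * 1 + A2 * 1"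
        unfolding \<Phi>_def using A1 A2 ln1 by (intro add_mono mult_left_mono) auto
      hence "sc.m0 * \<Phi> ?n \<le> sc.m0 * (A0 + A1 + A2)" using sc.m0_pos by (intro mult_left_mono) auto
      thus ?thesis by simp
    qed
    finally show "hard_core \<I> ?q ?K \<le> exp ((A0 + A1 + A2) * (p powr (1 - 1 / r) * ?n powr (2 - 1 / r)))"
      by (simp add: sc.m0_def mult.commute)
  qed
qed

end

section \<open>Graph copies and the first moment\<close>

lemma contains_copyI:
  assumes F: "simple_graph F" and f: "inj_on f (verts F)" "f ` verts F \<subseteq> verts G"
    and e: "\<And>e. e \<in> edges F \<Longrightarrow> f ` e \<in> edges G"
  shows "contains_copy G F"
proof -
  let ?H = "(f ` verts F, (`) f ` edges F)"
  let ?g = "inv_into (verts F) f"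
  have inv: "?g ` f ` e = e" if "e \<in> edges F" for e
  proof -
    have "e \<subseteq> verts F" using F that by (simp add: simple_graph_def)
    thus ?thesis by (rule inv_into_image_cancel[OF f(1)])
  qed
  have "simple_graph ?H" unfolding simple_graph_def
  proof (intro conjI ballI)
    show "finite (verts ?H)" using F by (simp add: simple_graph_def)
    fix e assume "e \<in> edges ?H"
    then obtain e' where e': "e' \<in> edges F" "e = f ` e'" by auto
    have "e' \<subseteq> verts F" "card e' = 2" using F e'(1) by (auto simp: simple_graph_def)
    thus "e \<subseteq> verts ?H" "card e = 2"
      using e'(2) card_image[OF inj_on_subset[OF f(1)], of e'] by auto
  qed
  hence "subgraph ?H G" using f e by (auto simp: subgraph_def)
  moreover have "isomorphic ?H F" unfolding isomorphic_def
  proof (intro exI[of _ ?g] conjI)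
    show "bij_betw ?g (verts ?H) (verts F)"
      using f(1) by (simp add: bij_betw_inv_into inj_on_imp_bij_betw)
    show "edges F = (`) ?g ` edges ?H" using inv by (simp add: image_image)
  qed
  ultimately show ?thesis unfolding contains_copy_def by blast
qed

lemma contains_copyE:
  assumes "contains_copy G F"
  obtains f where "inj_on f (verts F)" "f ` verts F \<subseteq> verts G" "\<And>e. e \<in> edges F \<Longrightarrow> f ` e \<in> edges G"
proof -
  obtain H g where H: "subgraph H G" and g: "bij_betw g (verts H) (verts F)" "edges F = (`) g ` edges H"
    using assms unfolding contains_copy_def isomorphic_def by blast
  let ?f = "inv_into (verts H) g"
  have b: "bij_betw ?f (verts F) (verts H)" using g(1) by (rule bij_betw_inv_into)
  show ?thesis
  proof (rule that[of ?f])
    show "inj_on ?f (verts F)" using b by (rule bij_betw_imp_inj_on)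
    show "?f ` verts F \<subseteq> verts G" using b H by (simp add: bij_betw_def subgraph_def)
    fix e assume "e \<in> edges F"
    then obtain e' where e': "e' \<in> edges H" "e = g ` e'" using g(2) by auto
    have "e' \<subseteq> verts H" using H e'(1) by (auto simp: subgraph_def simple_graph_def)
    hence "?f ` e = e'" using e'(2) inv_into_image_cancel[OF bij_betw_imp_inj_on[OF g(1)]] by simp
    thus "?f ` e \<in> edges G" using e'(1) H by (auto simp: subgraph_def)
  qed
qed

lemma contains_copy_trans:
  assumes K: "simple_graph K" and GF: "contains_copy G F" and FK: "contains_copy F K"
  shows "contains_copy G K"
proof -
  obtain f where f: "inj_on f (verts F)" "f ` verts F \<subseteq> verts G" "\<And>e. e \<in> edges F \<Longrightarrow> f ` e \<in> edges G"
    by (rule contains_copyE[OF GF], rule that)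
  obtain g where g: "inj_on g (verts K)" "g ` verts K \<subseteq> verts F" "\<And>e. e \<in> edges K \<Longrightarrow> g ` e \<in> edges F"
    by (rule contains_copyE[OF FK], rule that)
  show ?thesis
  proof (rule contains_copyI[OF K, of "f \<circ> g"])
    show "inj_on (f \<circ> g) (verts K)" using f(1) g(1,2) by (auto intro: comp_inj_on inj_on_subset)
    show "(f \<circ> g) ` verts K \<subseteq> verts G" using f(2) g(2) by (auto simp: image_subset_iff)
    show "(f \<circ> g) ` e \<in> edges G" if "e \<in> edges K" for e
      using f(3)[OF g(3)[OF that]] by (simp add: image_comp)
  qed
qed

lemma ex_in_bounds:
  fixes G :: "nat graph"
  assumes G: "finite (verts G)"
  shows "\<And>H. subgraph H G \<Longrightarrow> free_of F H \<Longrightarrow> card (edges H) \<le> ex_in G F"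
    and "0 < ex_in G F \<Longrightarrow> \<exists>H. subgraph H G \<and> free_of F H \<and> card (edges H) = ex_in G F"
proof -
  let ?A = "{card (edges H) | H. subgraph H G \<and> free_of F H}"
  have "card (edges H) \<le> card (Pow (verts G))" if H: "subgraph H G" for H
    using H G by (intro card_mono) (auto simp: subgraph_def simple_graph_def)
  hence sub: "?A \<subseteq> {..card (Pow (verts G))}" by auto
  hence fin: "finite ?A" using finite_subset by blast
  show "card (edges H) \<le> ex_in G F" if "subgraph H G" "free_of F H" for H
  proof -
    have "card (edges H) \<in> ?A" using that by blast
    thus ?thesis unfolding ex_in_def using bdd_above_finite[OF fin] by (rule cSup_upper)
  qed
  assume pos: "0 < ex_in G F"
  have "?A \<noteq> {}"
  proof
    assume "?A = {}"
    hence "ex_in G F = Sup {}" unfolding ex_in_def by (simp only:)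
    thus False using pos by (simp add: Sup_nat_def)
  qed
  moreover have "Sup A \<in> A" if "finite A" "A \<noteq> {}" for A :: "nat set"
    using that by (simp add: Sup_nat_def)
  ultimately have "Sup ?A \<in> ?A" using fin by blast
  thus "\<exists>H. subgraph H G \<and> free_of F H \<and> card (edges H) = ex_in G F"
    unfolding ex_in_def by force
qed

lemma finite_all_edges: "finite (all_edges n)" by (simp add: all_edges_def)

lemma prob_subset_edges:
  assumes I: "I \<subseteq> all_edges n" and p: "0 \<le> p" "p \<le> 1"
  shows "measure_pmf.prob (random_graph n p) {G. I \<subseteq> edges G} = p ^ card I"
proof -
  let ?P = "Pi_pmf (all_edges n) False (\<lambda>_. bernoulli_pmf p)"
  have "measure_pmf.prob (random_graph n p) {G. I \<subseteq> edges G}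
     = measure_pmf.prob ?P ((\<lambda>\<omega>. ({..<n}, {e \<in> all_edges n. \<omega> e})) -` {G. I \<subseteq> edges G})"
    by (simp add: random_graph_def)
  also have "(\<lambda>\<omega>. ({..<n}, {e \<in> all_edges n. \<omega> e})) -` {G. I \<subseteq> edges G}
     = Pi (all_edges n) (\<lambda>e. if e \<in> I then {True} else UNIV)"
    using I by (auto simp: Pi_iff split: if_splits)
  also have "measure_pmf.prob ?P \<dots> = (\<Prod>e\<in>all_edges n. measure_pmf.prob (bernoulli_pmf p) (if e \<in> I then {True} else UNIV))"
    by (rule measure_Pi_pmf_Pi[OF finite_all_edges])
  also have "\<dots> = (\<Prod>e\<in>all_edges n. if e \<in> I then p else 1)"
    using p by (intro prod.cong refl) (simp add: measure_pmf_single)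
  also have "\<dots> = (\<Prod>e\<in>I. p)"
    using I finite_all_edges[of n] by (intro prod.mono_neutral_cong_right) auto
  finally show ?thesis by simp
qed

lemma set_pmf_random_graph: "G \<in> set_pmf (random_graph n p) \<Longrightarrow> verts G = {..<n} \<and> edges G \<subseteq> all_edges n"
  by (auto simp: random_graph_def)

text \<open>The union bound over the members with at least \<open>x\<close> elements, each of which may be given an extra weight
\<open>exp (|I| - x) \<ge> 1\<close>.\<close>

lemma prob_large_member:
  fixes x :: real
  assumes p: "0 \<le> p" "p \<le> 1"
  shows "measure_pmf.prob (random_graph n p) {G. \<exists>I\<in>\<I>. I \<subseteq> all_edges n \<and> I \<subseteq> edges G \<and> x \<le> card I}
    \<le> exp (- x) * hard_core \<I> (exp 1 * p) (all_edges n)"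
proof -
  let ?J = "{I. I \<in> \<I> \<and> I \<subseteq> all_edges n \<and> x \<le> card I}"
  have fJ: "finite ?J" by (rule finite_subset[of _ "Pow (all_edges n)"]) (auto simp: finite_all_edges)
  have "{G. \<exists>I\<in>\<I>. I \<subseteq> all_edges n \<and> I \<subseteq> edges G \<and> x \<le> card I} = (\<Union>I\<in>?J. {G :: nat graph. I \<subseteq> edges G})"
    by auto
  also have "measure_pmf.prob (random_graph n p) \<dots> \<le> (\<Sum>I\<in>?J. measure_pmf.prob (random_graph n p) {G. I \<subseteq> edges G})"
    using fJ by (intro measure_pmf.finite_measure_subadditive_finite) auto
  also have "\<dots> = (\<Sum>I\<in>?J. p ^ card I)"
    using p by (intro sum.cong refl prob_subset_edges) auto
  also have "\<dots> \<le> (\<Sum>I\<in>?J. exp (- x) * (exp 1 * p) ^ card I)"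
  proof (rule sum_mono)
    fix I assume I: "I \<in> ?J"
    have "1 * p ^ card I \<le> exp (card I - x) * p ^ card I"
      using I p by (intro mult_right_mono) auto
    also have "exp (card I - x) = exp (- x) * exp 1 ^ card I"
      by (simp add: exp_diff exp_minus exp_of_nat_mult[symmetric] divide_inverse)
    finally show "p ^ card I \<le> exp (- x) * (exp 1 * p) ^ card I" by (simp add: power_mult_distrib)
  qed
  also have "\<dots> \<le> (\<Sum>I | I \<in> \<I> \<and> I \<subseteq> all_edges n. exp (- x) * (exp 1 * p) ^ card I)"
  proof (rule sum_mono2)
    show "finite {I. I \<in> \<I> \<and> I \<subseteq> all_edges n}"
      by (rule finite_subset[of _ "Pow (all_edges n)"]) (auto simp: finite_all_edges)
  qed (use p in auto)
  also have "\<dots> = exp (- x) * hard_core \<I> (exp 1 * p) (all_edges n)"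
    by (simp add: hard_core_def sum_distrib_left)
  finally show ?thesis .
qed

lemma aas_if_complement_vanishes:
  assumes "\<forall>\<^sub>F n in sequentially. measure_pmf.prob (M n) {x. \<not> A n x} \<le> \<epsilon> n" and "\<epsilon> \<longlonglongrightarrow> 0"
  shows "aas M A"
  unfolding aas_def
proof (rule tendsto_sandwich)
  have "measure_pmf.prob (M n) {x. A n x} = 1 - measure_pmf.prob (M n) {x. \<not> A n x}" for n
    using measure_pmf.prob_compl[of "{x. \<not> A n x}" "M n"] by (simp add: Compl_eq Diff_eq) 
  thus "\<forall>\<^sub>F n in sequentially. 1 - \<epsilon> n \<le> measure_pmf.prob (M n) {x. A n x}"
    using assms(1) by (auto elim: eventually_mono)
  show "\<forall>\<^sub>F n in sequentially. measure_pmf.prob (M n) {x. A n x} \<le> 1" by simp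
  show "(\<lambda>n. 1 - \<epsilon> n) \<longlonglongrightarrow> 1" using tendsto_diff[OF tendsto_const[of 1] assms(2)] by simp
qed (rule tendsto_const)

section \<open>The upper bound\<close>

text \<open>The graph \<open>F\<close> is first padded to a pattern.  The vertex \<open>v\<close> becomes the root and is joined to all of \<open>S\<close>.
Every other vertex of \<open>T\<close> is given private new neighbours, which bring its degree up to \<open>r\<close>; they have degree 2,
counting the root, and \<open>2 \<le> \<Delta>\<close>.  A further vertex that is adjacent to the root alone makes the pattern
nonempty.  An embedding of the pattern then restricts to a copy of \<open>F\<close> all of whose vertices, isolated ones
included, lie on edges of the host.\<close>

theorem upper_bound:
  fixes F :: "'a graph" and S T :: "'a set" and v :: 'a and r \<Delta> :: nat
  assumes F: "simple_graph F" and r: "r \<ge> 2" and \<Delta>: "\<Delta> \<ge> 2"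
    and bip: "bipartition F S T" and v: "v \<in> T"
    and degT: "\<forall>w\<in>T - {v}. vertex_degree F w \<le> r"
    and degS: "\<forall>u\<in>S. card (neighbours F u \<union> {v}) \<le> \<Delta>"
  shows "\<exists>K>0. \<forall>p. admissible_prob r \<Delta> 4 p \<longrightarrow>
       aas (\<lambda>n. random_graph n (p n))
         (\<lambda>n G. real (ex_in G F) \<le> K * (p n powr (1 - 1 / real r) * real n powr (2 - 1 / real r)))"
proof -
  define TT where "TT = T - {v}"
  \<comment> \<open>\<open>Inl\<close> marks the vertices of \<open>F\<close> and \<open>Inr (w, j)\<close> the private neighbours of \<open>w\<close>.\<close>
  define nbb :: "'a \<Rightarrow> ('a + 'a \<times> nat) set" where
    "nbb = (\<lambda>w. Inl ` neighbours F w \<union> Inr ` ({w} \<times> {..<r - vertex_degree F w}))"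
  define SS :: "('a + 'a \<times> nat) set" where
    "SS = Inl ` S \<union> insert (Inr (v, 0)) (\<Union>w\<in>TT. Inr ` ({w} \<times> {..<r - vertex_degree F w}))"
  have ST: "S \<union> T = verts F" "S \<inter> T = {}" and bipE: "\<And>e. e \<in> edges F \<Longrightarrow> \<exists>s\<in>S. \<exists>t\<in>T. e = {s, t}"
    using bip by (auto simp: bipartition_def)
  have finV: "finite (verts F)" using F by (simp add: simple_graph_def)
  have finS: "finite S" and finT: "finite T" using ST(1) finV by (metis finite_Un)+
  have finTT: "finite TT" using finT by (simp add: TT_def)
  have nbT: "neighbours F w \<subseteq> S" if "w \<in> T" for w
  proof
    fix u assume "u \<in> neighbours F w"
    hence "{w, u} \<in> edges F" by (simp add: neighbours_def)
    from bipE[OF this] obtain s t where "s \<in> S" "t \<in> T" "{w, u} = {s, t}" by blast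
    thus "u \<in> S" using that ST(2) by (auto simp: doubleton_eq_iff)
  qed
  have fin_nb: "finite (neighbours F w)" if "w \<in> T" for w using nbT[OF that] finS finite_subset by blast
  have symm: "w \<in> neighbours F u \<longleftrightarrow> u \<in> neighbours F w" for u w by (simp add: neighbours_def insert_commute)
  interpret pattern SS TT nbb r \<Delta>
  proof
    show "finite SS" using finS finTT by (simp add: SS_def)
    show "finite TT" by (rule finTT)
    show "SS \<noteq> {}" by (simp add: SS_def)
    show "2 \<le> r" by (rule r)
    show "nbb i \<subseteq> SS" if "i \<in> TT" for i
      using nbT[of i] that by (auto simp: nbb_def SS_def TT_def)
    show "card (nbb i) = r" if i: "i \<in> TT" for i
    proof -
      have "card (nbb i) = card (neighbours F i) + (r - vertex_degree F i)"
        unfolding nbb_def using i fin_nb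
        by (subst card_Un_disjoint) (auto simp: card_image card_cartesian_product TT_def)
      thus ?thesis using degT i by (simp add: vertex_degree_def TT_def)
    qed
    show "card {i \<in> TT. a \<in> nbb i} + 1 \<le> \<Delta>" if a: "a \<in> SS" for a
    proof (cases a)
      case (Inl u)
      hence u: "u \<in> S" using a by (auto simp: SS_def)
      have fu: "finite (neighbours F u)"
      proof (rule finite_subset[OF _ finV])
        show "neighbours F u \<subseteq> verts F" using F by (auto simp: neighbours_def simple_graph_def)
      qed
      have "{i \<in> TT. a \<in> nbb i} \<subseteq> neighbours F u - {v}"
        using Inl symm by (auto simp: nbb_def TT_def)
      hence "card {i \<in> TT. a \<in> nbb i} \<le> card (neighbours F u - {v})" using fu by (intro card_mono) auto
      also have "\<dots> + 1 = card (insert v (neighbours F u - {v}))"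
        using fu by (subst card_insert_disjoint) auto
      also have "\<dots> = card (neighbours F u \<union> {v})" by (rule arg_cong[where f = card]) auto
      also have "\<dots> \<le> \<Delta>" using degS u by blast
      finally show ?thesis by simp
    next
      case (Inr wj)
      have "{i \<in> TT. a \<in> nbb i} \<subseteq> {fst wj}" using Inr by (auto simp: nbb_def)
      hence "card {i \<in> TT. a \<in> nbb i} \<le> card {fst wj}" by (intro card_mono) auto
      thus ?thesis using \<Delta> by simp
    qed
  qed
  have embeds_copy: "contains_copy H F" if emb: "embeds (edges H)" and H: "\<forall>e\<in>edges H. e \<subseteq> verts H" for H :: "nat graph"
  proof -
    obtain x y t where E: "inj_on y SS \<and> inj_on t TT \<and> x \<notin> y ` SS \<and> x \<notin> t ` TT \<and> t ` TT \<inter> y ` SS = {} \<and>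
     (\<forall>a\<in>SS. {x, y a} \<in> edges H) \<and> (\<forall>i\<in>TT. \<forall>a\<in>nbb i. {t i, y a} \<in> edges H)"
      using emb unfolding embeds_def by (elim exE)
    have xyt: "inj_on y SS" "inj_on t TT" "x \<notin> y ` SS" "x \<notin> t ` TT" "t ` TT \<inter> y ` SS = {}"
      and e1: "\<And>a. a \<in> SS \<Longrightarrow> {x, y a} \<in> edges H" and e2: "\<And>i a. i \<in> TT \<Longrightarrow> a \<in> nbb i \<Longrightarrow> {t i, y a} \<in> edges H"
      using E by simp_all
    define f where "f = (\<lambda>u. if u \<in> S then y (Inl u) else if u = v then x else t u)"
    have SSl: "Inl u \<in> SS" if "u \<in> S" for u using that by (simp add: SS_def)
    have vS: "v \<notin> S" using v ST(2) by auto
    have TTS: "w \<notin> S" "w \<noteq> v" if "w \<in> TT" for w using that ST(2) by (auto simp: TT_def)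
    have V: "verts F = S \<union> {v} \<union> TT" using ST(1) v by (auto simp: TT_def)
    show ?thesis
    proof (rule contains_copyI[OF F, of f])
      show "inj_on f (verts F)"
      proof (rule inj_onI)
        fix u u' assume u: "u \<in> verts F" "u' \<in> verts F" and eq: "f u = f u'"
        have ym: "y (Inl u) \<in> y ` SS" if "u \<in> S" for u using SSl[OF that] by blast
        have tm: "t u \<in> t ` TT" if "u \<in> TT" for u using that by blast
        have yinj: "u = u'" if "u \<in> S" "u' \<in> S" "y (Inl u) = y (Inl u')" for u u'
          using inj_onD[OF xyt(1) that(3) SSl[OF that(1)] SSl[OF that(2)]] by simp
        have tinj: "u = u'" if "u \<in> TT" "u' \<in> TT" "t u = t u'" for u u'
          using inj_onD[OF xyt(2) that(3) that(1,2)] .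
        have fS: "f u = y (Inl u)" if "u \<in> S" for u using that by (simp add: f_def)
        have fv: "f v = x" using vS by (simp add: f_def)
        have fT: "f u = t u" if "u \<in> TT" for u using TTS[OF that] by (simp add: f_def)
        consider "u \<in> S" | "u = v" | "u \<in> TT" using u(1) V by blast
        note cu = this
        consider "u' \<in> S" | "u' = v" | "u' \<in> TT" using u(2) V by blast
        note cu' = this
        show "u = u'"
        proof (rule cu)
          assume a: "u \<in> S"
          show ?thesis
          proof (rule cu')
            assume "u' \<in> S" thus ?thesis using a yinj eq fS by metis
          next
            assume "u' = v" thus ?thesis using a eq fS fv ym xyt(3) by metis
          next
            assume b: "u' \<in> TT"
            have "t u' = y (Inl u)" using a b eq fS fT by simp
            thus ?thesis using ym[OF a] tm[OF b] xyt(5) by auto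
          qed
        next
          assume a: "u = v"
          show ?thesis
          proof (rule cu')
            assume "u' \<in> S" thus ?thesis using a eq fS fv ym xyt(3) by metis
          next
            assume "u' = v" thus ?thesis using a by simp
          next
            assume "u' \<in> TT" thus ?thesis using a eq fT fv tm xyt(4) by metis
          qed
        next
          assume a: "u \<in> TT"
          show ?thesis
          proof (rule cu')
            assume b: "u' \<in> S"
            have "t u = y (Inl u')" using a b eq fS fT by simp
            thus ?thesis using ym[OF b] tm[OF a] xyt(5) by auto
          next
            assume "u' = v" thus ?thesis using a eq fT fv tm xyt(4) by metis
          next
            assume "u' \<in> TT" thus ?thesis using a eq fT tinj by metis
          qed
        qed
      qed
      show "f ` verts F \<subseteq> verts H"
      proof (rule image_subsetI)
        fix u assume "u \<in> verts F"
        then consider "u \<in> S" | "u = v" | "u \<in> TT" using V by blast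
        thus "f u \<in> verts H"
        proof cases
          case 1
          thus ?thesis using e1[OF SSl[OF 1]] H by (auto simp: f_def)
        next
          case 2
          have "Inr (v, 0) \<in> SS" by (simp add: SS_def)
          from e1[OF this] have "x \<in> verts H" using H by auto
          thus ?thesis using 2 vS by (simp add: f_def)
        next
          case 3
          have "nbb u \<noteq> {}" using card_nb[OF 3] r by auto
          then obtain a where "a \<in> nbb u" by blast
          from e2[OF 3 this] have "t u \<in> verts H" using H by auto
          thus ?thesis using TTS[OF 3] by (simp add: f_def)
        qed
      qed
      fix e assume e: "e \<in> edges F"
      then obtain s w where sw: "s \<in> S" "w \<in> T" "e = {s, w}" using bipE by blast
      show "f ` e \<in> edges H"
      proof (cases "w = v")
        case True
        thus ?thesis using e1[OF SSl[OF sw(1)]] sw vS by (simp add: f_def insert_commute)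
      next
        case False
        hence w: "w \<in> TT" using sw by (simp add: TT_def)
        have "Inl s \<in> nbb w" using e sw by (auto simp: nbb_def neighbours_def insert_commute)
        thus ?thesis using e2[OF w] sw TTS[OF w] by (simp add: f_def insert_commute)
      qed
    qed
  qed
  obtain A :: real where AH: "0 < A \<and> (\<forall>(V :: nat set) p \<I>. finite V \<longrightarrow> 3 \<le> card V \<longrightarrow> 0 < p \<longrightarrow> p \<le> 1 \<longrightarrow>
     card V powr - ((real r - 1) / (real r * real \<Delta> - 1)) * ln (card V) powr 4 \<le> p \<longrightarrow>
     (\<forall>I\<in>\<I>. \<forall>J\<subseteq>I. J \<in> \<I>) \<longrightarrow> (\<forall>I\<in>\<I>. \<not> embeds I) \<longrightarrow>
     hard_core \<I> (exp 1 * p) {e. e \<subseteq> V \<and> card e = 2}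
       \<le> exp (A * (p powr (1 - 1 / r) * card V powr (2 - 1 / r))))"
    using hard_core_bound[where 'v = nat] by (rule exE)
  have A: "0 < A" by (rule conjunct1[OF AH])
  note hc = conjunct2[OF AH, THEN spec, THEN spec, THEN spec, THEN mp, THEN mp, THEN mp, THEN mp, THEN mp, THEN mp, THEN mp]
  \<comment> \<open>Avoiding the padded pattern is weaker than avoiding \<open>F\<close>, and it does not depend on the vertex set.\<close>
  define \<I> where "\<I> = {I :: nat set set. \<not> embeds I}"
  have down: "\<forall>I\<in>\<I>. \<forall>J\<subseteq>I. J \<in> \<I>"
  proof (intro ballI allI impI)
    fix I J assume "I \<in> \<I>" "J \<subseteq> I"
    thus "J \<in> \<I>" using embeds_mono[of J I] by (auto simp: \<I>_def)
  qed
  show ?thesis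
  proof (intro exI[of _ "A + 1"] conjI allI impI)
    show "0 < A + 1" using A by simp
    fix p assume adm: "admissible_prob r \<Delta> 4 p"
    show "aas (\<lambda>n. random_graph n (p n))
         (\<lambda>n G. real (ex_in G F) \<le> (A + 1) * (p n powr (1 - 1 / real r) * real n powr (2 - 1 / real r)))"
    proof (rule aas_if_complement_vanishes)
      show "(\<lambda>n. exp (- real n)) \<longlonglongrightarrow> 0"
        by (intro filterlim_compose[OF exp_at_bot] filterlim_compose[OF filterlim_uminus_at_bot_at_top]
            filterlim_real_sequentially)
      have ev: "\<forall>\<^sub>F n in sequentially. real n powr - ((real r - 1) / (real r * real \<Delta> - 1)) * ln (real n) powr 4 \<le> p n"
        using adm by (simp add: admissible_prob_def)
      show "\<forall>\<^sub>F n in sequentially. measure_pmf.prob (random_graph n (p n))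
         {G. \<not> real (ex_in G F) \<le> (A + 1) * (p n powr (1 - 1 / real r) * real n powr (2 - 1 / real r))} \<le> exp (- real n)"
        using ev eventually_ge_at_top[of 3]
      proof eventually_elim
        case (elim n)
        have p01: "0 \<le> p n" "p n \<le> 1" using adm by (auto simp: admissible_prob_def)
        have "0 < real n powr - ((real r - 1) / (real r * real \<Delta> - 1)) * ln (real n) powr 4"
          using elim(2) by simp
        hence p0: "0 < p n" using elim(1) by linarith
        interpret sc: scale r \<Delta> "real n" "p n"
          using r \<Delta> elim p01 p0 by unfold_locales auto
        let ?x = "(A + 1) * sc.m0"
        let ?bad = "{G. \<not> real (ex_in G F) \<le> ?x}"
        have "measure_pmf.prob (random_graph n (p n)) ?bad
           \<le> measure_pmf.prob (random_graph n (p n)) {G. \<exists>I\<in>\<I>. I \<subseteq> all_edges n \<and> I \<subseteq> edges G \<and> ?x \<le> card I}"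
        proof (rule measure_pmf.finite_measure_mono_AE)
          show "AE G in random_graph n (p n). G \<in> ?bad \<longrightarrow> G \<in> {G. \<exists>I\<in>\<I>. I \<subseteq> all_edges n \<and> I \<subseteq> edges G \<and> ?x \<le> card I}"
          proof (rule AE_pmfI, rule impI)
            fix G assume G: "G \<in> set_pmf (random_graph n (p n))" and bad: "G \<in> ?bad"
            have Gn: "verts G = {..<n}" "edges G \<subseteq> all_edges n" using set_pmf_random_graph[OF G] by auto
            have "0 \<le> ?x" using A sc.m0_pos by simp
            hence "0 < ex_in G F" using bad by auto
            then obtain H where H: "subgraph H G" "free_of F H" "card (edges H) = ex_in G F"
              using ex_in_bounds(2)[of G F] Gn(1) by auto
            have "\<not> embeds (edges H)"
              using embeds_copy[of H] H(1,2) by (auto simp: subgraph_def simple_graph_def)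
            moreover have "edges H \<subseteq> edges G" using H(1) by (simp add: subgraph_def)
            moreover have "?x \<le> real (card (edges H))" using bad H(3) by simp
            ultimately show "G \<in> {G. \<exists>I\<in>\<I>. I \<subseteq> all_edges n \<and> I \<subseteq> edges G \<and> ?x \<le> card I}"
              using Gn(2) unfolding \<I>_def by blast
          qed
        qed auto
        also have "\<dots> \<le> exp (- ?x) * hard_core \<I> (exp 1 * p n) (all_edges n)"
          by (rule prob_large_member[OF p01])
        also have "\<dots> \<le> exp (- ?x) * exp (A * sc.m0)"
        proof (rule mult_left_mono)
          have "hard_core \<I> (exp 1 * p n) {e. e \<subseteq> {..<n} \<and> card e = 2}
            \<le> exp (A * (p n powr (1 - 1 / r) * card {..<n} powr (2 - 1 / r)))"
            using elim p01 p0 down by (intro hc) (auto simp: \<I>_def)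
          thus "hard_core \<I> (exp 1 * p n) (all_edges n) \<le> exp (A * sc.m0)"
            by (simp add: all_edges_def sc.m0_def)
        qed simp
        also have "\<dots> = exp (- sc.m0)" by (simp add: exp_add[symmetric] algebra_simps)
        also have "\<dots> \<le> exp (- real n)" using sc.m0_ge by simp
        finally show ?case by (simp add: sc.m0_def)
      qed
    qed
  qed
qed

section \<open>The lower bound\<close>

definition block :: "nat \<Rightarrow> nat \<Rightarrow> nat set" where "block b i = {u. u div b = i}"

text \<open>The vertices with the same quotient by \<open>b\<close> form a blob; the cell of a pair \<open>e\<close> of blobs consists of the
possible edges between them.\<close>

definition cell :: "nat \<Rightarrow> nat set \<Rightarrow> nat set set" where
  "cell b e = {f. card f = 2 \<and> (\<lambda>u. u div b) ` f = e}"

text \<open>The edges in \<open>A\<close> that meet no other edge in \<open>A\<close>.\<close>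

definition isolated :: "nat set set \<Rightarrow> nat set set" where
  "isolated A = {f\<in>A. \<forall>f'\<in>A. f' \<inter> f \<noteq> {} \<longrightarrow> f' = f}"

lemma block_eq:
  assumes b: "0 < b"
  shows "block b i = {i * b..<i * b + b}"
proof (intro equalityI subsetI)
  fix u assume "u \<in> block b i"
  hence "u = i * b + u mod b" using div_mult_mod_eq[of u b] by (simp add: block_def)
  moreover have "u mod b < b" using b by simp
  ultimately show "u \<in> {i * b..<i * b + b}" by simp
next
  fix u assume "u \<in> {i * b..<i * b + b}"
  hence "u div b = i" by (intro div_nat_eqI) (auto simp: mult.commute)
  thus "u \<in> block b i" by (simp add: block_def)
qed

lemma card_block: "0 < b \<Longrightarrow> card (block b i) = b" "0 < b \<Longrightarrow> finite (block b i)"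
  by (simp_all add: block_eq)

lemma cell_eq:
  assumes "i \<noteq> j"
  shows "cell b {i, j} = (\<lambda>(u, w). {u, w}) ` (block b i \<times> block b j)"
proof (intro equalityI subsetI)
  fix f assume "f \<in> cell b {i, j}"
  hence f: "card f = 2" "(\<lambda>u. u div b) ` f = {i, j}" by (auto simp: cell_def)
  obtain u w where uw: "f = {u, w}" "u \<noteq> w" using f(1) by (auto simp: card_2_iff)
  have "{u div b, w div b} = {i, j}" using f(2) uw by simp
  hence "(u div b = i \<and> w div b = j) \<or> (u div b = j \<and> w div b = i)" by (auto simp: doubleton_eq_iff)
  thus "f \<in> (\<lambda>(u, w). {u, w}) ` (block b i \<times> block b j)"
  proof
    assume "u div b = i \<and> w div b = j"
    hence "(u, w) \<in> block b i \<times> block b j" by (simp add: block_def)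
    thus ?thesis using uw(1) by (intro image_eqI[of _ _ "(u, w)"]) auto
  next
    assume "u div b = j \<and> w div b = i"
    hence "(w, u) \<in> block b i \<times> block b j" by (simp add: block_def)
    thus ?thesis using uw(1) by (intro image_eqI[of _ _ "(w, u)"]) auto
  qed
next
  fix f assume "f \<in> (\<lambda>(u, w). {u, w}) ` (block b i \<times> block b j)"
  then obtain u w where uw: "f = {u, w}" "u div b = i" "w div b = j" by (auto simp: block_def)
  hence "u \<noteq> w" using assms by auto
  thus "f \<in> cell b {i, j}" using uw by (auto simp: cell_def)
qed

lemma cell_pair_inj:
  assumes "i \<noteq> j"
  shows "inj_on (\<lambda>(u, w). {u, w}) (block b i \<times> block b j)"
  using assms by (auto simp: inj_on_def block_def doubleton_eq_iff)

lemma card_cell: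
  assumes "i \<noteq> j" "0 < b"
  shows "card (cell b {i, j}) = b ^ 2" "finite (cell b {i, j})"
  using assms by (simp_all add: cell_eq card_image cell_pair_inj card_cartesian_product card_block power2_eq_square)

lemma cell_subset_all_edges:
  assumes "e \<subseteq> {..<n div b}"
  shows "cell b e \<subseteq> all_edges n"
proof
  fix f assume f: "f \<in> cell b e"
  have "u < n" if "u \<in> f" for u
  proof -
    have "u div b < n div b" using f that assms by (auto simp: cell_def)
    thus ?thesis using div_le_mono[of n u b] by (meson leD leI)
  qed
  thus "f \<in> all_edges n" using f by (auto simp: all_edges_def cell_def)
qed

lemma cells_disjoint: "e \<noteq> e' \<Longrightarrow> cell b e \<inter> cell b e' = {}"
  by (auto simp: cell_def)

lemma card_isolated_le:
  assumes ij: "i \<noteq> j" and b: "0 < b" and A: "A \<subseteq> cell b {i, j}"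
  shows "card (isolated A) \<le> b"
proof -
  define g where "g = (\<lambda>f. SOME u. u \<in> f \<and> u div b = i)"
  have g: "g f \<in> f \<and> g f div b = i" if "f \<in> A" for f
  proof -
    have "f \<in> cell b {i, j}" using that A by blast
    then obtain u w where "f = {u, w}" "u div b = i" using cell_eq[OF ij] by (auto simp: block_def)
    hence "\<exists>u. u \<in> f \<and> u div b = i" by blast
    thus ?thesis unfolding g_def by (rule someI_ex)
  qed
  have "card (isolated A) \<le> card (block b i)"
  proof (rule card_inj_on_le[of g])
    show "inj_on g (isolated A)"
    proof (rule inj_onI)
      fix f f' assume f: "f \<in> isolated A" "f' \<in> isolated A" and eq: "g f = g f'"
      have "g f \<in> f" "g f' \<in> f'" using g f by (auto simp: isolated_def)
      hence "f \<inter> f' \<noteq> {}" using eq by auto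
      thus "f = f'" using f by (auto simp: isolated_def)
    qed
    show "g ` isolated A \<subseteq> block b i" using g by (auto simp: isolated_def block_def)
  qed (rule card_block(2)[OF b])
  thus ?thesis using card_block[OF b] by simp
qed

lemma card_cell_neighbours_le:
  assumes ij: "i \<noteq> j" and b: "0 < b" and f: "f \<in> cell b {i, j}"
  shows "card {f'\<in>cell b {i, j}. f' \<inter> f \<noteq> {} \<and> f' \<noteq> f} \<le> 2 * (b - 1)"
proof -
  obtain u w where uw: "f = {u, w}" "u \<in> block b i" "w \<in> block b j" using f cell_eq[OF ij] by auto
  have ni: "x \<notin> block b j" if "x \<in> block b i" for x using that ij by (auto simp: block_def)
  have "{f'\<in>cell b {i, j}. f' \<inter> f \<noteq> {} \<and> f' \<noteq> f}
    \<subseteq> (\<lambda>w'. {u, w'}) ` (block b j - {w}) \<union> (\<lambda>u'. {u', w}) ` (block b i - {u})"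
  proof
    fix f' assume f': "f' \<in> {f'\<in>cell b {i, j}. f' \<inter> f \<noteq> {} \<and> f' \<noteq> f}"
    then obtain u' w' where uw': "f' = {u', w'}" "u' \<in> block b i" "w' \<in> block b j" using cell_eq[OF ij] by auto
    have "u' \<noteq> w" "w' \<noteq> u" using uw uw' ni by auto
    hence "u' = u \<or> w' = w" using f' uw uw' by auto
    thus "f' \<in> (\<lambda>w'. {u, w'}) ` (block b j - {w}) \<union> (\<lambda>u'. {u', w}) ` (block b i - {u})"
      using uw uw' f' by auto
  qed
  hence "card {f'\<in>cell b {i, j}. f' \<inter> f \<noteq> {} \<and> f' \<noteq> f}
    \<le> card ((\<lambda>w'. {u, w'}) ` (block b j - {w}) \<union> (\<lambda>u'. {u', w}) ` (block b i - {u}))"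
    using card_block(2)[OF b] by (intro card_mono) auto
  also have "\<dots> \<le> card ((\<lambda>w'. {u, w'}) ` (block b j - {w})) + card ((\<lambda>u'. {u', w}) ` (block b i - {u}))"
    by (rule card_Un_le)
  also have "\<dots> \<le> card (block b j - {w}) + card (block b i - {u})"
    using card_block(2)[OF b] by (intro add_mono card_image_le) auto
  also have "\<dots> = 2 * (b - 1)" using uw card_block[OF b] by simp
  finally show ?thesis .
qed

text \<open>In every cell that belongs to an edge of \<open>D\<close>, only the isolated edges are kept.\<close>

definition thinned :: "nat \<Rightarrow> nat set set \<Rightarrow> nat set set \<Rightarrow> nat set set" where
  "thinned b D A = (\<Union>e\<in>D. isolated (A \<inter> cell b e))"

lemma card_thinned:
  assumes D: "finite D" and fin: "\<And>e. e \<in> D \<Longrightarrow> finite (cell b e)"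
  shows "card (thinned b D A) = (\<Sum>e\<in>D. card (isolated (A \<inter> cell b e)))"
  unfolding thinned_def
proof (rule card_UN_disjoint[OF D])
  show "\<forall>e\<in>D. finite (isolated (A \<inter> cell b e))" using fin by (auto simp: isolated_def)
  show "\<forall>e\<in>D. \<forall>e'\<in>D. e \<noteq> e' \<longrightarrow> isolated (A \<inter> cell b e) \<inter> isolated (A \<inter> cell b e') = {}"
  proof (intro ballI impI)
    fix e e' :: "nat set" assume "e \<noteq> e'"
    moreover have "isolated (A \<inter> X) \<subseteq> X" for X by (auto simp: isolated_def)
    ultimately show "isolated (A \<inter> cell b e) \<inter> isolated (A \<inter> cell b e') = {}"
      using cells_disjoint[of e e' b] by fast
  qed
qed

lemma simple_complete_bipartite: "simple_graph (complete_bipartite r t)"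
  by (auto simp: simple_graph_def complete_bipartite_def card_2_iff)

text \<open>A vertex has at most one neighbour in each blob.  Therefore two vertices of a copy of \<open>K\<^bsub>r,t\<^esub>\<close> on the
same side lie in different blobs, since they have a common neighbour, and the copy projects to a copy in \<open>D\<close>.\<close>

lemma thinned_free:
  assumes r: "1 \<le> r" and t: "1 \<le> t"
    and D: "\<And>e. e \<in> D \<Longrightarrow> e \<subseteq> {..<m} \<and> card e = 2"
    and free: "free_of (complete_bipartite r t) ({..<m}, D)"
  shows "free_of (complete_bipartite r t) (U, thinned b D A)"
proof
  assume "contains_copy (U, thinned b D A) (complete_bipartite r t)"
  then obtain h where h: "inj_on h (verts (complete_bipartite r t))"
    "\<And>e. e \<in> edges (complete_bipartite r t) \<Longrightarrow> h ` e \<in> thinned b D A"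
    by (rule contains_copyE) simp
  let ?q = "\<lambda>x. h x div b"
  have adj: "{h (Inl i), h (Inr j)} \<in> thinned b D A" if "i < r" "j < t" for i j
    using h(2)[of "{Inl i, Inr j}"] that by (auto simp: complete_bipartite_def)
  have D_adj: "{?q (Inl i), ?q (Inr j)} \<in> D" "?q (Inl i) \<noteq> ?q (Inr j)" if ij: "i < r" "j < t" for i j
  proof -
    obtain e where e: "e \<in> D" "{h (Inl i), h (Inr j)} \<in> cell b e"
      using adj[OF ij] by (auto simp: thinned_def isolated_def)
    have "e = {?q (Inl i), ?q (Inr j)}" using e(2) by (auto simp: cell_def)
    thus "{?q (Inl i), ?q (Inr j)} \<in> D" "?q (Inl i) \<noteq> ?q (Inr j)"
      using e(1) D[OF e(1)] by auto
  qed
  have same: "f = f'" if ff: "f \<in> thinned b D A" "f' \<in> thinned b D A" "(\<lambda>u. u div b) ` f = (\<lambda>u. u div b) ` f'" "f \<inter> f' \<noteq> {}" for f f'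
  proof -
    obtain e e' where e: "f \<in> isolated (A \<inter> cell b e)" "f' \<in> isolated (A \<inter> cell b e')"
      using ff(1,2) by (auto simp: thinned_def)
    have "f \<in> A \<inter> cell b e" "f' \<in> A \<inter> cell b e'" using e by (simp_all add: isolated_def)
    hence c: "(\<lambda>u. u div b) ` f = e" "(\<lambda>u. u div b) ` f' = e'" "f' \<in> A \<inter> cell b e'"
      by (simp_all add: cell_def)
    hence f': "f' \<in> A \<inter> cell b e" by (simp only: ff(3))
    have "\<forall>g\<in>A \<inter> cell b e. g \<inter> f \<noteq> {} \<longrightarrow> g = f" using e(1) unfolding isolated_def mem_Collect_eq by (rule conjunct2)
    from bspec[OF this f'] have "f' \<inter> f \<noteq> {} \<longrightarrow> f' = f" .
    moreover have "f' \<inter> f \<noteq> {}" by (subst Int_commute) (rule ff(4))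
    ultimately show ?thesis by simp
  qed
  have "contains_copy ({..<m}, D) (complete_bipartite r t)"
  proof (rule contains_copyI[where f = ?q, OF simple_complete_bipartite])
    have injl: "i = i'" if i: "i < r" "i' < r" and eq: "?q (Inl i) = ?q (Inl i')" for i i'
    proof -
      have "{h (Inl i), h (Inr 0)} = {h (Inl i'), h (Inr 0)}"
        by (rule same[OF adj[of i 0] adj[of i' 0]]) (use i t eq in simp_all)
      hence "h (Inl i) = h (Inl i')" by (auto simp: doubleton_eq_iff)
      thus ?thesis using h(1) i by (auto simp: inj_on_def complete_bipartite_def)
    qed
    have injr: "j = j'" if j: "j < t" "j' < t" and eq: "?q (Inr j) = ?q (Inr j')" for j j'
    proof -
      have "{h (Inl 0), h (Inr j)} = {h (Inl 0), h (Inr j')}"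
        by (rule same[OF adj[of 0 j] adj[of 0 j']]) (use j r eq in simp_all)
      hence "h (Inr j) = h (Inr j')" by (auto simp: doubleton_eq_iff)
      thus ?thesis using h(1) j by (auto simp: inj_on_def complete_bipartite_def)
    qed
    show "inj_on ?q (verts (complete_bipartite r t))"
    proof (rule inj_onI)
      fix x y assume x: "x \<in> verts (complete_bipartite r t)" and y: "y \<in> verts (complete_bipartite r t)"
        and eq: "?q x = ?q y"
      show "x = y"
      proof (cases x; cases y)
        fix i i' assume "x = Inl i" "y = Inl i'"
        thus ?thesis using injl[of i i'] x y eq by (auto simp: complete_bipartite_def)
      next
        fix i j assume "x = Inl i" "y = Inr j"
        thus ?thesis using D_adj(2)[of i j] x y eq by (auto simp: complete_bipartite_def)
      next
        fix i j assume "x = Inr j" "y = Inl i"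
        thus ?thesis using D_adj(2)[of i j] x y eq by (auto simp: complete_bipartite_def)
      next
        fix j j' assume "x = Inr j" "y = Inr j'"
        thus ?thesis using injr[of j j'] x y eq by (auto simp: complete_bipartite_def)
      qed
    qed
    show "?q ` e \<in> edges ({..<m}, D)" if e: "e \<in> edges (complete_bipartite r t)" for e
    proof -
      obtain i j where "e = {Inl i, Inr j}" "i < r" "j < t" using e by (auto simp: complete_bipartite_def)
      thus ?thesis using D_adj(1) by simp
    qed
    show "?q ` verts (complete_bipartite r t) \<subseteq> verts ({..<m}, D)"
    proof (rule image_subsetI)
      fix x assume x: "x \<in> verts (complete_bipartite r t)"
      show "?q x \<in> verts ({..<m}, D)"
      proof (cases x)
        case (Inl i)
        hence "{?q (Inl i), ?q (Inr 0)} \<in> D" using x t by (intro D_adj) (auto simp: complete_bipartite_def)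
        thus ?thesis using D Inl by fastforce
      next
        case (Inr j)
        hence "{?q (Inl 0), ?q (Inr j)} \<in> D" using x r by (intro D_adj) (auto simp: complete_bipartite_def)
        thus ?thesis using D Inr by fastforce
      qed
    qed
  qed
  thus False using free by blast
qed

text \<open>For \<open>t = 0\<close> every graph with at least \<open>r\<close> vertices contains \<open>K\<^bsub>r,t\<^esub>\<close>, so that the extremal number is 0.\<close>

lemma extremal_graph_exists:
  assumes pos: "0 < ex_number m (complete_bipartite r t)" and m: "r \<le> m"
  shows "1 \<le> t" and "\<exists>D. (\<forall>e\<in>D. e \<subseteq> {..<m} \<and> card e = 2) \<and> free_of (complete_bipartite r t) ({..<m}, D) \<and>
     card D = ex_number m (complete_bipartite r t)"
proof -
  let ?K = "complete_bipartite r t"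
  let ?A = "{card (edges H) | H :: nat graph. simple_graph H \<and> card (verts H) = m \<and> free_of ?K H}"
  have "card (edges H) \<le> 2 ^ m" if H: "simple_graph H" "card (verts H) = m" for H :: "nat graph"
  proof -
    have "card (edges H) \<le> card (Pow (verts H))"
      using H by (intro card_mono) (auto simp: simple_graph_def)
    thus ?thesis using H by (simp add: card_Pow simple_graph_def)
  qed
  hence "?A \<subseteq> {..2 ^ m}" by auto
  hence fin: "finite ?A" using finite_subset by blast
  have "?A \<noteq> {}"
  proof
    assume "?A = {}"
    hence "ex_number m ?K = Sup {}" unfolding ex_number_def by (simp only:)
    thus False using pos by (simp add: Sup_nat_def)
  qed
  moreover have "Sup A \<in> A" if "finite A" "A \<noteq> {}" for A :: "nat set"
    using that by (simp add: Sup_nat_def)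
  ultimately have "Sup ?A \<in> ?A" using fin by blast
  then obtain H :: "nat graph" where H: "simple_graph H" "card (verts H) = m" "free_of ?K H"
    "card (edges H) = ex_number m ?K" unfolding ex_number_def by force
  have finH: "finite (verts H)" using H(1) by (simp add: simple_graph_def)
  show "1 \<le> t"
  proof (rule ccontr)
    assume "\<not> 1 \<le> t"
    hence t0: "t = 0" by simp
    obtain g where g: "inj_on g {..<r}" "g ` {..<r} \<subseteq> verts H"
      using card_le_inj[of "{..<r}" "verts H"] finH H(2) m by auto
    have "contains_copy H ?K"
    proof (rule contains_copyI[where f = "\<lambda>x. g (projl x)", OF simple_complete_bipartite])
      show "inj_on (\<lambda>x. g (projl x)) (verts ?K)" using g(1) t0 by (auto simp: inj_on_def complete_bipartite_def)
      show "(\<lambda>x. g (projl x)) ` verts ?K \<subseteq> verts H" using g(2) t0 by (auto simp: complete_bipartite_def)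
    qed (use t0 in \<open>simp add: complete_bipartite_def\<close>)
    thus False using H(3) by blast
  qed
  obtain \<phi> where \<phi>: "bij_betw \<phi> (verts H) {..<m}"
    using finH H(2) by (metis card_lessThan finite_lessThan finite_same_card_bij)
  have inj: "inj_on \<phi> (verts H)" using \<phi> by (rule bij_betw_imp_inj_on)
  let ?\<psi> = "inv_into (verts H) \<phi>"
  have sub: "e \<subseteq> verts H" "card e = 2" if "e \<in> edges H" for e using H(1) that by (auto simp: simple_graph_def)
  let ?D = "(`) \<phi> ` edges H"
  have "e \<subseteq> {..<m} \<and> card e = 2" if e: "e \<in> ?D" for e
  proof -
    obtain e' where e': "e' \<in> edges H" "e = \<phi> ` e'" using e by auto
    have "\<phi> ` e' \<subseteq> {..<m}" using sub(1)[OF e'(1)] \<phi> by (auto simp: bij_betw_def)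
    moreover have "card (\<phi> ` e') = 2"
      using card_image[OF inj_on_subset[OF inj sub(1)[OF e'(1)]]] sub(2)[OF e'(1)] by simp
    ultimately show ?thesis using e'(2) by simp
  qed
  moreover have "free_of ?K ({..<m}, ?D)"
  proof
    assume c: "contains_copy ({..<m}, ?D) ?K"
    have "contains_copy H ({..<m}, ?D)"
    proof (rule contains_copyI[where f = ?\<psi>])
      show "simple_graph ({..<m}, ?D)" using \<open>\<And>e. e \<in> ?D \<Longrightarrow> e \<subseteq> {..<m} \<and> card e = 2\<close>
        unfolding simple_graph_def by auto
      have b: "bij_betw ?\<psi> {..<m} (verts H)" using \<phi> by (rule bij_betw_inv_into)
      show "inj_on ?\<psi> (verts ({..<m}, ?D))" "?\<psi> ` verts ({..<m}, ?D) \<subseteq> verts H"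
        using b by (auto simp: bij_betw_def)
      fix e assume "e \<in> edges ({..<m}, ?D)"
      then obtain e' where e': "e' \<in> edges H" "e = \<phi> ` e'" by auto
      thus "?\<psi> ` e \<in> edges H" using inv_into_image_cancel[OF inj sub(1)[OF e'(1)]] by simp
    qed
    hence "contains_copy H ?K" using contains_copy_trans[OF simple_complete_bipartite _ c] by blast
    thus False using H(3) by blast
  qed
  moreover have "card ?D = ex_number m ?K"
  proof -
    have "inj_on ((`) \<phi>) (edges H)"
      using sub by (intro inj_on_subset[OF inj_on_image_Pow[OF inj]]) auto
    thus ?thesis using H(4) by (simp add: card_image)
  qed
  ultimately show "\<exists>D. (\<forall>e\<in>D. e \<subseteq> {..<m} \<and> card e = 2) \<and> free_of ?K ({..<m}, D) \<and> card D = ex_number m ?K"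
    by blast
qed

text \<open>At most \<open>2 (b - 1)\<close> other edges of the cell meet \<open>f\<close>, and all of them are absent with
probability at least \<open>1 - 2 (b - 1) p \<ge> 1/2\<close>.\<close>

lemma isolated_prob:
  assumes ij: "i \<noteq> j" and b: "0 < b" and sub: "cell b {i, j} \<subseteq> all_edges n" and f: "f \<in> cell b {i, j}"
    and p: "0 \<le> p" "p \<le> 1" "(real b - 1) * p \<le> 1 / 4"
  shows "p / 2 \<le> measure_pmf.prob (Pi_pmf (all_edges n) False (\<lambda>_. bernoulli_pmf p))
     {\<omega>. f \<in> isolated {f\<in>cell b {i, j}. \<omega> f}}"
proof -
  let ?P = "Pi_pmf (all_edges n) False (\<lambda>_. bernoulli_pmf p)"
  let ?O = "{f'\<in>cell b {i, j}. f' \<inter> f \<noteq> {} \<and> f' \<noteq> f}"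
  let ?B = "\<lambda>g. if g = f then {True} else if g \<in> ?O then {False} else (UNIV :: bool set)"
  have fE: "f \<in> all_edges n" "?O \<subseteq> all_edges n" using f sub by auto
  have fO: "finite ?O" using card_cell(2)[OF ij b] by simp
  have ne: "f \<inter> f \<noteq> {}" using f by (auto simp: cell_def)
  have eq: "{\<omega>. f \<in> isolated {f\<in>cell b {i, j}. \<omega> f}} = Pi (all_edges n) ?B"
  proof (intro equalityI subsetI)
    fix \<omega> assume "\<omega> \<in> {\<omega>. f \<in> isolated {f\<in>cell b {i, j}. \<omega> f}}"
    hence \<omega>: "\<omega> f" "\<forall>g. g \<in> cell b {i, j} \<and> \<omega> g \<longrightarrow> g \<inter> f \<noteq> {} \<longrightarrow> g = f"
      by (simp_all add: isolated_def)
    show "\<omega> \<in> Pi (all_edges n) ?B"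
    proof (rule Pi_I)
      fix g
      show "\<omega> g \<in> ?B g" using \<omega> by auto
    qed
  next
    fix \<omega> assume \<omega>: "\<omega> \<in> Pi (all_edges n) ?B"
    have "\<omega> f" using Pi_mem[OF \<omega> fE(1)] by simp
    moreover have "g = f" if g: "g \<in> cell b {i, j}" "\<omega> g" "g \<inter> f \<noteq> {}" for g
    proof (rule ccontr)
      assume "g \<noteq> f"
      hence "g \<in> ?O" using g by simp
      hence "\<omega> g \<in> {False}" using Pi_mem[OF \<omega>, of g] fE(2) \<open>g \<noteq> f\<close> by auto
      thus False using g(2) by simp
    qed
    ultimately show "\<omega> \<in> {\<omega>. f \<in> isolated {f\<in>cell b {i, j}. \<omega> f}}"
      using f by (simp add: isolated_def)
  qed
  have "measure_pmf.prob ?P (Pi (all_edges n) ?B) = (\<Prod>g\<in>all_edges n. measure_pmf.prob (bernoulli_pmf p) (?B g))"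
    by (rule measure_Pi_pmf_Pi[OF finite_all_edges])
  also have "\<dots> = (\<Prod>g\<in>all_edges n. if g = f then p else if g \<in> ?O then 1 - p else 1)"
    using p by (intro prod.cong refl) (simp add: measure_pmf_single)
  also have "\<dots> = (\<Prod>g\<in>insert f ?O. if g = f then p else if g \<in> ?O then 1 - p else 1)"
    using fE finite_all_edges[of n] by (intro prod.mono_neutral_right) auto
  also have "\<dots> = p * (\<Prod>g\<in>?O. 1 - p)"
    using fO by (subst prod.insert) (auto intro!: prod.cong)
  also have "\<dots> = p * (1 - p) ^ card ?O" by simp
  finally have pr: "measure_pmf.prob ?P {\<omega>. f \<in> isolated {f\<in>cell b {i, j}. \<omega> f}} = p * (1 - p) ^ card ?O"
    unfolding eq .
  have "1 / 2 \<le> 1 - real (card ?O) * p"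
  proof -
    have "real (card ?O) \<le> 2 * (real b - 1)"
    proof -
      have "real (card ?O) \<le> real (2 * (b - 1))"
        using card_cell_neighbours_le[OF ij b f] by (rule of_nat_mono)
      also have "\<dots> = 2 * (real b - 1)" using b by (simp add: of_nat_diff)
      finally show ?thesis .
    qed
    hence "real (card ?O) * p \<le> 2 * (real b - 1) * p" using p by (intro mult_right_mono)
    also have "\<dots> = 2 * ((real b - 1) * p)" by simp
    finally show ?thesis using p(3) by linarith
  qed
  also have "\<dots> \<le> (1 - p) ^ card ?O"
    using Bernoulli_inequality[of "- p" "card ?O"] p by simp
  finally have "p * (1 / 2) \<le> p * (1 - p) ^ card ?O" using p by (intro mult_left_mono)
  thus ?thesis using pr by simp
qed

text \<open>The cells are disjoint, so the numbers of isolated edges in them are independent; each lies between 0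
and \<open>b\<close> and has expectation at least \<open>b^2 p / 2 \<ge> b / 8\<close>.  Hoeffding's inequality is applied with
deviation equal to half of the expectation.\<close>

lemma thinned_concentration:
  assumes D: "\<And>e. e \<in> D \<Longrightarrow> e \<subseteq> {..<n div b} \<and> card e = 2" and D_ne: "D \<noteq> {}" and b: "0 < b"
    and p: "0 < p" "p \<le> 1" "(real b - 1) * p \<le> 1 / 4" "1 / 4 \<le> real b * p"
  shows "measure_pmf.prob (Pi_pmf (all_edges n) False (\<lambda>_. bernoulli_pmf p))
      {\<omega>. real (card (thinned b D {f\<in>all_edges n. \<omega> f})) < real (card D) * b / 16} \<le> exp (- real (card D) / 128)"
proof -
  let ?P = "Pi_pmf (all_edges n) False (\<lambda>_. bernoulli_pmf p)"
  have finD: "finite D" by (rule finite_subset[of _ "Pow {..<n div b}"]) (use D in auto)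
  have cD: "0 < card D" using finD D_ne by (simp add: card_gt_0_iff)
  have pair: "\<exists>i j. e = {i, j} \<and> i \<noteq> j" if "e \<in> D" for e using D[OF that] by (auto simp: card_2_iff)
  have cs: "cell b e \<subseteq> all_edges n" if "e \<in> D" for e using D[OF that] by (intro cell_subset_all_edges) auto
  have fc: "finite (cell b e)" if "e \<in> D" for e using pair[OF that] card_cell(2)[OF _ b] by auto
  define Y where "Y = (\<lambda>e (\<omega> :: nat set \<Rightarrow> bool). real (card (isolated {f\<in>cell b e. \<omega> f})))"
  have Y_sum: "real (card (thinned b D {f\<in>all_edges n. \<omega> f})) = (\<Sum>e\<in>D. Y e \<omega>)" for \<omega>
  proof -
    have "{f\<in>all_edges n. \<omega> f} \<inter> cell b e = {f\<in>cell b e. \<omega> f}" if "e \<in> D" for e using cs[OF that] by auto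
    thus ?thesis using card_thinned[OF finD fc] by (simp add: Y_def)
  qed
  have Y_restrict: "Y e (restrict \<omega> (cell b e)) = Y e \<omega>" for e \<omega>
  proof -
    have "{f\<in>cell b e. restrict \<omega> (cell b e) f} = {f\<in>cell b e. \<omega> f}" by auto
    thus ?thesis by (simp add: Y_def)
  qed
  have Y_ind: "Y e \<omega> = (\<Sum>f\<in>cell b e. indicator {\<omega>. f \<in> isolated {f\<in>cell b e. \<omega> f}} \<omega>)" if "e \<in> D" for e \<omega>
  proof -
    have "isolated {f\<in>cell b e. \<omega> f} = {f\<in>cell b e. f \<in> isolated {f\<in>cell b e. \<omega> f}}" by (auto simp: isolated_def)
    hence "Y e \<omega> = real (card {f\<in>cell b e. f \<in> isolated {f\<in>cell b e. \<omega> f}})" unfolding Y_def by (rule arg_cong)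
    also have "\<dots> = (\<Sum>f\<in>cell b e. if f \<in> isolated {f\<in>cell b e. \<omega> f} then 1 else 0)"
      using fc[OF that] by (simp add: sum.inter_filter[symmetric])
    finally show ?thesis by (simp add: indicator_def of_bool_def)
  qed
  have Y_bounds: "0 \<le> Y e \<omega> \<and> Y e \<omega> \<le> b" if "e \<in> D" for e \<omega>
    using pair[OF that] card_isolated_le[OF _ b, of _ _ "{f\<in>cell b e. \<omega> f}"] by (auto simp: Y_def)
  have EY: "b / 8 \<le> measure_pmf.expectation ?P (Y e)" if e: "e \<in> D" for e
  proof -
    obtain i j where ij: "e = {i, j}" "i \<noteq> j" using pair[OF e] by blast
    have "b / 8 = (1 / 4) * b / 2" by simp
    also have "\<dots> \<le> (b * p) * b / 2" using p b by (intro divide_right_mono mult_right_mono) auto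
    also have "\<dots> = (\<Sum>f\<in>cell b e. p / 2)"
      using card_cell(1)[OF ij(2) b] ij(1) by (simp add: power2_eq_square)
    also have "\<dots> \<le> (\<Sum>f\<in>cell b e. measure_pmf.prob ?P {\<omega>. f \<in> isolated {f\<in>cell b e. \<omega> f}})"
      using isolated_prob[OF ij(2) b] cs[OF e] ij(1) p by (intro sum_mono) auto
    also have "\<dots> = measure_pmf.expectation ?P (\<lambda>\<omega>. \<Sum>f\<in>cell b e. indicator {\<omega>. f \<in> isolated {f\<in>cell b e. \<omega> f}} \<omega>)"
      by (subst Bochner_Integration.integral_sum)
        (auto intro!: measure_pmf.integrable_const_bound[where B = 1])
    also have "\<dots> = measure_pmf.expectation ?P (Y e)"
      by (intro Bochner_Integration.integral_cong refl) (rule Y_ind[OF e, symmetric])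
    finally show ?thesis .
  qed
  have meas: "Y e \<in> borel_measurable (Pi\<^sub>M (cell b e) (\<lambda>_. count_space UNIV))" if e: "e \<in> D" for e
  proof -
    have fin: "finite (cell b e)" by (rule fc[OF e])
    have comp: "Measurable.pred (Pi\<^sub>M (cell b e) (\<lambda>_. count_space UNIV)) (\<lambda>\<omega>. \<omega> f)" if "f \<in> cell b e" for f
      using measurable_component_singleton[OF that, of "\<lambda>_. count_space (UNIV :: bool set)"] by simp
    have "Measurable.pred (Pi\<^sub>M (cell b e) (\<lambda>_. count_space UNIV)) (\<lambda>\<omega>. \<omega> f \<and> (\<forall>f'\<in>cell b e. \<omega> f' \<longrightarrow> f' \<inter> f \<noteq> {} \<longrightarrow> f' = f))"
      if f: "f \<in> cell b e" for f
      using comp f fin by (intro pred_intros_logic pred_intros_finite) auto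
    hence "(\<lambda>\<omega>. \<Sum>f\<in>cell b e. if \<omega> f \<and> (\<forall>f'\<in>cell b e. \<omega> f' \<longrightarrow> f' \<inter> f \<noteq> {} \<longrightarrow> f' = f) then 1 else (0::real))
       \<in> borel_measurable (Pi\<^sub>M (cell b e) (\<lambda>_. count_space UNIV))"
      by (intro borel_measurable_sum measurable_If) auto
    moreover have "Y e = (\<lambda>\<omega>. \<Sum>f\<in>cell b e. if \<omega> f \<and> (\<forall>f'\<in>cell b e. \<omega> f' \<longrightarrow> f' \<inter> f \<noteq> {} \<longrightarrow> f' = f) then 1 else (0::real))"
    proof
      fix \<omega>
      show "Y e \<omega> = (\<Sum>f\<in>cell b e. if \<omega> f \<and> (\<forall>f'\<in>cell b e. \<omega> f' \<longrightarrow> f' \<inter> f \<noteq> {} \<longrightarrow> f' = f) then 1 else (0::real))"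
        unfolding Y_ind[OF e] by (intro sum.cong refl) (auto simp: indicator_def isolated_def)
    qed
    ultimately show ?thesis by simp
  qed
  have "prob_space.indep_vars ?P (\<lambda>_. borel) (\<lambda>e \<omega>. Y e (restrict (\<lambda>f. \<omega> f) (cell b e))) D"
  proof (rule prob_space.indep_vars_compose2[OF measure_pmf.prob_space_axioms,
        where X = "\<lambda>e \<omega>. restrict (\<lambda>f. \<omega> f) (cell b e)" and Y = Y
          and M' = "\<lambda>e. Pi\<^sub>M (cell b e) (\<lambda>_. count_space UNIV)"])
    show "prob_space.indep_vars ?P (\<lambda>e. Pi\<^sub>M (cell b e) (\<lambda>_. count_space UNIV)) (\<lambda>e \<omega>. restrict (\<lambda>f. \<omega> f) (cell b e)) D"
    proof (rule prob_space.indep_vars_restrict[OF measure_pmf.prob_space_axioms indep_vars_Pi_pmf[OF finite_all_edges]])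
      show "disjoint_family_on (cell b) D" using cells_disjoint by (auto simp: disjoint_family_on_def)
    qed (rule cs)
  qed (rule meas)
  hence indep: "prob_space.indep_vars ?P (\<lambda>_. borel) Y D" by (simp only: Y_restrict)
  define \<mu> where "\<mu> = (\<Sum>e\<in>D. measure_pmf.expectation ?P (Y e))"
  interpret hoeff: Hoeffding_ineq "measure_pmf ?P" D Y "\<lambda>_. 0" "\<lambda>_. real b" \<mu>
  proof unfold_locales
    show "finite D" by (rule finD)
    show "prob_space.indep_vars ?P (\<lambda>_. borel) Y D" by (rule indep)
    show "AE \<omega> in ?P. Y e \<omega> \<in> {0..real b}" if "e \<in> D" for e using Y_bounds[OF that] by (intro AE_pmfI) auto
    show "\<mu> \<equiv> \<Sum>i\<in>D. measure_pmf.expectation ?P (Y i)" by (simp add: \<mu>_def)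
  qed
  have \<mu>: "card D * (b / 8) \<le> \<mu>" using sum_mono[of D "\<lambda>_. b / 8"] EY by (simp add: \<mu>_def)
  have \<mu>0: "0 \<le> \<mu>" using \<mu> by (rule order.trans[rotated]) simp
  have "measure_pmf.prob ?P {\<omega>. real (card (thinned b D {f\<in>all_edges n. \<omega> f})) < real (card D) * b / 16}
     \<le> measure_pmf.prob ?P {\<omega>\<in>space (measure_pmf ?P). (\<Sum>e\<in>D. Y e \<omega>) \<le> \<mu> - \<mu> / 2}"
    using \<mu> by (intro measure_pmf.finite_measure_mono) (auto simp: Y_sum)
  also have "\<dots> \<le> exp (- 2 * (\<mu> / 2)\<^sup>2 / (\<Sum>e\<in>D. (real b - 0)\<^sup>2))"
    using \<mu>0 cD b by (intro hoeff.Hoeffding_ineq_le) auto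
  also have "\<dots> \<le> exp (- real (card D) / 128)"
  proof -
    have "(card D * (b / 8))\<^sup>2 \<le> \<mu>\<^sup>2" using \<mu> by (intro power_mono) auto
    hence "real (card D) / 128 * (card D * (real b)\<^sup>2) \<le> 2 * (\<mu> / 2)\<^sup>2"
      by (simp add: power2_eq_square mult_ac)
    hence "real (card D) / 128 \<le> 2 * (\<mu> / 2)\<^sup>2 / (card D * (real b)\<^sup>2)"
      using cD b by (subst pos_le_divide_eq) auto
    thus ?thesis by simp
  qed
  finally show ?thesis .
qed

text \<open>Blobs of size \<open>b \<approx> 1 / (4 p)\<close> satisfy both conditions of \<open>thinned_concentration\<close>, and leave
\<open>m \<ge> n p / 4\<close> blobs for an extremal graph.  The condition on \<open>p\<close> enters through \<open>n p \<ge> ln n\<close>, which makes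
the number of edges of the extremal graph, and with it the exponent in the error probability, tend to infinity.\<close>

theorem lower_bound:
  fixes F :: "'a graph" and r \<Delta> t :: nat
  assumes r: "r \<ge> 2" and \<Delta>: "1 \<le> \<Delta>"
    and K: "contains_copy F (complete_bipartite r t)"
    and ex: "(\<lambda>n. real (ex_number n (complete_bipartite r t))) \<in> \<Theta>(\<lambda>n. real n powr (2 - 1 / real r))"
  shows "\<exists>k>0. \<forall>p. admissible_prob r \<Delta> 4 p \<longrightarrow>
       aas (\<lambda>n. random_graph n (p n))
         (\<lambda>n G. k * (p n powr (1 - 1 / real r) * real n powr (2 - 1 / real r)) \<le> real (ex_in G F))"
proof -
  let ?K = "complete_bipartite r t"
  obtain c where c: "0 < c" and evc: "\<forall>\<^sub>F n in sequentially. c * real n powr (2 - 1 / real r) \<le> real (ex_number n ?K)"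
  proof -
    have "(\<lambda>n. real (ex_number n ?K)) \<in> \<Omega>(\<lambda>n. real n powr (2 - 1 / real r))" using ex by (rule bigthetaD2)
    then obtain c where "0 < c" "\<forall>\<^sub>F n in sequentially. c * norm (real n powr (2 - 1 / real r)) \<le> norm (real (ex_number n ?K))"
      by (rule landau_omega.bigE)
    thus ?thesis using that by simp
  qed
  then obtain N0 where N0: "\<And>m. N0 \<le> m \<Longrightarrow> c * real m powr (2 - 1 / real r) \<le> real (ex_number m ?K)"
    by (auto simp: eventually_at_top_linorder)
  have i12: "1 \<le> 2 - 1 / real r" "2 - 1 / real r \<le> 2" using r by auto
  show ?thesis
  proof (intro exI[of _ "c / 1024"] conjI allI impI)
    show "0 < c / 1024" using c by simp
    fix p assume adm: "admissible_prob r \<Delta> 4 p"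
    show "aas (\<lambda>n. random_graph n (p n))
         (\<lambda>n G. c / 1024 * (p n powr (1 - 1 / real r) * real n powr (2 - 1 / real r)) \<le> real (ex_in G F))"
    proof (rule aas_if_complement_vanishes)
      have ev: "\<forall>\<^sub>F n in sequentially. real n powr - ((real r - 1) / (real r * real \<Delta> - 1)) * ln (real n) powr 4 \<le> p n"
        using adm by (simp add: admissible_prob_def)
      \<comment> \<open>For \<open>n p \<ge> M\<close> the number of blobs is large enough for the estimate of the extremal number.\<close>
      define M where "M = 4 * real (max (max N0 r) 1) + 4"
      have "filterlim (\<lambda>n. ln (real n)) at_top sequentially"
        by (intro filterlim_compose[OF ln_at_top] filterlim_real_sequentially)
      hence evM: "\<forall>\<^sub>F n in sequentially. M \<le> ln (real n)" by (simp add: filterlim_at_top)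
      show "(\<lambda>n. exp (- (c / 512) * ln (real n))) \<longlonglongrightarrow> 0"
      proof -
        have "filterlim (\<lambda>n. - (c / 512) * ln (real n)) at_bot sequentially"
          using c by (intro filterlim_tendsto_neg_mult_at_bot[OF tendsto_const]
              filterlim_compose[OF ln_at_top] filterlim_real_sequentially) auto
        thus ?thesis by (rule filterlim_compose[OF exp_at_bot])
      qed
      show "\<forall>\<^sub>F n in sequentially. measure_pmf.prob (random_graph n (p n))
         {G. \<not> c / 1024 * (p n powr (1 - 1 / real r) * real n powr (2 - 1 / real r)) \<le> real (ex_in G F)}
         \<le> exp (- (c / 512) * ln (real n))"
        using ev evM eventually_ge_at_top[of 3]
      proof eventually_elim
        case (elim n)
        have p01: "0 \<le> p n" "p n \<le> 1" using adm by (auto simp: admissible_prob_def)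
        have "0 < real n powr - ((real r - 1) / (real r * real \<Delta> - 1)) * ln (real n) powr 4"
          using elim(3) by simp
        hence p0: "0 < p n" using elim(1) by linarith
        interpret sc: scale r \<Delta> "real n" "p n"
          using r \<Delta> elim p01 p0 by unfold_locales auto
        let ?p = "p n"
        \<comment> \<open>Rounding up gives \<open>b p \<ge> 1/4\<close> and at the same time \<open>(b - 1) p \<le> 1/4\<close>.\<close>
        define b where "b = nat \<lceil>1 / (4 * ?p)\<rceil>"
        define m where "m = n div b"
        have q0: "0 < 1 / (4 * ?p)" using p0 by simp
        have b1: "1 / (4 * ?p) \<le> real b" unfolding b_def using q0 by linarith
        have b2: "real b \<le> 1 / (4 * ?p) + 1" unfolding b_def using q0 by linarith
        have b0: "0 < b" using b1 q0 by (metis less_le_trans of_nat_0_less_iff)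
        have pb1: "1 / 4 \<le> real b * ?p"
        proof -
          have "1 / (4 * ?p) * ?p \<le> real b * ?p" using b1 p0 by (intro mult_right_mono) auto
          thus ?thesis using p0 by simp
        qed
        have pb2: "(real b - 1) * ?p \<le> 1 / 4"
        proof -
          have "(real b - 1) * ?p \<le> 1 / (4 * ?p) * ?p" using b2 p0 by (intro mult_right_mono) auto
          thus ?thesis using p0 by simp
        qed
        have pb3: "real b * ?p \<le> 2" using pb2 p01 by (simp add: algebra_simps)
        have np: "M \<le> n * ?p" "ln n \<le> n * ?p" using sc.np_ge_ln elim(2) by auto
        have m1: "n * ?p / 4 \<le> m"
        proof -
          have "real n = real (b * m + n mod b)" unfolding m_def by simp
          also have "\<dots> \<le> b * m + b" using b0 by (simp add: less_imp_le)
          finally have "real n * ?p \<le> (b * m + b) * ?p" using p0 by (intro mult_right_mono) auto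
          also have "\<dots> = (b * ?p) * (m + 1)" by (simp add: algebra_simps)
          also have "\<dots> \<le> 2 * real (m + 1)" using pb3 by (intro mult_right_mono) auto
          finally have "real n * ?p \<le> 2 * real (m + 1)" by simp
          moreover have "4 \<le> n * ?p" using np(1) by (simp add: M_def)
          ultimately show ?thesis by simp
        qed
        have "real (max (max N0 r) 1) \<le> real m" using m1 np(1) unfolding M_def by linarith
        hence "max (max N0 r) 1 \<le> m" by (simp only: of_nat_le_iff)
        hence mN: "N0 \<le> m" "r \<le> m" "1 \<le> m" by simp_all
        have exm: "c * real m powr (2 - 1 / real r) \<le> real (ex_number m ?K)" by (rule N0[OF mN(1)])
        moreover have "0 < c * real m powr (2 - 1 / real r)" using c mN by simp
        ultimately have expos: "0 < ex_number m ?K" by (metis less_le_trans of_nat_0_less_iff)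
        obtain D where D: "\<And>e. e \<in> D \<Longrightarrow> e \<subseteq> {..<m} \<and> card e = 2" and Dfree: "free_of ?K ({..<m}, D)"
          and cD: "card D = ex_number m ?K"
          using extremal_graph_exists(2)[OF expos mN(2)] by auto
        have t1: "1 \<le> t" by (rule extremal_graph_exists(1)[OF expos mN(2)])
        have Dne: "D \<noteq> {}" using cD expos by auto
        let ?P = "Pi_pmf (all_edges n) False (\<lambda>_. bernoulli_pmf ?p)"
        let ?x = "real (card D) * b / 16"
        \<comment> \<open>The constant collects \<open>(1/4)^(2-1/r) \<ge> 1/16\<close>, \<open>b p \<ge> 1/4\<close> and the loss \<open>1/16\<close> in the concentration.\<close>
        have x_ge: "c / 1024 * (?p powr (1 - 1 / real r) * real n powr (2 - 1 / real r)) \<le> ?x"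
        proof -
          have np4: "0 \<le> n * ?p / 4" using p0 by simp
          have "(1 / 16) * (n * ?p) powr (2 - 1 / real r) \<le> (1 / 4) powr (2 - 1 / real r) * (n * ?p) powr (2 - 1 / real r)"
          proof (rule mult_right_mono)
            have "(1 / 4) powr 2 \<le> (1 / 4 :: real) powr (2 - 1 / real r)" using i12 by (intro powr_mono') auto
            thus "1 / 16 \<le> (1 / 4 :: real) powr (2 - 1 / real r)" by (simp add: power2_eq_square)
          qed simp
          also have "\<dots> = (1 / 4 * (n * ?p)) powr (2 - 1 / real r)" by (rule powr_mult[symmetric])
          also have "\<dots> \<le> real m powr (2 - 1 / real r)" using m1 np4 i12 by (intro powr_mono2) auto
          finally have e1: "c * ((1 / 16) * (n * ?p) powr (2 - 1 / real r)) \<le> real (card D)"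
            using exm c cD by (smt (verit) mult_left_mono)
          have "(n * ?p) powr (2 - 1 / real r) = n powr (2 - 1 / real r) * ?p powr (2 - 1 / real r)"
            by (rule powr_mult)
          also have "?p powr (2 - 1 / real r) = ?p powr (1 + (1 - 1 / real r))" by (simp add: algebra_simps)
          also have "\<dots> = ?p * ?p powr (1 - 1 / real r)" using p0 by (simp only: powr_add) simp
          finally have e2: "(n * ?p) powr (2 - 1 / real r) = ?p * (?p powr (1 - 1 / real r) * n powr (2 - 1 / real r))"
            by simp
          define Z where "Z = ?p powr (1 - 1 / real r) * real n powr (2 - 1 / real r)"
          have Z0: "0 \<le> Z" by (simp add: Z_def)
          have e3: "c / 16 * (?p * Z) \<le> real (card D)" using e1 by (simp add: e2 Z_def)
          have "c / 1024 * Z = (c / 16 * Z) * (1 / 4) / 16" by simp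
          also have "\<dots> \<le> (c / 16 * Z) * (b * ?p) / 16"
            using pb1 c Z0 by (intro divide_right_mono mult_left_mono) auto
          also have "\<dots> = (c / 16 * (?p * Z)) * b / 16" by simp
          also have "\<dots> \<le> real (card D) * b / 16" using e3 by (intro divide_right_mono mult_right_mono) auto
          finally show ?thesis by (simp add: Z_def)
        qed
        have "measure_pmf.prob (random_graph n ?p)
             {G. \<not> c / 1024 * (?p powr (1 - 1 / real r) * real n powr (2 - 1 / real r)) \<le> real (ex_in G F)}
          = measure_pmf.prob ?P ((\<lambda>\<omega>. ({..<n}, {e \<in> all_edges n. \<omega> e})) -`
             {G. \<not> c / 1024 * (?p powr (1 - 1 / real r) * real n powr (2 - 1 / real r)) \<le> real (ex_in G F)})"
          by (simp only: random_graph_def measure_map_pmf)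
        also have "\<dots> \<le> measure_pmf.prob ?P {\<omega>. real (card (thinned b D {f\<in>all_edges n. \<omega> f})) < ?x}"
        proof (rule measure_pmf.finite_measure_mono)
          show "(\<lambda>\<omega>. ({..<n}, {e \<in> all_edges n. \<omega> e})) -`
             {G. \<not> c / 1024 * (?p powr (1 - 1 / real r) * real n powr (2 - 1 / real r)) \<le> real (ex_in G F)}
             \<subseteq> {\<omega>. real (card (thinned b D {f\<in>all_edges n. \<omega> f})) < ?x}"
          proof
            fix \<omega> assume \<omega>: "\<omega> \<in> (\<lambda>\<omega>. ({..<n}, {e \<in> all_edges n. \<omega> e})) -`
             {G. \<not> c / 1024 * (?p powr (1 - 1 / real r) * real n powr (2 - 1 / real r)) \<le> real (ex_in G F)}"
            let ?A = "{e \<in> all_edges n. \<omega> e}"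
            let ?G = "({..<n}, ?A)"
            let ?H = "({..<n}, thinned b D ?A)"
            have sub: "thinned b D ?A \<subseteq> ?A" by (auto simp: thinned_def isolated_def)
            have "subgraph ?H ?G" using sub
              by (auto simp: subgraph_def simple_graph_def all_edges_def)
            moreover have "free_of F ?H"
            proof
              assume "contains_copy ?H F"
              from contains_copy_trans[OF simple_complete_bipartite this K]
              show False using thinned_free[OF _ t1 D Dfree] r by auto
            qed
            ultimately have "card (thinned b D ?A) \<le> ex_in ?G F"
              using ex_in_bounds(1)[of ?G ?H F] by simp
            thus "\<omega> \<in> {\<omega>. real (card (thinned b D {f\<in>all_edges n. \<omega> f})) < ?x}" using \<omega> x_ge by auto
          qed
        qed simp
        also have "\<dots> \<le> exp (- real (card D) / 128)"
          using D Dne b0 p0 p01 pb1 pb2 by (intro thinned_concentration) (auto simp: m_def)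
        also have "\<dots> \<le> exp (- (c / 512) * ln (real n))"
        proof -
          have "c / 512 * ln n \<le> c / 512 * (n * ?p)" using np c by (intro mult_left_mono) auto
          also have "\<dots> = c / 128 * (n * ?p / 4)" by simp
          also have "\<dots> \<le> c / 128 * m" using m1 c by (intro mult_left_mono) auto
          also have "\<dots> = c * m powr 1 / 128" using mN by simp
          also have "\<dots> \<le> c * m powr (2 - 1 / real r) / 128"
            using mN i12 c by (intro divide_right_mono mult_left_mono powr_mono) auto
          also have "\<dots> \<le> card D / 128" using exm cD by simp
          finally show ?thesis by simp
        qed
        finally show ?case .
      qed
    qed
  qed
qed

section \<open>The theorem\<close>

lemma aas_conj:
  assumes "aas M A" "aas M B"
  shows "aas M (\<lambda>n x. A n x \<and> B n x)"
  unfolding aas_def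
proof (rule tendsto_sandwich)
  have "measure_pmf.prob (M n) {x. A n x} + measure_pmf.prob (M n) {x. B n x} - 1 \<le> measure_pmf.prob (M n) {x. A n x \<and> B n x}" for n
  proof -
    have "measure_pmf.prob (M n) {x. A n x} \<le> measure_pmf.prob (M n) ({x. A n x \<and> B n x} \<union> {x. \<not> B n x})"
      by (intro measure_pmf.finite_measure_mono) auto
    also have "\<dots> \<le> measure_pmf.prob (M n) {x. A n x \<and> B n x} + measure_pmf.prob (M n) {x. \<not> B n x}"
      by (rule measure_Un_le) auto
    also have "measure_pmf.prob (M n) {x. \<not> B n x} = 1 - measure_pmf.prob (M n) {x. B n x}"
      using measure_pmf.prob_compl[of "{x. B n x}" "M n"] by (simp add: Compl_eq Diff_eq)
    finally show ?thesis by simp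
  qed
  thus "\<forall>\<^sub>F n in sequentially. measure_pmf.prob (M n) {x. A n x} + measure_pmf.prob (M n) {x. B n x} - 1
     \<le> measure_pmf.prob (M n) {x. A n x \<and> B n x}" by simp
  show "(\<lambda>n. measure_pmf.prob (M n) {x. A n x} + measure_pmf.prob (M n) {x. B n x} - 1) \<longlonglongrightarrow> 1"
    using tendsto_diff[OF tendsto_add[OF assms[unfolded aas_def]] tendsto_const[of 1]] by simp
  show "\<forall>\<^sub>F n in sequentially. measure_pmf.prob (M n) {x. A n x \<and> B n x} \<le> 1" by simp
qed (rule tendsto_const)

lemma aas_mono: "aas M A \<Longrightarrow> (\<And>n x. A n x \<Longrightarrow> B n x) \<Longrightarrow> aas M B"
  unfolding aas_def
proof (rule tendsto_sandwich)
  assume "\<And>n x. A n x \<Longrightarrow> B n x"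
  thus "\<forall>\<^sub>F n in sequentially. measure_pmf.prob (M n) {x. A n x} \<le> measure_pmf.prob (M n) {x. B n x}"
    by (intro always_eventually allI measure_pmf.finite_measure_mono) auto
  show "\<forall>\<^sub>F n in sequentially. measure_pmf.prob (M n) {x. B n x} \<le> 1" by simp
qed (auto intro: tendsto_const)

theorem theorem2p1:
  fixes F :: "'a graph" and S T :: "'a set" and v :: 'a and r \<Delta> :: nat
  assumes "simple_graph F"
    and "r \<ge> 2" and "\<Delta> \<ge> 2"
    and "bipartition F S T"
    and "v \<in> T"
    and "\<forall>w\<in>T - {v}. vertex_degree F w \<le> r"
    and "\<forall>u\<in>S. card (neighbours F u \<union> {v}) \<le> \<Delta>"
  shows "\<exists>C::real.
    (\<exists>K>0. \<forall>p. admissible_prob r \<Delta> C p \<longrightarrow>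
       aas (\<lambda>n. random_graph n (p n))
         (\<lambda>n G. real (ex_in G F) \<le> K * (p n powr (1 - 1 / real r) * real n powr (2 - 1 / real r))))
    \<and> ((\<exists>t. contains_copy F (complete_bipartite r t) \<and>
            (\<lambda>n. real (ex_number n (complete_bipartite r t))) \<in> \<Theta>(\<lambda>n. real n powr (2 - 1 / real r)))
        \<longrightarrow> (\<exists>K>0. \<forall>p. admissible_prob r \<Delta> C p \<longrightarrow>
              aas (\<lambda>n. random_graph n (p n))
                (\<lambda>n G. inverse K * (p n powr (1 - 1 / real r) * real n powr (2 - 1 / real r))
                          \<le> real (ex_in G F) \<and>
                       real (ex_in G F)
                          \<le> K * (p n powr (1 - 1 / real r) * real n powr (2 - 1 / real r)))))"
proof (rule exI[of _ 4], intro conjI impI)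
  show upper: "\<exists>K>0. \<forall>p. admissible_prob r \<Delta> 4 p \<longrightarrow>
       aas (\<lambda>n. random_graph n (p n))
         (\<lambda>n G. real (ex_in G F) \<le> K * (p n powr (1 - 1 / real r) * real n powr (2 - 1 / real r)))"
    by (rule upper_bound[OF assms])
  assume "\<exists>t. contains_copy F (complete_bipartite r t) \<and>
            (\<lambda>n. real (ex_number n (complete_bipartite r t))) \<in> \<Theta>(\<lambda>n. real n powr (2 - 1 / real r))"
  then obtain t where t: "contains_copy F (complete_bipartite r t)"
    "(\<lambda>n. real (ex_number n (complete_bipartite r t))) \<in> \<Theta>(\<lambda>n. real n powr (2 - 1 / real r))" by blast
  have D1: "1 \<le> \<Delta>" using assms(3) by simp
  obtain K :: real where K: "0 < K" and up: "\<And>p. admissible_prob r \<Delta> 4 p \<Longrightarrow> aas (\<lambda>n. random_graph n (p n))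
         (\<lambda>n G. real (ex_in G F) \<le> K * (p n powr (1 - 1 / real r) * real n powr (2 - 1 / real r)))"
    using upper by blast
  obtain k :: real where k: "0 < k" and low: "\<And>p. admissible_prob r \<Delta> 4 p \<Longrightarrow> aas (\<lambda>n. random_graph n (p n))
         (\<lambda>n G. k * (p n powr (1 - 1 / real r) * real n powr (2 - 1 / real r)) \<le> real (ex_in G F))"
    using lower_bound[OF assms(2) D1 t] by blast
  define L where "L = max K (inverse k)"
  have L: "0 < L" "K \<le> L" "inverse L \<le> k"
  proof -
    show "0 < L" "K \<le> L" using K by (auto simp: L_def)
    have "inverse L \<le> inverse (inverse k)" using k by (intro le_imp_inverse_le) (auto simp: L_def)
    thus "inverse L \<le> k" by simp
  qed
  show "\<exists>K>0. \<forall>p. admissible_prob r \<Delta> 4 p \<longrightarrow>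
              aas (\<lambda>n. random_graph n (p n))
                (\<lambda>n G. inverse K * (p n powr (1 - 1 / real r) * real n powr (2 - 1 / real r))
                          \<le> real (ex_in G F) \<and>
                       real (ex_in G F)
                          \<le> K * (p n powr (1 - 1 / real r) * real n powr (2 - 1 / real r)))"
  proof (intro exI[of _ L] conjI allI impI)
    show "0 < L" by (rule L(1))
    fix p assume adm: "admissible_prob r \<Delta> 4 p"
    show "aas (\<lambda>n. random_graph n (p n))
                (\<lambda>n G. inverse L * (p n powr (1 - 1 / real r) * real n powr (2 - 1 / real r))
                          \<le> real (ex_in G F) \<and>
                       real (ex_in G F)
                          \<le> L * (p n powr (1 - 1 / real r) * real n powr (2 - 1 / real r)))"
    proof (rule aas_mono[OF aas_conj[OF low[OF adm] up[OF adm]]])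
      fix n and G :: "nat graph"
      let ?z = "p n powr (1 - 1 / real r) * real n powr (2 - 1 / real r)"
      have z: "0 \<le> ?z" by simp
      assume "k * ?z \<le> real (ex_in G F) \<and> real (ex_in G F) \<le> K * ?z"
      thus "inverse L * ?z \<le> real (ex_in G F) \<and> real (ex_in G F) \<le> L * ?z"
        using mult_right_mono[OF L(3) z] mult_right_mono[OF L(2) z] by linarith
    qed
  qed
qed

end
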